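(* Let $\mathbb{K}$ be a field of characteristic zero and let $Q$ be a finite quiver without isolated points. (i) $Z(\mathbb{K}Q_{\geq 1})$ is the direct sum of the centers of the principal subalgebras associated to the algebraically connected components of $Q$. If $Q$ is algebraically connected, then $$Z(\mathbb{K}Q_{\geq 1}) = \operatorname{span}\{\text{non-trivial paths of } Q \text{ which are two-sided-unextendable}\},$$ except if $Q$ is an $n$-circle $C_n$ with arrows $\{a_1, \dots, a_n\}$ for some $n\ge1$; in this case, $$Z(\mathbb{K}Q_{\geq 1}) = \left\{ \sum_{i=1}^n f(c_i) \,\bigg|\, f(x) \in \mathbb{K}[x],\ f(0)=0 \right\},$$ where $c_i = a_i a_{i+1} \cdots a_n a_1 \cdots a_{i-1}$ for $i=1,2,\dots,n$, and this is isomorphic to the subalgebra of $\mathbb{K}[x]$ consisting of all polynomials with zero constant term. (ii) $Z_3(\mathbb{K}Q_{\geq 1})$ is the direct sum of the 3-centers of the principal subalgebras associated to the algebraically connected components of $Q$. If $Q$ is algebraically connected, then $$Z_3(\mathbb{K}Q_{\geq 1}) = \operatorname{span}\{\text{non-trivial paths of } Q \text{ which satisfy property } ( * )\},$$ except if $Q$ is a $1$-circle $C_1$; in this case, $Z_3(\mathbb{K}Q_{\geq 1}) = \mathbb{K}Q_{\geq 1}$, which is (isomorphic to) the subalgebra of $\mathbb{K}[x]$ consisting of all polynomials with zero constant term.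
   Context: Quivers and algebras. A quiver $Q=(Q_0,Q_1,s,t)$ consists of a finite non-empty set $Q_0$ of vertices, a finite non-empty set $Q_1$ of arrows, and maps $s,t:Q_1\to Q_0$ (starting and terminal vertex). An isolated point is a vertex that is neither the start nor the end of an arrow. A non-trivial path of length $n\ge 1$ is a sequence $p=\alpha_1\cdots\alpha_n$ of arrows with $t(\alpha_i)=s(\alpha_{i+1})$; $s(p)=s(\alpha_1)$, $t(p)=t(\alpha_n)$. The principal subalgebra $\mathbb{K}Q_{\ge 1}$ is the (non-unital) $\mathbb{K}$-algebra with basis all non-trivial paths of $Q$; the product of paths $p,q$ is the concatenation $pq$ if $t(p)=s(q)$ and $0$ otherwise. A loop is an arrow $a$ with $s(a)=t(a)$. The $n$-circle $C_n$ ($n\ge1$) is the quiver with $n$ vertices $1,\dots,n$ and $n$ arrows $a_1,\dots,a_n$ with $s(a_i)=i$ for all $i$, $t(a_i)=i+1$ for $i<n$ and $t(a_n)=1$. Algebraic connectivity. A finite quiver $Q$ without isolated points is algebraically connected if $\mathbb{K}Q_{\ge1}$ is not isomorphic to a direct sum of more than one principal subalgebra of path algebras of quivers. If $Q$ is not algebraically connected, one can write $\mathbb{K}Q_{\ge 1}\cong\bigoplus_{i}\mathbb{K}(E_i)_{\ge1}$ with each $E_i$ a finite algebraically connected subquiver of $Q$; the $E_i$ are the algebraically connected components of $Q$. Centers. $Z(A)$ is the center of an algebra $A$. With $St_3(x_1,x_2,x_3)=\sum_{\sigma\in S_3}\operatorname{sgn}(\sigma)x_{\sigma(1)}x_{\sigma(2)}x_{\sigma(3)}$,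 the 3-center $Z_3(A)$ is the set of $a\in A$ (the $St_3$-elements) such that $St_3(a,b,c)=0$ for all $b,c\in A$. Path properties. A path $p$ is two-sided-unextendable if there is no arrow $a$ with $ap\ne0$ and no arrow $a$ with $pa\neq0$. A triple $(a,b,c)$ of elements of an algebra is non-trivial if at least one of the six products of $a,b,c$ in some order (the six monomials of $St_3(a,b,c)$) is non-zero (entries of the triple are allowed to coincide). A non-trivial path $p$ of $Q$ satisfies property $( * )$ if either there do not exist two distinct arrows $a_1\ne a_2$ of $Q$ such that $(p,a_1,a_2)$ is a non-trivial triple (here $p$ may equal $a_1$ or $a_2$), or $p=c_1^k$ for some $k\ge1$ where $Q$ is one of the following: (1) a loop $c_1$ at a vertex $1$ and no other arrows; (2) a loop $c_1$ at a vertex $1$ together with some arrows with terminal vertex $1$ that are not loops, and no other arrows; (3) a loop $c_1$ at a vertex $1$ together with some arrows with starting vertex $1$ that are not loops, and no other arrows. *)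

theory Defs
  imports
    "Graph_Theory.Graph_Theory"
    "HOL-Library.Poly_Mapping"
    "HOL-Library.Function_Algebras"
    "HOL-Combinatorics.Permutations"
    "HOL-Computational_Algebra.Polynomial"
begin

section \<open>Algebras without unit\<close>

text \<open>
  The elements of an algebra form a subset of a type that is already an abelian group; only the
  carrier, the product and the action of the field are recorded. The product and the scalar
  action are used on the carrier only.
\<close>

record ('k, 'x) nu_alg =
  car :: "'x set"
  mult :: "'x \<Rightarrow> 'x \<Rightarrow> 'x"
  scale :: "'k \<Rightarrow> 'x \<Rightarrow> 'x"

definition alg_iso ::
  "('x \<Rightarrow> 'y) \<Rightarrow> ('k, 'x::ab_group_add) nu_alg \<Rightarrow> ('k, 'y::ab_group_add) nu_alg \<Rightarrow> bool" where
  "alg_iso \<phi> A B \<longleftrightarrow>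
     bij_betw \<phi> (car A) (car B) \<and>
     (\<forall>x\<in>car A. \<forall>y\<in>car A. \<phi> (x + y) = \<phi> x + \<phi> y) \<and>
     (\<forall>x\<in>car A. \<forall>y\<in>car A. \<phi> (mult A x y) = mult B (\<phi> x) (\<phi> y)) \<and>
     (\<forall>c. \<forall>x\<in>car A. \<phi> (scale A c x) = scale B c (\<phi> x))"

definition alg_isomorphic ::
  "('k, 'x::ab_group_add) nu_alg \<Rightarrow> ('k, 'y::ab_group_add) nu_alg \<Rightarrow> bool" where
  "alg_isomorphic A B \<longleftrightarrow> (\<exists>\<phi>. alg_iso \<phi> A B)"

text \<open>
  The direct sum of \<open>A 0, \<dots>, A (n - 1)\<close>: families that vanish outside \<open>{..<n}\<close>, so that the
  pointwise addition of functions is the addition of the direct sum.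
\<close>

definition direct_sum ::
  "nat \<Rightarrow> (nat \<Rightarrow> ('k, 'x::ab_group_add) nu_alg) \<Rightarrow> ('k, nat \<Rightarrow> 'x) nu_alg" where
  "direct_sum n A = \<lparr>
     car = {x. (\<forall>i<n. x i \<in> car (A i)) \<and> (\<forall>i\<ge>n. x i = 0)},
     mult = (\<lambda>x y i. if i < n then mult (A i) (x i) (y i) else 0),
     scale = (\<lambda>c x i. if i < n then scale (A i) c (x i) else 0)\<rparr>"

definition center :: "('k, 'x) nu_alg \<Rightarrow> 'x set" where
  "center A = {a \<in> car A. \<forall>b\<in>car A. mult A a b = mult A b a}"

definition monomial3 :: "('k, 'x) nu_alg \<Rightarrow> 'x list \<Rightarrow> (nat \<Rightarrow> nat) \<Rightarrow> 'x" where
  "monomial3 A xs \<sigma> = mult A (mult A (xs ! \<sigma> 0) (xs ! \<sigma> 1)) (xs ! \<sigma> 2)"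

definition St3 :: "('k::field, 'x::ab_group_add) nu_alg \<Rightarrow> 'x \<Rightarrow> 'x \<Rightarrow> 'x \<Rightarrow> 'x" where
  "St3 A a b c =
     (\<Sum>\<sigma> | \<sigma> permutes {..<3}. scale A (of_int (sign \<sigma>)) (monomial3 A [a, b, c] \<sigma>))"

definition center3 :: "('k::field, 'x::ab_group_add) nu_alg \<Rightarrow> 'x set" where
  "center3 A = {a \<in> car A. \<forall>b\<in>car A. \<forall>c\<in>car A. St3 A a b c = 0}"

definition nontrivial_triple :: "('k, 'x::ab_group_add) nu_alg \<Rightarrow> 'x \<Rightarrow> 'x \<Rightarrow> 'x \<Rightarrow> bool" where
  "nontrivial_triple A a b c \<longleftrightarrow>
     (\<exists>\<sigma>. \<sigma> permutes {..<3} \<and> monomial3 A [a, b, c] \<sigma> \<noteq> 0)"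

abbreviation alg_span :: "('k::field, 'x::ab_group_add) nu_alg \<Rightarrow> 'x set \<Rightarrow> 'x set" where
  "alg_span A \<equiv> module.span (scale A)"

abbreviation center_alg :: "('k, 'x) nu_alg \<Rightarrow> ('k, 'x) nu_alg" where
  "center_alg A \<equiv> A\<lparr>car := center A\<rparr>"

abbreviation center3_alg ::
  "('k::field, 'x::ab_group_add) nu_alg \<Rightarrow> ('k, 'x) nu_alg" where
  "center3_alg A \<equiv> A\<lparr>car := center3 A\<rparr>"

text \<open>
  In the absence of a unit, powers have exponent \<open>k \<ge> 1\<close> and polynomials are evaluated only if
  their constant term is zero.
\<close>

definition alg_power :: "('k, 'x) nu_alg \<Rightarrow> 'x \<Rightarrow> nat \<Rightarrow> 'x" where
  "alg_power A x k = ((\<lambda>y. mult A y x) ^^ (k - 1)) x"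

definition poly_at :: "('k::field, 'x::ab_group_add) nu_alg \<Rightarrow> 'k poly \<Rightarrow> 'x \<Rightarrow> 'x" where
  "poly_at A f x = (\<Sum>k = 1..degree f. scale A (coeff f k) (alg_power A x k))"

definition polys_no_const :: "'k::field itself \<Rightarrow> ('k, 'k poly) nu_alg" where
  "polys_no_const _ = \<lparr>car = {f. poly f 0 = 0}, mult = (*), scale = smult\<rparr>"

section \<open>Quivers and their principal subalgebras\<close>

locale quiver = fin_digraph +
  assumes verts_nonempty: "verts G \<noteq> {}"
    and arcs_nonempty: "arcs G \<noteq> {}"

definition isolated_point :: "('v, 'a) pre_digraph \<Rightarrow> 'v \<Rightarrow> bool" where
  "isolated_point Q v \<longleftrightarrow> v \<in> verts Q \<and> (\<forall>e\<in>arcs Q. tail Q e \<noteq> v \<and> head Q e \<noteq> v)"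

definition no_isolated_points :: "('v, 'a) pre_digraph \<Rightarrow> bool" where
  "no_isolated_points Q \<longleftrightarrow> (\<forall>v. \<not> isolated_point Q v)"

definition nontrivial_paths :: "('v, 'a) pre_digraph \<Rightarrow> 'a list set" where
  "nontrivial_paths Q = {p. p \<noteq> [] \<and> (\<exists>u v. pre_digraph.awalk Q u p v)}"

definition path_prod ::
  "('v, 'a) pre_digraph \<Rightarrow> ('a list \<Rightarrow>\<^sub>0 'k) \<Rightarrow> ('a list \<Rightarrow>\<^sub>0 'k) \<Rightarrow> ('a list \<Rightarrow>\<^sub>0 'k::field)" where
  "path_prod Q f g =
     (\<Sum>p\<in>Poly_Mapping.keys f. \<Sum>q\<in>Poly_Mapping.keys g.
        if head Q (last p) = tail Q (hd q)
        then Poly_Mapping.single (p @ q) (Poly_Mapping.lookup f p * Poly_Mapping.lookup g q)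
        else 0)"

definition principal_subalg ::
  "'k::field itself \<Rightarrow> ('v, 'a) pre_digraph \<Rightarrow> ('k, 'a list \<Rightarrow>\<^sub>0 'k) nu_alg" where
  "principal_subalg _ Q = \<lparr>
     car = {f. Poly_Mapping.keys f \<subseteq> nontrivial_paths Q},
     mult = path_prod Q,
     scale = (\<lambda>c. Poly_Mapping.map ((*) c))\<rparr>"

abbreviation path_elem :: "'k::field itself \<Rightarrow> 'a list \<Rightarrow> ('a list \<Rightarrow>\<^sub>0 'k)" where
  "path_elem _ p \<equiv> Poly_Mapping.single p 1"

definition circle :: "nat \<Rightarrow> (nat, nat) pre_digraph" where
  "circle n = \<lparr>verts = {1..n}, arcs = {1..n},
     tail = (\<lambda>i. i), head = (\<lambda>i. if i < n then i + 1 else 1)\<rparr>"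

text \<open>The closed path \<open>a i, \<dots>, a n, a 1, \<dots>, a (i - 1)\<close>.\<close>

definition circle_path :: "nat \<Rightarrow> (nat \<Rightarrow> 'a) \<Rightarrow> nat \<Rightarrow> 'a list" where
  "circle_path n a i = map a ([i..<n + 1] @ [1..<i])"

section \<open>Algebraic connectivity\<close>

text \<open>
  Every finite quiver is isomorphic to one whose vertices and arrows are natural numbers, so it
  is no restriction that the summands come from such quivers.
\<close>

definition alg_connected :: "'k::field itself \<Rightarrow> ('v, 'a) pre_digraph \<Rightarrow> bool" where
  "alg_connected K Q \<longleftrightarrow>
     \<not> (\<exists>n (F :: nat \<Rightarrow> (nat, nat) pre_digraph). n \<ge> 2 \<and> (\<forall>i<n. quiver (F i)) \<and>
          alg_isomorphic (principal_subalg K Q) (direct_sum n (\<lambda>i. principal_subalg K (F i))))"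

definition alg_components ::
  "'k::field itself \<Rightarrow> ('v, 'a) pre_digraph \<Rightarrow> nat \<Rightarrow> (nat \<Rightarrow> ('v, 'a) pre_digraph) \<Rightarrow> bool" where
  "alg_components K Q n E \<longleftrightarrow>
     (\<forall>i<n. subgraph (E i) Q \<and> quiver (E i) \<and> no_isolated_points (E i) \<and> alg_connected K (E i)) \<and>
     alg_isomorphic (principal_subalg K Q) (direct_sum n (\<lambda>i. principal_subalg K (E i)))"

section \<open>Properties of paths\<close>

definition two_sided_unextendable :: "'k::field itself \<Rightarrow> ('v, 'a) pre_digraph \<Rightarrow> 'a list \<Rightarrow> bool" where
  "two_sided_unextendable K Q p \<longleftrightarrow>
     \<not> (\<exists>a\<in>arcs Q. mult (principal_subalg K Q) (path_elem K [a]) (path_elem K p) \<noteq> 0) \<and>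
     \<not> (\<exists>a\<in>arcs Q. mult (principal_subalg K Q) (path_elem K p) (path_elem K [a]) \<noteq> 0)"

text \<open>
  The second alternative is the union of three classes of quivers: the loop \<open>c\<close> is the only arrow,
  or all other arrows are non-loops ending, respectively starting, at the vertex of \<open>c\<close>.
\<close>

definition property_star :: "'k::field itself \<Rightarrow> ('v, 'a) pre_digraph \<Rightarrow> 'a list \<Rightarrow> bool" where
  "property_star K Q p \<longleftrightarrow>
     \<not> (\<exists>a1\<in>arcs Q. \<exists>a2\<in>arcs Q. a1 \<noteq> a2 \<and>
          nontrivial_triple (principal_subalg K Q) (path_elem K p) (path_elem K [a1]) (path_elem K [a2])) \<or>
     (\<exists>c\<in>arcs Q. \<exists>k\<ge>1. p = replicate k c \<and> tail Q c = head Q c \<and>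
        (arcs Q = {c} \<or>
         (\<forall>b\<in>arcs Q - {c}. head Q b = head Q c \<and> tail Q b \<noteq> head Q b) \<or>
         (\<forall>b\<in>arcs Q - {c}. tail Q b = tail Q c \<and> tail Q b \<noteq> head Q b)))"

end

theory Submission
  imports Defs
begin

text \<open>
  A path extendable by an arrow \<open>a\<close> that occurs in a central element \<open>f\<close> must
  start with \<open>a\<close>: compare the coefficients of \<open>f a\<close> and \<open>a f\<close>. So it is closed, its rotations occur
  too, and its vertices have a single incoming and a single outgoing arrow; connectivity makes the quiver
  a circle. For the 3-center, coefficients of \<open>St\<^sub>3(f, q, r)\<close> for suitable paths \<open>q\<close> and \<open>r\<close> give linear
  equations that kill every path without property \<open>(*)\<close>.

  Algebraic connectivity means that any two arrows are linked by a chain of arrows in which neighbours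
  compose in some order. If the algebra splits into ideals annihilating each other, the linear parts
  of the ideals label the arrows, and composable arrows share one label; an ideal without linear
  part consists of sums of products, which is impossible for a sum of principal subalgebras.
\<close>

section \<open>Isomorphisms, direct sums and centers\<close>

text \<open>The link between products and words is \<open>flank\<close>: at a fixed word
  \<open>w\<close>, a product \<open>u f v\<close> reads off at most one coefficient of
  \<open>f\<close>, that of the middle factor, which must be non-empty because there are no trivial
  paths. Test words are chosen so that the first or last arrow excludes most factorizations. For the
  3-center some equations leave only 2x = 0, or 2x = y together with 2y = x; characteristic zero
  cancels the factors 2 and 3.

  Algebraic connectivity speaks of arbitrary isomorphisms and gives no hold on paths, hence the
  combinatorial substitute \<open>arc_connected\<close>. The labelling argument leaves one case
  open: both ideals may contribute to every arrow. Then no two arrows compose, connectivity leaves a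
  single arrow, and a one-dimensional algebra has no two non-zero ideals with zero intersection.

  The claims about components are formal: every isomorphism restricts to centers, and centers of
  direct sums are formed componentwise. As \<open>nu_alg\<close> imposes no axioms, the closure of
  the carrier needed for this is the separate predicate \<open>closed_alg\<close>.\<close>

definition closed_alg :: "('k, 'x::ab_group_add) nu_alg \<Rightarrow> bool" where
  "closed_alg A \<longleftrightarrow> 0 \<in> car A \<and> (\<forall>x\<in>car A. \<forall>y\<in>car A. x + y \<in> car A) \<and>
     (\<forall>x\<in>car A. \<forall>y\<in>car A. mult A x y \<in> car A) \<and> (\<forall>c. \<forall>x\<in>car A. scale A c x \<in> car A)"

lemma closed_algD:
  assumes "closed_alg A"
  shows "0 \<in> car A" "\<And>x y. x \<in> car A \<Longrightarrow> y \<in> car A \<Longrightarrow> x + y \<in> car A"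
    "\<And>x y. x \<in> car A \<Longrightarrow> y \<in> car A \<Longrightarrow> mult A x y \<in> car A"
    "\<And>c x. x \<in> car A \<Longrightarrow> scale A c x \<in> car A"
  using assms by (auto simp: closed_alg_def)

lemma closed_alg_sum:
  assumes "closed_alg A" "\<And>i. i \<in> I \<Longrightarrow> x i \<in> car A"
  shows "(\<Sum>i\<in>I. x i) \<in> car A"
  using assms(2)
  by (induction I rule: infinite_finite_induct) (auto intro: closed_algD[OF assms(1)])

lemma alg_isoD:
  assumes "alg_iso \<phi> A B"
  shows "bij_betw \<phi> (car A) (car B)"
    "\<And>x y. x \<in> car A \<Longrightarrow> y \<in> car A \<Longrightarrow> \<phi> (x + y) = \<phi> x + \<phi> y"
    "\<And>x y. x \<in> car A \<Longrightarrow> y \<in> car A \<Longrightarrow> \<phi> (mult A x y) = mult B (\<phi> x) (\<phi> y)"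
    "\<And>c x. x \<in> car A \<Longrightarrow> \<phi> (scale A c x) = scale B c (\<phi> x)"
    "\<And>x. x \<in> car A \<Longrightarrow> \<phi> x \<in> car B"
  using assms by (auto simp: alg_iso_def bij_betw_def)

lemma alg_iso_zero:
  assumes "alg_iso \<phi> A B" "closed_alg A"
  shows "\<phi> 0 = 0"
  using alg_isoD(2)[OF assms(1), of 0 0] closed_algD(1)[OF assms(2)] by simp

lemma alg_iso_sum:
  assumes "alg_iso \<phi> A B" "closed_alg A" "\<And>i. i \<in> I \<Longrightarrow> x i \<in> car A"
  shows "\<phi> (\<Sum>i\<in>I. x i) = (\<Sum>i\<in>I. \<phi> (x i))"
  using assms(3)
proof (induction I rule: infinite_finite_induct)
  case (insert i I)
  then have "(\<Sum>i\<in>I. x i) \<in> car A" by (intro closed_alg_sum[OF assms(2)]) auto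
  with insert show ?case using alg_isoD(2)[OF assms(1)] by simp
qed (auto simp: alg_iso_zero[OF assms(1,2)])

lemma alg_iso_inv:
  assumes iso: "alg_iso \<phi> A B" and A: "closed_alg A"
  shows "alg_iso (inv_into (car A) \<phi>) B A"
proof -
  let ?\<psi> = "inv_into (car A) \<phi>"
  note bij = alg_isoD(1)[OF iso]
  have \<psi>\<phi>: "?\<psi> (\<phi> x) = x" if "x \<in> car A" for x
    using bij that by (simp add: bij_betw_def)
  have ex: "\<exists>x'\<in>car A. x = \<phi> x'" if "x \<in> car B" for x
    using bij that by (auto simp: bij_betw_def)
  show ?thesis
    unfolding alg_iso_def
  proof (intro conjI ballI allI)
    show "bij_betw ?\<psi> (car B) (car A)" using bij by (rule bij_betw_inv_into)
  next
    fix x y assume "x \<in> car B" "y \<in> car B"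
    then obtain x' y' where *: "x' \<in> car A" "y' \<in> car A" "x = \<phi> x'" "y = \<phi> y'" using ex by meson
    then show "?\<psi> (x + y) = ?\<psi> x + ?\<psi> y"
      using alg_isoD(2)[OF iso *(1,2)] \<psi>\<phi> closed_algD(2)[OF A] by metis
  next
    fix x y assume "x \<in> car B" "y \<in> car B"
    then obtain x' y' where *: "x' \<in> car A" "y' \<in> car A" "x = \<phi> x'" "y = \<phi> y'" using ex by meson
    then show "?\<psi> (mult B x y) = mult A (?\<psi> x) (?\<psi> y)"
      using alg_isoD(3)[OF iso *(1,2)] \<psi>\<phi> closed_algD(3)[OF A] by metis
  next
    fix c x assume "x \<in> car B"
    then obtain x' where *: "x' \<in> car A" "x = \<phi> x'" using ex by meson
    then show "?\<psi> (scale B c x) = scale A c (?\<psi> x)"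
      using alg_isoD(4)[OF iso *(1)] \<psi>\<phi> closed_algD(4)[OF A] by metis
  qed
qed

lemma alg_iso_restrict:
  assumes "alg_iso \<phi> A B" "X \<subseteq> car A" "\<phi> ` X = Y"
  shows "alg_iso \<phi> (A\<lparr>car := X\<rparr>) (B\<lparr>car := Y\<rparr>)"
  using assms unfolding alg_iso_def
  by (auto simp: bij_betw_def inj_on_def subset_iff)

lemma image_restrict_eqI:
  assumes "\<phi> ` X = Y" "C \<subseteq> X" "C' \<subseteq> Y" "\<And>a. a \<in> X \<Longrightarrow> \<phi> a \<in> C' \<longleftrightarrow> a \<in> C"
  shows "\<phi> ` C = C'"
  using assms by blast

lemma alg_iso_center:
  assumes iso: "alg_iso \<phi> A B" and A: "closed_alg A"
  shows "alg_iso \<phi> (center_alg A) (center_alg B)"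
proof (rule alg_iso_restrict[OF iso])
  show "center A \<subseteq> car A" by (auto simp: center_def)
  have inj: "inj_on \<phi> (car A)" and im: "\<phi> ` car A = car B"
    using alg_isoD(1)[OF iso] by (auto simp: bij_betw_def)
  have "\<phi> a \<in> center B \<longleftrightarrow> a \<in> center A" if "a \<in> car A" for a
  proof -
    have "mult A a b = mult A b a \<longleftrightarrow> mult B (\<phi> a) (\<phi> b) = mult B (\<phi> b) (\<phi> a)" if b: "b \<in> car A" for b
      using inj_on_eq_iff[OF inj closed_algD(3)[OF A \<open>a \<in> car A\<close> b] closed_algD(3)[OF A b \<open>a \<in> car A\<close>]]
      by (simp add: alg_isoD(3)[OF iso] that \<open>a \<in> car A\<close>)
    then show ?thesis using that unfolding center_def im[symmetric] by auto
  qed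
  then show "\<phi> ` center A = center B"
    by (intro image_restrict_eqI[OF im]) (auto simp: center_def)
qed

lemma permutes_3_nth:
  assumes "\<sigma> permutes {..<3}" "j < 3"
  shows "[a, b, c] ! \<sigma> j \<in> {a, b, c}"
proof -
  have "\<sigma> j < 3" using permutes_in_image[OF assms(1), of j] assms(2) by simp
  then have "\<sigma> j = 0 \<or> \<sigma> j = 1 \<or> \<sigma> j = 2" by arith
  then show ?thesis by auto
qed

lemma monomial3_closed:
  assumes "closed_alg A" "a \<in> car A" "b \<in> car A" "c \<in> car A" "\<sigma> permutes {..<3}"
  shows "monomial3 A [a, b, c] \<sigma> \<in> car A"
proof -
  have "[a, b, c] ! \<sigma> j \<in> car A" if "j < 3" for j
    using permutes_3_nth[OF assms(5) that, of a b c] assms by auto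
  then show ?thesis unfolding monomial3_def by (intro closed_algD[OF assms(1)]) auto
qed

lemma St3_closed:
  assumes "closed_alg A" "a \<in> car A" "b \<in> car A" "c \<in> car A"
  shows "St3 A a b c \<in> car A"
  unfolding St3_def
  using assms by (intro closed_alg_sum closed_algD(4) monomial3_closed) auto

lemma alg_iso_St3:
  assumes iso: "alg_iso \<phi> A B" and A: "closed_alg A" and car: "a \<in> car A" "b \<in> car A" "c \<in> car A"
  shows "\<phi> (St3 A a b c) = St3 B (\<phi> a) (\<phi> b) (\<phi> c)"
proof -
  have "\<phi> (monomial3 A [a, b, c] \<sigma>) = monomial3 B [\<phi> a, \<phi> b, \<phi> c] \<sigma>" if \<sigma>: "\<sigma> permutes {..<3}" for \<sigma>
  proof -
    have in_A: "[a, b, c] ! \<sigma> j \<in> car A" if "j < 3" for j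
      using permutes_3_nth[OF \<sigma> that, of a b c] car by auto
    have nth: "\<phi> ([a, b, c] ! \<sigma> j) = [\<phi> a, \<phi> b, \<phi> c] ! \<sigma> j" if "j < 3" for j
    proof -
      have "\<sigma> j < 3" using permutes_in_image[OF \<sigma>, of j] that by simp
      then show ?thesis using nth_map[of "\<sigma> j" "[a, b, c]" \<phi>] by simp
    qed
    show ?thesis unfolding monomial3_def
      using in_A nth by (simp add: alg_isoD(3)[OF iso] closed_algD(3)[OF A])
  qed
  then show ?thesis unfolding St3_def
    by (subst alg_iso_sum[OF iso A])
       (auto intro!: closed_algD(4)[OF A] monomial3_closed[OF A] car sum.cong
             simp: alg_isoD(4)[OF iso] monomial3_closed[OF A] car)
qed

lemma alg_iso_center3:
  assumes iso: "alg_iso \<phi> A B" and A: "closed_alg A"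
  shows "alg_iso \<phi> (center3_alg A) (center3_alg B)"
proof (rule alg_iso_restrict[OF iso])
  show "center3 A \<subseteq> car A" by (auto simp: center3_def)
  have inj: "inj_on \<phi> (car A)" and im: "\<phi> ` car A = car B"
    using alg_isoD(1)[OF iso] by (auto simp: bij_betw_def)
  have "\<phi> a \<in> center3 B \<longleftrightarrow> a \<in> center3 A" if a: "a \<in> car A" for a
  proof -
    have "St3 A a b c = 0 \<longleftrightarrow> St3 B (\<phi> a) (\<phi> b) (\<phi> c) = 0" if "b \<in> car A" "c \<in> car A" for b c
      using inj_on_eq_iff[OF inj St3_closed[OF A a that] closed_algD(1)[OF A]]
      by (simp add: alg_iso_St3[OF iso A] alg_iso_zero[OF iso A] a that)
    then show ?thesis using a unfolding center3_def im[symmetric] by auto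
  qed
  then show "\<phi> ` center3 A = center3 B"
    by (intro image_restrict_eqI[OF im]) (auto simp: center3_def)
qed

section \<open>Centers and 3-centers of direct sums\<close>

lemma direct_sum_closed:
  assumes "\<And>i. i < n \<Longrightarrow> closed_alg (A i)"
  shows "closed_alg (direct_sum n A)"
  using closed_algD[OF assms]
  by (auto simp: closed_alg_def direct_sum_def)

lemma sum_fun_apply: "(\<Sum>j\<in>J. f j) i = (\<Sum>j\<in>J. f j i)"
  by (induction J rule: infinite_finite_induct) auto

lemma mult_direct_sum [simp]:
  "mult (direct_sum n A) x y i = (if i < n then mult (A i) (x i) (y i) else 0)"
  by (simp add: direct_sum_def)

lemma scale_direct_sum [simp]:
  "scale (direct_sum n A) c x i = (if i < n then scale (A i) c (x i) else 0)"
  by (simp add: direct_sum_def)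

lemma car_direct_sum:
  "car (direct_sum n A) = {x. (\<forall>i<n. x i \<in> car (A i)) \<and> (\<forall>i\<ge>n. x i = 0)}"
  by (simp add: direct_sum_def)

lemma single_component_in_direct_sum:
  assumes "\<And>j. j < n \<Longrightarrow> closed_alg (A j)" "i < n" "b \<in> car (A i)"
  shows "(\<lambda>j. if j = i then b else 0) \<in> car (direct_sum n A)"
  using assms closed_algD(1) by (auto simp: car_direct_sum)

text \<open>An equality of records rather than of carriers, so that it rewrites directly inside an
  \<open>alg_iso\<close> claim.\<close>

lemma center_direct_sum:
  assumes A: "\<And>i. i < n \<Longrightarrow> closed_alg (A i)"
  shows "center_alg (direct_sum n A) = direct_sum n (\<lambda>i. center_alg (A i))"
proof -
  have comp: "x i \<in> center (A i)" if x: "x \<in> center (direct_sum n A)" and i: "i < n" for x i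
  proof -
    have "mult (A i) (x i) b = mult (A i) b (x i)" if "b \<in> car (A i)" for b
    proof -
      \<comment> \<open>A family concentrated in the summand \<open>i\<close> turns commutation in
        the direct sum into commutation in \<open>A i\<close>.\<close>
      let ?b = "\<lambda>j. if j = i then b else 0"
      have b: "?b \<in> car (direct_sum n A)"
        by (rule single_component_in_direct_sum) (use A i that in auto)
      have "mult (direct_sum n A) x y = mult (direct_sum n A) y x"
        if "y \<in> car (direct_sum n A)" for y
        using x that by (simp add: center_def)
      from fun_cong[OF this[OF b], of i] show ?thesis using i by simp
    qed
    then show ?thesis using x i by (auto simp: center_def car_direct_sum)
  qed
  have "center (direct_sum n A) = {x. (\<forall>i<n. x i \<in> center (A i)) \<and> (\<forall>i\<ge>n. x i = 0)}"
  proof (intro subset_antisym subsetI CollectI conjI allI impI)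
    fix x i assume "x \<in> center (direct_sum n A)" "n \<le> i"
    then show "x i = 0" by (simp add: center_def car_direct_sum)
  qed (auto simp: comp, auto simp: center_def car_direct_sum fun_eq_iff)
  then show ?thesis by (simp add: direct_sum_def cong: if_cong)
qed

lemma monomial3_direct_sum:
  assumes "\<sigma> permutes {..<3}"
  shows "monomial3 (direct_sum n A) [a, b, c] \<sigma> i =
    (if i < n then monomial3 (A i) [a i, b i, c i] \<sigma> else 0)"
proof -
  have nth: "([a, b, c] ! \<sigma> j) i = [a i, b i, c i] ! \<sigma> j" if "j < 3" for j
  proof -
    have "\<sigma> j < 3" using permutes_in_image[OF assms, of j] that by simp
    then show ?thesis using nth_map[of "\<sigma> j" "[a, b, c]" "\<lambda>x. x i"] by simp
  qed
  show ?thesis by (simp add: monomial3_def nth)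
qed

lemma St3_direct_sum:
  "St3 (direct_sum n A) a b c i = (if i < n then St3 (A i) (a i) (b i) (c i) else 0)"
  by (simp add: St3_def sum_fun_apply monomial3_direct_sum)

lemma center3_direct_sum:
  assumes A: "\<And>i. i < n \<Longrightarrow> closed_alg (A i)"
  shows "center3_alg (direct_sum n A) = direct_sum n (\<lambda>i. center3_alg (A i))"
proof -
  have comp: "x i \<in> center3 (A i)" if x: "x \<in> center3 (direct_sum n A)" and i: "i < n" for x i
  proof -
    have "St3 (A i) (x i) b c = 0" if "b \<in> car (A i)" "c \<in> car (A i)" for b c
    proof -
      let ?e = "\<lambda>b j. if j = i then b else 0"
      have e: "?e d \<in> car (direct_sum n A)" if "d \<in> car (A i)" for d
        by (rule single_component_in_direct_sum) (use A i that in auto)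
      have "St3 (direct_sum n A) x y z = 0"
        if "y \<in> car (direct_sum n A)" "z \<in> car (direct_sum n A)" for y z
        using x that by (simp add: center3_def)
      from fun_cong[OF this[OF e[OF \<open>b \<in> car (A i)\<close>] e[OF \<open>c \<in> car (A i)\<close>]], of i] show ?thesis using i by (simp add: St3_direct_sum)
    qed
    then show ?thesis using x i by (auto simp: center3_def car_direct_sum)
  qed
  have "center3 (direct_sum n A) = {x. (\<forall>i<n. x i \<in> center3 (A i)) \<and> (\<forall>i\<ge>n. x i = 0)}"
  proof (intro subset_antisym subsetI CollectI conjI allI impI)
    fix x i assume "x \<in> center3 (direct_sum n A)" "n \<le> i"
    then show "x i = 0" by (simp add: center3_def car_direct_sum)
  qed (auto simp: comp, auto simp: center3_def car_direct_sum fun_eq_iff St3_direct_sum)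
  then show ?thesis by (simp add: direct_sum_def cong: if_cong)
qed

text \<open>The six elements of the symmetric group: identity, three transpositions, two 3-cycles.
  Their order fixes the order of the six terms in all later expansions of
  \<open>St3\<close>.\<close>

definition perms3 :: "(nat \<Rightarrow> nat) list" where
  "perms3 = [id, transpose 0 1, transpose 0 2, transpose 1 2,
     transpose 0 1 \<circ> transpose 1 2, transpose 0 2 \<circ> transpose 1 2]"

lemma distinct_perms3: "distinct perms3"
proof -
  have "distinct (map (\<lambda>\<sigma>. (\<sigma> 0, \<sigma> 1, \<sigma> 2)) perms3)"
    by (simp add: perms3_def transpose_def)
  then show ?thesis by (simp add: distinct_map)
qed

text \<open>The list lies in the symmetric group and has 3! = 6 distinct entries, so counting gives
  equality.\<close>

lemma permutes_lessThan_3: "{\<sigma>. \<sigma> permutes {..<3}} = set perms3"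
proof (rule sym, rule card_subset_eq)
  show "finite {\<sigma>. \<sigma> permutes {..<3::nat}}" by (simp add: finite_permutations)
  show "set perms3 \<subseteq> {\<sigma>. \<sigma> permutes {..<3}}"
    by (auto simp: perms3_def intro!: permutes_swap_id permutes_compose permutes_id)
  have "card (set perms3) = 6" using distinct_card[OF distinct_perms3] by (simp add: perms3_def)
  then show "card (set perms3) = card {\<sigma>. \<sigma> permutes {..<3::nat}}"
    by (simp add: card_permutations[of "{..<3::nat}" 3] fact_numeral)
qed

text \<open>\<open>scale A 1\<close> and \<open>scale A (- 1)\<close> stay symbolic because a bare
  record satisfies no module laws; they are evaluated in \<open>St3_A\<close>.\<close>

lemma St3_expand:
  fixes A :: "('k::field, 'x::ab_group_add) nu_alg" and a b c :: 'x
  shows "St3 A a b c =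
    scale A 1 (mult A (mult A a b) c) + scale A (- 1) (mult A (mult A b a) c)
    + scale A (- 1) (mult A (mult A c b) a) + scale A (- 1) (mult A (mult A a c) b)
    + scale A 1 (mult A (mult A b c) a) + scale A 1 (mult A (mult A c a) b)"
  unfolding St3_def permutes_lessThan_3 sum.distinct_set_conv_list[OF distinct_perms3]
  by (simp add: perms3_def sign_compose sign_swap_id monomial3_def transpose_def
        permutation_swap_id add.assoc)

lemma nontrivial_triple_iff:
  "nontrivial_triple A a b c \<longleftrightarrow>
    mult A (mult A a b) c \<noteq> 0 \<or> mult A (mult A b a) c \<noteq> 0 \<or>
    mult A (mult A c b) a \<noteq> 0 \<or> mult A (mult A a c) b \<noteq> 0 \<or>
    mult A (mult A b c) a \<noteq> 0 \<or> mult A (mult A c a) b \<noteq> 0"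
proof -
  have "nontrivial_triple A a b c \<longleftrightarrow> (\<exists>\<sigma>\<in>set perms3. monomial3 A [a, b, c] \<sigma> \<noteq> 0)"
    unfolding nontrivial_triple_def permutes_lessThan_3[symmetric] by auto
  then show ?thesis by (simp add: perms3_def monomial3_def transpose_def)
qed

section \<open>Coefficients in the path algebra\<close>

abbreviation coef :: "('b \<Rightarrow>\<^sub>0 'k::zero) \<Rightarrow> 'b \<Rightarrow> 'k" where
  "coef \<equiv> Poly_Mapping.lookup"

lemma coef_scale: "coef (Poly_Mapping.map ((*) c) f) p = (c :: 'k::semiring_0) * coef f p"
  by (simp add: Poly_Mapping.map.rep_eq when_def)

text \<open>Cancellation can make the support of a sum smaller than the union of the supports.
  Summing over common supersets lets bilinearity be checked term by term.\<close>

lemma path_prod_superset: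
  assumes "finite X" "finite Y" "Poly_Mapping.keys f \<subseteq> X" "Poly_Mapping.keys g \<subseteq> Y"
  shows "path_prod Q f g = (\<Sum>p\<in>X. \<Sum>q\<in>Y.
    if head Q (last p) = tail Q (hd q) then Poly_Mapping.single (p @ q) (coef f p * coef g q) else 0)"
proof -
  let ?h = "\<lambda>p q. if head Q (last p) = tail Q (hd q)
    then Poly_Mapping.single (p @ q) (coef f p * coef g q) else 0"
  have "path_prod Q f g = (\<Sum>p\<in>Poly_Mapping.keys f. \<Sum>q\<in>Y. ?h p q)"
    unfolding path_prod_def
    by (intro sum.cong refl sum.mono_neutral_left) (use assms in \<open>auto simp: in_keys_iff\<close>)
  also have "\<dots> = (\<Sum>p\<in>X. \<Sum>q\<in>Y. ?h p q)"
    by (intro sum.mono_neutral_left) (use assms in \<open>auto simp: in_keys_iff intro!: sum.neutral\<close>)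
  finally show ?thesis .
qed

lemma path_prod_add_left: "path_prod Q (f + f') g = path_prod Q f g + path_prod Q f' g"
proof -
  let ?X = "Poly_Mapping.keys f \<union> Poly_Mapping.keys f'" and ?Y = "Poly_Mapping.keys g"
  have X: "finite ?X" "Poly_Mapping.keys (f + f') \<subseteq> ?X"
    using keys_add[of f f'] by auto
  show ?thesis
    by (subst (1 2 3) path_prod_superset[of ?X ?Y])
       (use X in \<open>auto simp: lookup_add single_add algebra_simps sum.distrib[symmetric] intro!: sum.cong\<close>)
qed

lemma path_prod_add_right: "path_prod Q f (g + g') = path_prod Q f g + path_prod Q f g'"
proof -
  let ?X = "Poly_Mapping.keys f" and ?Y = "Poly_Mapping.keys g \<union> Poly_Mapping.keys g'"
  have Y: "finite ?Y" "Poly_Mapping.keys (g + g') \<subseteq> ?Y"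
    using keys_add[of g g'] by auto
  show ?thesis
    by (subst (1 2 3) path_prod_superset[of ?X ?Y])
       (use Y in \<open>auto simp: lookup_add single_add algebra_simps sum.distrib[symmetric] intro!: sum.cong\<close>)
qed

lemma path_prod_zero [simp]: "path_prod Q 0 g = 0" "path_prod Q f 0 = 0"
  by (auto simp: path_prod_def)

lemma path_prod_sum_left: "path_prod Q (\<Sum>i\<in>I. f i) g = (\<Sum>i\<in>I. path_prod Q (f i) g)"
  by (induction I rule: infinite_finite_induct) (auto simp: path_prod_add_left)

lemma path_prod_sum_right: "path_prod Q f (\<Sum>i\<in>I. g i) = (\<Sum>i\<in>I. path_prod Q f (g i))"
  by (induction I rule: infinite_finite_induct) (auto simp: path_prod_add_right)

lemma path_prod_single:
  "path_prod Q (Poly_Mapping.single p x) (Poly_Mapping.single q y) =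
    (if head Q (last p) = tail Q (hd q) then Poly_Mapping.single (p @ q) (x * y) else 0)"
  by (subst path_prod_superset[of "{p}" "{q}"]) auto

lemma poly_mapping_sum_singles:
  "f = (\<Sum>p\<in>Poly_Mapping.keys f. Poly_Mapping.single p (coef f p))"
  by (rule poly_mapping_eqI)
     (auto simp: lookup_sum lookup_single when_def sum.delta' in_keys_iff)

text \<open>The coefficient at the word \<open>w\<close> of the product of \<open>u\<close>, an element with coefficients \<open>f\<close>, and \<open>v\<close>.\<close>

definition flank :: "('a list \<Rightarrow> 'k::zero) \<Rightarrow> 'a list \<Rightarrow> 'a list \<Rightarrow> 'a list \<Rightarrow> 'k" where
  "flank f u v w = (if \<exists>s. s \<noteq> [] \<and> w = u @ s @ v then f (THE s. w = u @ s @ v) else 0)"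

lemma flank_eq: "w = u @ s @ v \<Longrightarrow> s \<noteq> [] \<Longrightarrow> flank f u v w = f s"
  by (auto simp: flank_def)

lemma flank_zero: "(\<And>s. s \<noteq> [] \<Longrightarrow> w \<noteq> u @ s @ v) \<Longrightarrow> flank f u v w = 0"
  by (auto simp: flank_def)

lemma flank_cases:
  obtains s where "s \<noteq> []" "w = u @ s @ v" "flank f u v w = f s"
  | "\<And>s. s \<noteq> [] \<Longrightarrow> w \<noteq> u @ s @ v" "flank f u v w = 0"
  by (metis flank_eq flank_zero)

locale path_algebra = quiver Q for Q :: "('v, 'a) pre_digraph" +
  fixes K :: "'k::field_char_0 itself"
begin

abbreviation NP :: "'a list set" where "NP \<equiv> nontrivial_paths Q"
abbreviation A :: "('k, 'a list \<Rightarrow>\<^sub>0 'k) nu_alg" where "A \<equiv> principal_subalg K Q"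
abbreviation pe :: "'a list \<Rightarrow> ('a list \<Rightarrow>\<^sub>0 'k)" where "pe p \<equiv> Poly_Mapping.single p 1"

lemma car_A: "f \<in> car A \<longleftrightarrow> Poly_Mapping.keys f \<subseteq> NP"
  and mult_A: "mult A = path_prod Q"
  and scale_A: "scale A = (\<lambda>c. Poly_Mapping.map ((*) c))"
  by (auto simp: principal_subalg_def)

lemma coef_notin: "f \<in> car A \<Longrightarrow> p \<notin> NP \<Longrightarrow> coef f p = 0"
  by (auto simp: car_A in_keys_iff)

lemma in_carI: "(\<And>p. p \<notin> NP \<Longrightarrow> coef f p = 0) \<Longrightarrow> f \<in> car A"
  by (auto simp: car_A in_keys_iff)

lemma single_in_car: "p \<in> NP \<Longrightarrow> Poly_Mapping.single p x \<in> car A"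
  by (auto simp: car_A)

lemma ex_cas_iff:
  assumes "p \<noteq> []" "set p \<subseteq> arcs Q"
  shows "(\<exists>v. cas (tail Q (hd p)) p v) \<longleftrightarrow> successively (\<lambda>a b. head Q a = tail Q b) p"
  using assms
proof (induction p rule: induct_list012)
  case (3 a b p)
  then show ?case by auto
qed auto

text \<open>Replaces the endpoints of a walk by a local condition on neighbouring arrows, which is
  compatible with cutting and joining words.\<close>

lemma NP_iff: "p \<in> NP \<longleftrightarrow>
  p \<noteq> [] \<and> set p \<subseteq> arcs Q \<and> successively (\<lambda>a b. head Q a = tail Q b) p"
proof -
  have "(\<exists>u v. awalk u p v) \<longleftrightarrow> (\<exists>v. cas (tail Q (hd p)) p v)" if "p \<noteq> []" "set p \<subseteq> arcs Q"
    using that by (cases p) (auto simp: awalk_def)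
  then show ?thesis using ex_cas_iff[of p] by (auto simp: nontrivial_paths_def awalk_def)
qed

lemma NP_not_Nil: "p \<in> NP \<Longrightarrow> p \<noteq> []" by (simp add: NP_iff)

lemma NP_arcs: "p \<in> NP \<Longrightarrow> set p \<subseteq> arcs Q" by (simp add: NP_iff)

lemma NP_append: "p \<noteq> [] \<Longrightarrow> q \<noteq> [] \<Longrightarrow>
  p @ q \<in> NP \<longleftrightarrow> p \<in> NP \<and> q \<in> NP \<and> head Q (last p) = tail Q (hd q)"
  by (auto simp: NP_iff successively_append_iff)

lemma NP_singleton: "[a] \<in> NP \<longleftrightarrow> a \<in> arcs Q"
  by (auto simp: NP_iff)

lemma NP_Cons: "p \<noteq> [] \<Longrightarrow> a # p \<in> NP \<longleftrightarrow> a \<in> arcs Q \<and> p \<in> NP \<and> head Q a = tail Q (hd p)"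
  using NP_append[of "[a]" p] by (auto simp: NP_singleton)

text \<open>A factorization of \<open>w\<close> into two non-empty words is a cut at a position
  strictly inside \<open>w\<close>. If \<open>w\<close> is a path, both pieces are paths and compose
  automatically, so the composability test of \<open>path_prod\<close> disappears.\<close>

lemma coef_mult:
  assumes f: "f \<in> car A" and g: "g \<in> car A"
  shows "coef (path_prod Q f g) w =
    (if w \<in> NP then (\<Sum>i\<in>{0<..<length w}. coef f (take i w) * coef g (drop i w)) else 0)"
proof -
  let ?X = "Poly_Mapping.keys f" and ?Y = "Poly_Mapping.keys g"
  let ?h = "\<lambda>(p, q). if head Q (last p) = tail Q (hd q) \<and> p @ q = w then coef f p * coef g q else 0"
  have XY: "p \<in> NP" "q \<in> NP" if "(p, q) \<in> ?X \<times> ?Y" for p q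
    using that f g by (auto simp: car_A)
  have lhs: "coef (path_prod Q f g) w = sum ?h (?X \<times> ?Y)"
    unfolding path_prod_def
    by (simp add: lookup_sum sum.cartesian_product)
       (auto intro!: sum.cong simp: lookup_single when_def)
  show ?thesis
  proof (cases "w \<in> NP")
    case False
    have "?h z = 0" if "z \<in> ?X \<times> ?Y" for z
    proof (cases z)
      case (Pair p q)
      then have "p \<in> NP" "q \<in> NP" using XY that by blast+
      then show ?thesis using Pair False NP_append[of p q] NP_not_Nil by auto
    qed
    then show ?thesis using False lhs by simp
  next
    case True
    let ?I = "{0<..<length w}" and ?s = "\<lambda>i. (take i w, drop i w)"
    have inj: "inj_on ?s ?I"
      by (rule inj_onI) (metis (no_types, lifting) Pair_inject greaterThanLessThan_iff length_take
          less_imp_le min.absorb2)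
    have "sum ?h (?X \<times> ?Y) = sum (\<lambda>(p, q). coef f p * coef g q) (?s ` ?I)"
    proof (rule sum.mono_neutral_cong)
      fix z assume z: "z \<in> ?X \<times> ?Y - ?s ` ?I"
      obtain p q where pq: "z = (p, q)" by (cases z)
      with z XY have "p \<noteq> []" "q \<noteq> []" using NP_not_Nil by blast+
      then have "p @ q = w \<Longrightarrow> z \<in> ?s ` ?I"
        unfolding pq by (intro image_eqI[where x = "length p"]) auto
      with z show "?h z = 0" by (auto simp: pq)
    next
      fix z assume "z \<in> ?X \<times> ?Y \<inter> ?s ` ?I"
      then obtain i where i: "z = (take i w, drop i w)" "i \<in> ?I" by auto
      then have ne: "take i w \<noteq> []" "drop i w \<noteq> []" by auto
      show "?h z = (\<lambda>(p, q). coef f p * coef g q) z"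
        using True NP_append[OF ne] i by simp
    qed (auto simp: in_keys_iff)
    also have "\<dots> = (\<Sum>i\<in>?I. coef f (take i w) * coef g (drop i w))"
      by (subst sum.reindex[OF inj]) simp
    finally show ?thesis using True lhs by simp
  qed
qed

lemma closed_A: "closed_alg A"
  unfolding closed_alg_def
proof (intro conjI ballI allI)
  fix x y assume xy: "x \<in> car A" "y \<in> car A"
  show "x + y \<in> car A" using xy by (intro in_carI) (simp add: lookup_add coef_notin)
  show "mult A x y \<in> car A" using xy by (intro in_carI) (simp add: mult_A coef_mult)
  show "scale A c x \<in> car A" for c using xy by (intro in_carI) (simp add: scale_A coef_scale coef_notin)
qed (auto simp: car_A)

text \<open>Of all cuts of \<open>w\<close>, only the one that leaves exactly \<open>v\<close> on
  the right contributes.\<close>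

lemma coef_mult_path_right:
  assumes f: "f \<in> car A" and v: "v \<in> NP"
  shows "coef (path_prod Q f (pe v)) w = (if w \<in> NP then flank (coef f) [] v w else 0)"
proof -
  have "(\<Sum>i\<in>{0<..<length w}. coef f (take i w) * coef (pe v) (drop i w)) = flank (coef f) [] v w"
  proof (cases rule: flank_cases[where w = w and u = "[] :: 'a list" and v = v and f = "coef f"])
    case (1 s)
    have "coef f (take i w) * coef (pe v) (drop i w) = (if length s = i then coef f s else 0)"
      if "i \<in> {0<..<length w}" for i
    proof (cases "length s = i")
      case False
      moreover have "length w = length s + length v" using 1(2) by simp
      ultimately have "length (drop i w) \<noteq> length v" using that by simp linarith
      then have "drop i w \<noteq> v" by blast
      then show ?thesis using False by (simp add: lookup_single when_def)
    qed (use 1 in \<open>auto simp: lookup_single\<close>)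
    moreover have "length s \<in> {0<..<length w}" using 1 NP_not_Nil[OF v] by auto
    ultimately show ?thesis using 1 by simp
  next
    case 2
    have "drop i w \<noteq> v" if "i \<in> {0<..<length w}" for i
    proof
      assume "drop i w = v"
      then have "w = [] @ take i w @ v" by (metis append_Nil append_take_drop_id)
      moreover have "take i w \<noteq> []" using that by auto
      ultimately show False using 2(1) by blast
    qed
    then have "coef f (take i w) * coef (pe v) (drop i w) = 0" if "i \<in> {0<..<length w}" for i
      using that by (metis lookup_single_not_eq mult_zero_right)
    then show ?thesis unfolding 2(2) by (intro sum.neutral ballI)
  qed
  then show ?thesis using coef_mult[OF f single_in_car[OF v]] by simp
qed

lemma coef_mult_path_left:
  assumes f: "f \<in> car A" and u: "u \<in> NP"
  shows "coef (path_prod Q (pe u) f) w = (if w \<in> NP then flank (coef f) u [] w else 0)"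
proof -
  have "(\<Sum>i\<in>{0<..<length w}. coef (pe u) (take i w) * coef f (drop i w)) = flank (coef f) u [] w"
  proof (cases rule: flank_cases[where w = w and u = u and v = "[] :: 'a list" and f = "coef f"])
    case (1 s)
    have "coef (pe u) (take i w) * coef f (drop i w) = (if length u = i then coef f s else 0)"
      if "i \<in> {0<..<length w}" for i
    proof (cases "length u = i")
      case False
      then have "length (take i w) \<noteq> length u" using that by simp
      then have "take i w \<noteq> u" by blast
      then show ?thesis using False by (simp add: lookup_single when_def)
    qed (use 1 in \<open>auto simp: lookup_single\<close>)
    moreover have "length u \<in> {0<..<length w}" using 1 NP_not_Nil[OF u] by auto
    ultimately show ?thesis using 1 by simp
  next
    case 2
    have "take i w \<noteq> u" if "i \<in> {0<..<length w}" for i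
    proof
      assume "take i w = u"
      then have "w = u @ drop i w @ []" by (metis append_Nil2 append_take_drop_id)
      moreover have "drop i w \<noteq> []" using that by auto
      ultimately show False using 2(1) by blast
    qed
    then have "coef (pe u) (take i w) * coef f (drop i w) = 0" if "i \<in> {0<..<length w}" for i
      using that by (metis lookup_single_not_eq mult_zero_left)
    then show ?thesis unfolding 2(2) by (intro sum.neutral ballI)
  qed
  then show ?thesis using coef_mult[OF single_in_car[OF u] f] by simp
qed

lemma mult_path_in_car:
  assumes "f \<in> car A" "v \<in> NP"
  shows "path_prod Q f (pe v) \<in> car A" "path_prod Q (pe v) f \<in> car A"
  using closed_algD(3)[OF closed_A] single_in_car assms by (auto simp: mult_A)

text \<open>The source of all necessary conditions on a central element: \<open>w\<close> is chosen
  so that one side is a known coefficient and the other forces the shape of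
  \<open>w\<close>.\<close>

lemma center_flank:
  assumes "f \<in> center A" "v \<in> NP" "w \<in> NP"
  shows "flank (coef f) [] v w = flank (coef f) v [] w"
proof -
  have f: "f \<in> car A" "path_prod Q f (pe v) = path_prod Q (pe v) f"
    using assms single_in_car[of v 1] by (auto simp: center_def mult_A)
  then show ?thesis
    using coef_mult_path_left[OF f(1) assms(2), of w] coef_mult_path_right[OF f(1) assms(2), of w]
      assms(3) by simp
qed

text \<open>Associativity read on coefficients. The middle factor of a path \<open>w\<close> is
  again a path, so the coefficient formula for the inner product applies to it.\<close>

lemma flank_mult_right:
  assumes f: "f \<in> car A" and q: "q \<in> NP" and w: "w \<in> NP"
  shows "flank (coef (path_prod Q f (pe q))) u v w = flank (coef f) u (q @ v) w"
proof (cases rule: flank_cases[where w = w and u = u and v = v and f = "coef (path_prod Q f (pe q))"])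
  case (1 s)
  then have s: "s \<in> NP" using w by (cases "u = []"; cases "v = []") (auto simp: NP_append)
  have "flank (coef f) [] q s = flank (coef f) u (q @ v) w"
  proof (cases rule: flank_cases[where w = s and u = "[] :: 'a list" and v = q and f = "coef f"])
    case (1 t)
    then show ?thesis using \<open>w = _\<close> flank_eq[of w u t "q @ v" "coef f"] by simp
  next
    case 2
    have "w \<noteq> u @ t @ q @ v" if "t \<noteq> []" for t
      using 2(1)[OF that] \<open>w = _\<close> by auto
    then show ?thesis using 2 flank_zero[of w u "q @ v" "coef f"] by simp
  qed
  then show ?thesis using 1 s by (simp add: coef_mult_path_right[OF f q])
next
  case 2
  have "w \<noteq> u @ t @ q @ v" if "t \<noteq> []" for t
    using 2(1)[of "t @ q"] that by auto
  then show ?thesis using 2 flank_zero[of w u "q @ v" "coef f"] by simp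
qed

lemma flank_mult_left:
  assumes f: "f \<in> car A" and q: "q \<in> NP" and w: "w \<in> NP"
  shows "flank (coef (path_prod Q (pe q) f)) u v w = flank (coef f) (u @ q) v w"
proof (cases rule: flank_cases[where w = w and u = u and v = v and f = "coef (path_prod Q (pe q) f)"])
  case (1 s)
  then have s: "s \<in> NP" using w by (cases "u = []"; cases "v = []") (auto simp: NP_append)
  have "flank (coef f) q [] s = flank (coef f) (u @ q) v w"
  proof (cases rule: flank_cases[where w = s and u = q and v = "[] :: 'a list" and f = "coef f"])
    case (1 t)
    then show ?thesis using \<open>w = _\<close> flank_eq[of w "u @ q" t v "coef f"] by simp
  next
    case 2
    have "w \<noteq> (u @ q) @ t @ v" if "t \<noteq> []" for t
      using 2(1)[OF that] \<open>w = _\<close> by auto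
    then show ?thesis using 2 flank_zero[of w "u @ q" v "coef f"] by simp
  qed
  then show ?thesis using 1 s by (simp add: coef_mult_path_left[OF f q])
next
  case 2
  have "w \<noteq> (u @ q) @ t @ v" if "t \<noteq> []" for t
    using 2(1)[of "q @ t"] that by auto
  then show ?thesis using 2 flank_zero[of w "u @ q" v "coef f"] by simp
qed

lemma scale_A_simps: "scale A 1 f = f" "scale A (- 1) f = - f"
  by (auto simp: scale_A coef_scale intro!: poly_mapping_eqI)

lemma St3_A: "St3 A a b c =
  path_prod Q (path_prod Q a b) c - path_prod Q (path_prod Q b a) c - path_prod Q (path_prod Q c b) a
  - path_prod Q (path_prod Q a c) b + path_prod Q (path_prod Q b c) a + path_prod Q (path_prod Q c a) b"
  by (simp add: St3_expand scale_A_simps mult_A)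

text \<open>If \<open>q\<close> and \<open>r\<close> do not compose, both sides vanish: the product
  is zero, and the path \<open>w\<close> cannot begin with \<open>q @ r\<close>.\<close>

lemma coef_path_path_mult:
  assumes f: "f \<in> car A" and q: "q \<in> NP" and r: "r \<in> NP" and w: "w \<in> NP"
  shows "coef (path_prod Q (path_prod Q (pe q) (pe r)) f) w = flank (coef f) (q @ r) [] w"
proof (cases "q @ r \<in> NP")
  case True
  then have "path_prod Q (pe q) (pe r) = pe (q @ r)"
    using NP_append[of q r] NP_not_Nil[OF q] NP_not_Nil[OF r] by (simp add: path_prod_single)
  then show ?thesis using coef_mult_path_left[OF f True] w by simp
next
  case False
  then have "path_prod Q (pe q) (pe r) = 0"
    using NP_append[of q r] NP_not_Nil[OF q] NP_not_Nil[OF r] q r by (simp add: path_prod_single)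
  moreover have "w \<noteq> (q @ r) @ s @ []" if "s \<noteq> []" for s
    using False w that NP_append[of "q @ r" s] NP_not_Nil[OF q] by auto
  ultimately show ?thesis using flank_zero[of w "q @ r" "[]"] by simp
qed

text \<open>One term for each monomial of \<open>St_3(f, q, r)\<close>, in the order of
  \<open>perms3\<close>. The necessary conditions on the 3-center are instances with suitable
  \<open>q\<close>, \<open>r\<close>, \<open>w\<close>.\<close>

lemma center3_flank:
  assumes f3: "f \<in> center3 A" and q: "q \<in> NP" and r: "r \<in> NP" and w: "w \<in> NP"
  shows "flank (coef f) [] (q @ r) w - flank (coef f) q r w - flank (coef f) (r @ q) [] w
    - flank (coef f) [] (r @ q) w + flank (coef f) (q @ r) [] w + flank (coef f) r q w = 0"
proof -
  have f: "f \<in> car A" using f3 by (simp add: center3_def)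
  have "coef (St3 A f (pe q) (pe r)) w = 0"
    using f3 single_in_car[OF q] single_in_car[OF r] by (simp add: center3_def)
  then show ?thesis
    unfolding St3_A
    by (simp add: lookup_add lookup_minus coef_path_path_mult[OF f] q r w
        coef_mult_path_right[OF mult_path_in_car(1)[OF f]]
        coef_mult_path_right[OF mult_path_in_car(2)[OF f]] flank_mult_right[OF f]
        flank_mult_left[OF f])
qed

lemma module_A: "module (scale A)"
  by unfold_locales (auto simp: scale_A coef_scale lookup_add algebra_simps intro!: poly_mapping_eqI)

text \<open>Paths form a basis, so membership in such a span is a condition on each key separately;
  both center descriptions thus reduce to single paths.\<close>

lemma span_paths: "alg_span A {pe p | p. P p} = {f. \<forall>p\<in>Poly_Mapping.keys f. P p}"
proof -
  interpret M: module "scale A" by (rule module_A)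
  show ?thesis
  proof (intro subset_antisym subsetI)
    fix f assume "f \<in> M.span {pe p | p. P p}"
    then show "f \<in> {f. \<forall>p\<in>Poly_Mapping.keys f. P p}"
    proof (induction rule: M.span_induct_alt)
      case (step c x y)
      then obtain p where "P p" "x = pe p" by auto
      then show ?case using step(2)
        by (auto simp: in_keys_iff lookup_add scale_A coef_scale lookup_single when_def split: if_splits)
    qed auto
  next
    fix f :: "'a list \<Rightarrow>\<^sub>0 'k" assume f: "f \<in> {f. \<forall>p\<in>Poly_Mapping.keys f. P p}"
    have scale: "Poly_Mapping.single p x = scale A x (pe p)" for p :: "'a list" and x
      by (rule poly_mapping_eqI) (simp add: scale_A coef_scale lookup_single when_def)
    have "(\<Sum>p\<in>Poly_Mapping.keys f. scale A (coef f p) (pe p)) \<in> M.span {pe p | p. P p}"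
      using f by (intro M.span_sum M.span_scale M.span_base) auto
    then have "(\<Sum>p\<in>Poly_Mapping.keys f. Poly_Mapping.single p (coef f p)) \<in> M.span {pe p | p. P p}"
      by (simp only: scale[symmetric])
    then show "f \<in> M.span {pe p | p. P p}" unfolding poly_mapping_sum_singles[symmetric] .
  qed
qed

lemma St3_sum:
  "St3 A (\<Sum>i\<in>I. a i) b c = (\<Sum>i\<in>I. St3 A (a i) b c)"
  "St3 A b (\<Sum>i\<in>I. a i) c = (\<Sum>i\<in>I. St3 A b (a i) c)"
  "St3 A b c (\<Sum>i\<in>I. a i) = (\<Sum>i\<in>I. St3 A b c (a i))"
  by (simp_all add: St3_A path_prod_sum_left path_prod_sum_right sum.distrib sum_subtractf)

text \<open>Trilinearity reduces the vanishing of \<open>St3\<close> to multiples of single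
  paths.\<close>

lemma St3_eq_0I:
  assumes "\<And>p q r x y z. p \<in> Poly_Mapping.keys a \<Longrightarrow> q \<in> Poly_Mapping.keys b \<Longrightarrow>
    r \<in> Poly_Mapping.keys c \<Longrightarrow>
    St3 A (Poly_Mapping.single p x) (Poly_Mapping.single q y) (Poly_Mapping.single r z) = 0"
  shows "St3 A a b c = 0"
  by (subst poly_mapping_sum_singles[of a], subst poly_mapping_sum_singles[of b],
      subst poly_mapping_sum_singles[of c])
     (simp add: St3_sum assms)

end

section \<open>The center\<close>

text \<open>Phrased by closed sets instead of chains, since each use exhibits one closed set of
  arrows and concludes that it is everything. Sharing only a source or only a target does not make
  two arrows neighbours, so this differs from connectivity of the underlying graph.\<close>

definition arc_connected :: "('v, 'a) pre_digraph \<Rightarrow> bool" where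
  "arc_connected Q \<longleftrightarrow> (\<forall>S\<subseteq>arcs Q. S \<noteq> {} \<and>
     (\<forall>a\<in>S. \<forall>b\<in>arcs Q. head Q a = tail Q b \<or> head Q b = tail Q a \<longrightarrow> b \<in> S) \<longrightarrow> S = arcs Q)"

lemma arc_connectedD:
  assumes "arc_connected Q" "S \<subseteq> arcs Q" "S \<noteq> {}"
    "\<And>a b. a \<in> S \<Longrightarrow> b \<in> arcs Q \<Longrightarrow> head Q a = tail Q b \<Longrightarrow> b \<in> S"
    "\<And>a b. a \<in> S \<Longrightarrow> b \<in> arcs Q \<Longrightarrow> head Q b = tail Q a \<Longrightarrow> b \<in> S"
  shows "S = arcs Q"
  using assms unfolding arc_connected_def by meson

lemma single_one_nonzero [simp]: "Poly_Mapping.single p (1 :: 'k::zero_neq_one) \<noteq> 0"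
  by (metis lookup_single_eq lookup_zero one_neq_zero)

context path_algebra
begin

lemma two_sided_unextendable_iff:
  "two_sided_unextendable K Q p \<longleftrightarrow>
    (\<forall>a\<in>arcs Q. head Q a \<noteq> tail Q (hd p) \<and> head Q (last p) \<noteq> tail Q a)"
  by (auto simp: two_sided_unextendable_def mult_A path_prod_single)

text \<open>In \<open>a f\<close> the word \<open>p @ [a]\<close> reads the coefficient of whatever
  follows a leading \<open>a\<close>. This yields the first arrow of \<open>p\<close>, and since the
  remainder is the rotation of \<open>p\<close>, also the coefficient of that rotation.\<close>

lemma center_extend_right:
  assumes f: "f \<in> center A" and p: "coef f p \<noteq> 0"
    and a: "a \<in> arcs Q" "head Q (last p) = tail Q a"
  shows "hd p = a \<and> coef f (tl p @ [a]) = coef f p"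
proof -
  have pNP: "p \<in> NP" using f p coef_notin by (auto simp: center_def)
  then have ne: "p \<noteq> []" by (rule NP_not_Nil)
  then have w: "p @ [a] \<in> NP" using pNP a by (simp add: NP_append NP_singleton)
  have "flank (coef f) [a] [] (p @ [a]) = coef f p"
    using center_flank[OF f _ w, of "[a]"] flank_eq[of "p @ [a]" "[]" p "[a]" "coef f"] ne a
    by (simp add: NP_singleton)
  then show ?thesis
    using p ne by (cases rule: flank_cases[where w = "p @ [a]" and u = "[a]" and v = "[]" and f = "coef f"])
      (cases p; auto)+
qed

lemma center_extend_left:
  assumes f: "f \<in> center A" and p: "coef f p \<noteq> 0"
    and a: "a \<in> arcs Q" "head Q a = tail Q (hd p)"
  shows "last p = a"
proof -
  have pNP: "p \<in> NP" using f p coef_notin by (auto simp: center_def)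
  then have ne: "p \<noteq> []" by (rule NP_not_Nil)
  then have w: "a # p \<in> NP" using pNP a by (simp add: NP_Cons)
  have "flank (coef f) [] [a] (a # p) = coef f p"
    using center_flank[OF f _ w, of "[a]"] flank_eq[of "a # p" "[a]" p "[]" "coef f"] ne a
    by (simp add: NP_singleton)
  then obtain s where "a # p = s @ [a]"
    using p flank_zero[of "a # p" "[]" "[a]" "coef f"] by auto
  then show ?thesis using ne by (metis last_ConsR last_snoc)
qed

text \<open>A path can meet an unextendable path only through its own first or last arrow, so all
  products with such a path vanish on both sides and agree trivially.\<close>

lemma unextendable_in_center:
  assumes "\<And>p. p \<in> Poly_Mapping.keys f \<Longrightarrow> p \<in> NP \<and> two_sided_unextendable K Q p"
  shows "f \<in> center A"
proof -
  have *: "head Q (last p) \<noteq> tail Q (hd q)" "head Q (last q) \<noteq> tail Q (hd p)"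
    if "p \<in> Poly_Mapping.keys f" "g \<in> car A" "q \<in> Poly_Mapping.keys g" for p q g
  proof -
    have "q \<in> NP" using that by (auto simp: car_A)
    then have "hd q \<in> arcs Q" "last q \<in> arcs Q"
      using NP_not_Nil NP_arcs hd_in_set last_in_set by blast+
    then show "head Q (last p) \<noteq> tail Q (hd q)" "head Q (last q) \<noteq> tail Q (hd p)"
      using assms[OF that(1)] by (auto simp: two_sided_unextendable_iff)
  qed
  have "path_prod Q f g = 0" "path_prod Q g f = 0" if "g \<in> car A" for g
    unfolding path_prod_def using *[OF _ that] by (auto intro!: sum.neutral)
  then show ?thesis using assms by (auto simp: center_def mult_A car_A)
qed

text \<open>Unique successors and predecessors make the range of \<open>b\<close> closed under
  composability, so connectivity makes it all of \<open>arcs Q\<close>. The predecessor of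
  \<open>b k\<close> is written one period ahead, as \<open>b (k + m - 1)\<close>, because
  \<open>k - 1\<close> would be truncated at \<open>k = 0\<close>.\<close>

lemma periodic_arcs_circle:
  fixes b :: "nat \<Rightarrow> 'a"
  assumes conn: "arc_connected Q" and iso: "no_isolated_points Q" and m: "m > 0"
    and b_arc: "\<And>k. b k \<in> arcs Q" and per: "\<And>k. b (k + m) = b k"
    and adj: "\<And>k. head Q (b k) = tail Q (b (Suc k))"
    and out: "\<And>k x. x \<in> arcs Q \<Longrightarrow> head Q (b k) = tail Q x \<Longrightarrow> x = b (Suc k)"
    and inc: "\<And>k x. x \<in> arcs Q \<Longrightarrow> head Q x = tail Q (b k) \<Longrightarrow> x = b (k + m - 1)"
  shows "\<exists>n\<ge>1. digraph_iso (circle n) Q"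
proof -
  \<comment> \<open>The period \<open>m\<close> may wind several times round the circle; the length
    of the circle is the first return to \<open>b 0\<close>.\<close>
  define n where "n = (LEAST n. n > 0 \<and> b n = b 0)"
  have n: "n > 0" "b n = b 0"
    using LeastI[of "\<lambda>n. n > 0 \<and> b n = b 0" m] m per[of 0] unfolding n_def by auto
  have n_min: "n \<le> k" if "k > 0" "b k = b 0" for k
    using that unfolding n_def by (intro Least_le) auto
  \<comment> \<open>The walk is deterministic backwards, so any repetition
    \<open>b (i + d) = b i\<close> moves back to index 0, where minimality of \<open>n\<close>
    applies.\<close>
  have pred: "b i = b j" if "b (Suc i) = b (Suc j)" for i j
    using inc[of "b i" "Suc j"] adj[of i] that b_arc per[of j] by simp
  have shift: "b d = b 0" if "b (i + d) = b i" for i d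
    using that by (induction i) (auto dest: pred)
  have per_n: "b (k + n) = b k" for k
  proof (induction k)
    case (Suc k)
    then show ?case using out[of "b (Suc (k + n))" k] adj[of "k + n"] b_arc by simp
  qed (use n in simp)
  have per_kn: "b (i + k * n) = b i" for i k
  proof (induction k)
    case (Suc k)
    then show ?case using per_n[of "i + k * n"] by (simp add: algebra_simps)
  qed simp
  have b_mod: "b (k mod n) = b k" for k
    using per_kn[of "k mod n" "k div n"] by simp
  have less: "b i \<noteq> b j" if "i < j" "j < n" for i j
    using shift[of i "j - i"] n_min[of "j - i"] that by auto
  have inj: "inj_on b {..<n}"
    by (rule inj_onI) (metis less lessThan_iff linorder_neqE_nat)
  have "range b = arcs Q"
  proof (rule arc_connectedD[OF conn])
    show "range b \<subseteq> arcs Q" using b_arc by auto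
    show "x \<in> range b" if "a \<in> range b" "x \<in> arcs Q" "head Q a = tail Q x" for a x
      using that out by auto
    show "x \<in> range b" if "a \<in> range b" "x \<in> arcs Q" "head Q x = tail Q a" for a x
      using that inc by auto
  qed auto
  moreover have "range b = b ` {..<n}"
  proof (intro subset_antisym subsetI)
    fix x assume "x \<in> range b"
    then obtain k where "x = b k" by auto
    then show "x \<in> b ` {..<n}" using b_mod[of k] n by (intro image_eqI[of _ _ "k mod n"]) auto
  qed auto
  ultimately have arcs: "arcs Q = b ` {..<n}" by simp
  have tail_eq: "b i = b j" if "tail Q (b i) = tail Q (b j)" for i j
  proof -
    have "Suc (i + m - 1) = i + m" using m by simp
    then have "head Q (b (i + m - 1)) = tail Q (b i)" using adj[of "i + m - 1"] per[of i] by simp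
    then have "b j = b (Suc (i + m - 1))" using out[of "b j" "i + m - 1"] that b_arc by simp
    then show ?thesis using \<open>Suc (i + m - 1) = i + m\<close> per[of i] by simp
  qed
  have verts: "verts Q = (\<lambda>k. tail Q (b k)) ` {..<n}"
  proof (intro subset_antisym subsetI)
    fix v assume "v \<in> verts Q"
    \<comment> \<open>Arrows account only for their endpoints; absence of isolated points makes
      these all the vertices.\<close>
    then obtain e where "e \<in> arcs Q" "tail Q e = v \<or> head Q e = v"
      using iso by (auto simp: no_isolated_points_def isolated_point_def)
    then obtain k where "v = tail Q (b k) \<or> v = tail Q (b (Suc k))" using arcs adj by auto
    then obtain k where "v = tail Q (b k)" by auto
    then have "v = tail Q (b (k mod n))" using b_mod[of k] by simp
    then show "v \<in> (\<lambda>k. tail Q (b k)) ` {..<n}" using n by auto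
  qed (use b_arc in auto)
  \<comment> \<open>\<open>circle\<close> counts vertices and arrows from 1, while \<open>b\<close>
    counts from 0.\<close>
  define h where "h = \<lparr>iso_verts = \<lambda>i. tail Q (b (i - 1)), iso_arcs = \<lambda>i. b (i - 1),
    iso_head = head Q, iso_tail = tail Q\<rparr>"
  have im: "(\<lambda>i. i - 1) ` {1..n} = {..<n}"
  proof (intro subset_antisym subsetI)
    fix x assume "x \<in> {..<n}"
    then show "x \<in> (\<lambda>i. i - 1) ` {1..n}" by (intro image_eqI[of _ _ "Suc x"]) auto
  qed auto
  have inj1: "inj_on (\<lambda>i::nat. i - 1) {1..n}" by (auto simp: inj_on_def)
  have inj_b: "inj_on (\<lambda>i. b (i - 1)) {1..n}"
    using comp_inj_on[OF inj1, of b] inj im by (simp add: o_def)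
  have inj_v: "inj_on (\<lambda>i. tail Q (b (i - 1))) {1..n}"
  proof (rule inj_onI)
    fix i j assume ij: "i \<in> {1..n}" "j \<in> {1..n}" and "tail Q (b (i - 1)) = tail Q (b (j - 1))"
    then have "b (i - 1) = b (j - 1)" using tail_eq by blast
    from inj_onD[OF inj_b this ij] show "i = j" .
  qed
  have "pre_digraph.digraph_isomorphism (circle n) h"
    unfolding pre_digraph.digraph_isomorphism_def
  proof (intro conjI ballI)
    show "wf_digraph (circle n)" using n by unfold_locales (auto simp: circle_def)
    show "inj_on (iso_verts h) (verts (circle n))" "inj_on (iso_arcs h) (arcs (circle n))"
      using inj_b inj_v by (simp_all add: h_def circle_def)
  next
    fix a assume a: "a \<in> arcs (circle n)"
    show "iso_verts h (tail (circle n) a) = iso_tail h (iso_arcs h a)"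
      by (simp add: h_def circle_def)
    show "iso_verts h (head (circle n) a) = iso_head h (iso_arcs h a)"
      using a n adj[of "a - 1"] by (cases "a < n") (auto simp: h_def circle_def)
  qed
  moreover have "Q = app_iso h (circle n)"
  proof (rule pre_digraph.equality)
    show "verts Q = verts (app_iso h (circle n))"
      using verts im by (simp add: h_def circle_def image_image flip: im)
    show "arcs Q = arcs (app_iso h (circle n))"
      using arcs im by (simp add: h_def circle_def image_image flip: im)
  qed (auto simp: h_def)
  ultimately show ?thesis using n unfolding digraph_iso_def by (intro exI[of _ n]) auto
qed

lemma center_extendable_circle:
  assumes conn: "arc_connected Q" and iso: "no_isolated_points Q"
    and f: "f \<in> center A" and p: "coef f p \<noteq> 0" and ext: "\<not> two_sided_unextendable K Q p"
  shows "\<exists>n\<ge>1. digraph_iso (circle n) Q"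
proof -
  have NPI: "q \<in> NP" if "coef f q \<noteq> 0" for q
    using f that coef_notin by (auto simp: center_def)
  have pNP: "p \<in> NP" and ne: "p \<noteq> []" using NPI[OF p] NP_not_Nil by auto
  define m where "m = length p"
  define b where "b k = p ! (k mod m)" for k
  have m: "m > 0" using ne by (simp add: m_def)
  \<comment> \<open>The extending arrow is the first arrow of \<open>p\<close> if it is appended and
    the last one if it is prepended; either way \<open>p\<close> closes up.\<close>
  have closed: "head Q (last p) = tail Q (hd p)"
    using ext center_extend_right[OF f p] center_extend_left[OF f p]
    by (auto simp: two_sided_unextendable_iff)
  have b_arc: "b k \<in> arcs Q" for k
    using NP_arcs[OF pNP] m nth_mem[of "k mod m" p] by (auto simp: b_def m_def)
  have per: "b (k + m) = b k" for k by (simp add: b_def)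
  have adj: "head Q (b k) = tail Q (b (Suc k))" for k
  proof (cases "Suc (k mod m) = m")
    case True
    then have "k mod m = m - 1" "Suc k mod m = 0" by (auto simp: mod_Suc)
    then have "b k = last p" "b (Suc k) = hd p"
      unfolding b_def by (simp_all add: m_def last_conv_nth[OF ne] hd_conv_nth[OF ne])
    then show ?thesis using closed by simp
  next
    case False
    then have "Suc (k mod m) < m" using m by (simp add: Suc_lessI)
    then show ?thesis using pNP by (auto simp: NP_iff successively_conv_nth b_def m_def mod_Suc)
  qed
  have W: "coef f (map b [k..<k + m]) \<noteq> 0" for k
  proof (induction k)
    case 0
    have "map b [0..<m] = p" by (auto simp: b_def m_def intro: nth_equalityI)
    then show ?case using p by simp
  next
    case (Suc k)
    have "map b [k..<k + m] = b k # map b [Suc k..<k + m]" using m by (simp add: upt_conv_Cons)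
    moreover have "last (map b [k..<k + m]) = b (k + m - 1)" using m by (simp add: last_map)
    moreover have "head Q (b (k + m - 1)) = tail Q (b k)" using adj[of "k + m - 1"] m per by simp
    ultimately have "coef f (map b [Suc k..<k + m] @ [b k]) = coef f (map b [k..<k + m])"
      using center_extend_right[OF f Suc b_arc[of k]] by simp
    then show ?case using Suc m per[of k] by simp
  qed
  have hd_W: "hd (map b [k..<k + m]) = b k" and last_W: "last (map b [k..<k + m]) = b (k + m - 1)" for k
    using m by (simp_all add: hd_map last_map)
  show ?thesis
  proof (rule periodic_arcs_circle[where b = b, OF conn iso m b_arc per adj])
    \<comment> \<open>The rotation that starts at \<open>Suc k\<close> ends with
      \<open>b (k + m) = b k\<close>, so an arrow following \<open>b k\<close> extends it on the
      right.\<close>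
    show "x = b (Suc k)" if "x \<in> arcs Q" "head Q (b k) = tail Q x" for k x
      using center_extend_right[OF f W[of "Suc k"] that(1)] that(2) hd_W[of "Suc k"] last_W[of "Suc k"]
        per[of k] by simp
    show "x = b (k + m - 1)" if "x \<in> arcs Q" "head Q x = tail Q (b k)" for k x
      using center_extend_left[OF f W[of k] that(1)] that(2) hd_W[of k] last_W[of k] by simp
  qed
qed

lemma center_noncircle:
  assumes "arc_connected Q" "no_isolated_points Q" "\<not> (\<exists>n\<ge>1. digraph_iso (circle n) Q)"
  shows "center A = alg_span A {pe p | p. p \<in> NP \<and> two_sided_unextendable K Q p}"
  unfolding span_paths
proof (intro subset_antisym subsetI CollectI ballI)
  fix f p assume f: "f \<in> center A" and "p \<in> Poly_Mapping.keys f"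
  then have p: "coef f p \<noteq> 0" by (simp add: in_keys_iff)
  have "p \<in> NP" using f p coef_notin by (auto simp: center_def)
  then show "p \<in> NP \<and> two_sided_unextendable K Q p"
    using center_extendable_circle[OF assms(1,2) f p] assms(3) by blast
qed (auto intro: unextendable_in_center)

end

section \<open>The 3-center\<close>

lemma flank_hd: "u \<noteq> [] \<Longrightarrow> hd w \<noteq> hd u \<Longrightarrow> flank f u v w = 0"
  by (rule flank_zero) auto

lemma flank_last: "v \<noteq> [] \<Longrightarrow> last w \<noteq> last v \<Longrightarrow> flank f u v w = 0"
  by (rule flank_zero) auto

lemma flank_suffix: "w = t @ v' \<Longrightarrow> length v' = length v \<Longrightarrow> v' \<noteq> v \<Longrightarrow> flank f u v w = 0"
  by (rule flank_zero) (metis append_assoc append_eq_append_conv)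

lemma flank_prefix: "w = u' @ t \<Longrightarrow> length u' = length u \<Longrightarrow> u' \<noteq> u \<Longrightarrow> flank f u v w = 0"
  by (rule flank_zero) (metis append_eq_append_conv)

lemma char_0_double: "x + x = 0 \<Longrightarrow> x = (0 :: 'k::field_char_0)"
  by (metis mult_2 mult_eq_0_iff zero_neq_numeral)

text \<open>Doubling twice gives 4x = x, that is 3x = 0. This is the system obtained for a closed
  path and one of its rotations.\<close>

lemma char_0_triple: "2 * x = y \<Longrightarrow> 2 * y = x \<Longrightarrow> x = (0 :: 'k::field_char_0)"
proof -
  assume "2 * x = y" "2 * y = x"
  have "3 * x + x = 2 * (2 * x)" by simp
  also have "\<dots> = x" using \<open>2 * x = y\<close> \<open>2 * y = x\<close> by simp
  finally have "3 * x = 0" by simp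
  then show "x = 0" by simp
qed

context path_algebra
begin

lemma NP_append3:
  assumes "p \<noteq> []" "q \<noteq> []" "r \<noteq> []"
  shows "p @ q @ r \<in> NP \<longleftrightarrow> p \<in> NP \<and> q \<in> NP \<and> r \<in> NP \<and>
    head Q (last p) = tail Q (hd q) \<and> head Q (last q) = tail Q (hd r)"
  using assms by (auto simp: NP_append)

lemma center3_NP: "f \<in> center3 A \<Longrightarrow> coef f p \<noteq> 0 \<Longrightarrow> p \<in> NP"
  using coef_notin by (auto simp: center3_def)

text \<open>At the word \<open>p q r\<close> the first arrow excludes the four monomials that begin
  with \<open>q\<close> or \<open>r\<close>. Of the other two, \<open>f q r\<close> contributes the
  coefficient of \<open>p\<close>, so \<open>f r q\<close> has to cancel it, which needs the same
  suffix.\<close>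

lemma center3_commute_right:
  assumes f: "f \<in> center3 A" and p: "coef f p \<noteq> 0" and w: "p @ q @ r \<in> NP"
    and ne: "q \<noteq> []" "r \<noteq> []" and hd: "hd p \<noteq> hd q" "hd p \<noteq> hd r"
  shows "q @ r = r @ q"
proof (rule ccontr)
  assume neq: "q @ r \<noteq> r @ q"
  have p0: "p \<noteq> []" using center3_NP[OF f p] NP_not_Nil by simp
  have qr: "q \<in> NP" "r \<in> NP" using w NP_append3[OF p0 ne] by auto
  let ?w = "p @ q @ r"
  have "flank (coef f) [] (q @ r) ?w = coef f p" by (rule flank_eq) (use p0 in auto)
  moreover have "flank (coef f) [] (r @ q) ?w = 0" by (rule flank_suffix[of _ p "q @ r"]) (use neq in auto)
  moreover have "flank (coef f) q r ?w = 0" "flank (coef f) r q ?w = 0"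
    "flank (coef f) (q @ r) [] ?w = 0" "flank (coef f) (r @ q) [] ?w = 0"
    using hd ne p0 by (auto intro: flank_hd)
  ultimately show False using center3_flank[OF f qr w] p by simp
qed

text \<open>Mirror image of \<open>center3_commute_right\<close>, with the last arrows excluding the
  other monomials.\<close>

lemma center3_commute_left:
  assumes f: "f \<in> center3 A" and p: "coef f p \<noteq> 0" and w: "q @ r @ p \<in> NP"
    and ne: "q \<noteq> []" "r \<noteq> []" and last: "last p \<noteq> last q" "last p \<noteq> last r"
  shows "q @ r = r @ q"
proof (rule ccontr)
  assume neq: "q @ r \<noteq> r @ q"
  have p0: "p \<noteq> []" using center3_NP[OF f p] NP_not_Nil by simp
  have qr: "q \<in> NP" "r \<in> NP" using w NP_append3[OF ne p0] by auto
  let ?w = "q @ r @ p"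
  have "flank (coef f) (q @ r) [] ?w = coef f p" by (rule flank_eq) (use p0 in auto)
  moreover have "flank (coef f) (r @ q) [] ?w = 0" by (rule flank_prefix[of _ "q @ r" p]) (use neq in auto)
  moreover have "flank (coef f) q r ?w = 0" "flank (coef f) r q ?w = 0"
    "flank (coef f) [] (q @ r) ?w = 0" "flank (coef f) [] (r @ q) ?w = 0"
    using last ne p0 by (auto intro: flank_last)
  ultimately show False using center3_flank[OF f qr w] p by simp
qed

text \<open>Two test words are needed. At \<open>p a b\<close> only \<open>b a f\<close> can cancel
  the contribution of \<open>f a b\<close>, which gives a second path \<open>s\<close> with the same
  coefficient. At \<open>p a b a\<close> the coefficients of \<open>p\<close> and \<open>s\<close>
  enter with equal signs, so twice the coefficient of \<open>p\<close> is zero.\<close>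

lemma center3_nonclosed_right:
  assumes f: "f \<in> center3 A" and p: "coef f p \<noteq> 0" and nc: "head Q (last p) \<noteq> tail Q (hd p)"
    and w: "p @ [a, b] \<in> NP" and ab: "a \<noteq> b"
  shows False
proof -
  have p0: "p \<noteq> []" using center3_NP[OF f p] NP_not_Nil by simp
  have NP: "[a] \<in> NP" "[b] \<in> NP" "head Q (last p) = tail Q a" "head Q a = tail Q b"
    using w NP_append3[of p "[a]" "[b]"] p0 by auto
  have hd: "hd p \<noteq> a" using nc NP by auto
  have "flank (coef f) [] [a, b] (p @ [a, b]) = coef f p" by (rule flank_eq) (use p0 in auto)
  moreover have "flank (coef f) [] [b, a] (p @ [a, b]) = 0" "flank (coef f) [b] [a] (p @ [a, b]) = 0"
    using ab by (auto intro: flank_last)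
  moreover have "flank (coef f) [a] [b] (p @ [a, b]) = 0" "flank (coef f) [a, b] [] (p @ [a, b]) = 0"
    using hd p0 by (auto intro: flank_hd)
  ultimately have "flank (coef f) [b, a] [] (p @ [a, b]) = coef f p"
    using center3_flank[OF f NP(1,2), of "p @ [a, b]"] w by simp
  \<comment> \<open>The word must also factor as \<open>b a s\<close>; hence \<open>a\<close> and
    \<open>b\<close> compose in both orders and \<open>p\<close> begins with
    \<open>b\<close>.\<close>
  then obtain s where s: "p @ [a, b] = [b, a] @ s" "s \<noteq> []" "coef f s = coef f p"
    using p by (cases rule: flank_cases[where w = "p @ [a, b]" and u = "[b, a]" and v = "[]" and f = "coef f"]) auto
  have "[b, a] @ s \<in> NP" using w s by simp
  then have ba: "head Q b = tail Q a" "[b, a] \<in> NP"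
    using NP_append3[of "[b]" "[a]" s] NP_append[of "[b, a]" s] s(2) by auto
  have hd_b: "hd p = b" using arg_cong[OF s(1), of hd] p0 by simp
  \<comment> \<open>For the test paths \<open>[a]\<close> and \<open>[b, a]\<close>, this word is
    both \<open>p a (b a)\<close> and \<open>(b a) s a\<close>; both monomials have sign
    plus.\<close>
  let ?w = "p @ [a, b, a]"
  have w': "?w \<in> NP" using w ba(1) NP NP_append[of "p @ [a, b]" "[a]"] by simp
  have "flank (coef f) [] ([a] @ [b, a]) ?w = coef f p" by (rule flank_eq) (use p0 in auto)
  moreover have "flank (coef f) [b, a] [a] ?w = coef f s" by (rule flank_eq) (use s in auto)
  moreover have "flank (coef f) [a] [b, a] ?w = 0" "flank (coef f) ([a] @ [b, a]) [] ?w = 0"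
    using ab p0 hd by (auto intro: flank_hd)
  moreover have "flank (coef f) [] ([b, a] @ [a]) ?w = 0"
    by (rule flank_suffix[of _ p "[a, b, a]"]) (use ab in auto)
  moreover have "flank (coef f) ([b, a] @ [a]) [] ?w = 0"
  proof (rule flank_zero)
    fix t :: "'a list" assume "t \<noteq> []"
    \<comment> \<open>The monomial \<open>(b a) a f\<close> would require \<open>a\<close> to be a
      loop; then \<open>tail Q b = tail Q a\<close>, and \<open>p\<close>, which begins with
      \<open>b\<close> and ends at the tail of \<open>a\<close>, would be closed.\<close>
    have "head Q a \<noteq> tail Q a" using nc NP hd_b by auto
    then have "([b, a] @ [a]) @ t @ [] \<notin> NP"
      using NP_append3[of "[b]" "[a]" "[a] @ t"] by auto
    then show "?w \<noteq> ([b, a] @ [a]) @ t @ []" using w' by metis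
  qed
  ultimately have "coef f p + coef f p = 0"
    using center3_flank[OF f NP(1) ba(2) w'] s(3) by simp
  then show False using p char_0_double by blast
qed

text \<open>Mirror image of \<open>center3_nonclosed_right\<close>. The second test word is
  \<open>b a b p\<close>, where \<open>(b a) b f\<close> and \<open>b f (b a)\<close> both carry the
  sign minus.\<close>

lemma center3_nonclosed_left:
  assumes f: "f \<in> center3 A" and p: "coef f p \<noteq> 0" and nc: "head Q (last p) \<noteq> tail Q (hd p)"
    and w: "[a, b] @ p \<in> NP" and ab: "a \<noteq> b"
  shows False
proof -
  have p0: "p \<noteq> []" using center3_NP[OF f p] NP_not_Nil by simp
  have NP: "[a] \<in> NP" "[b] \<in> NP" "head Q a = tail Q b" "head Q b = tail Q (hd p)"
    using w NP_append3[of "[a]" "[b]" p] p0 by auto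
  have last: "last p \<noteq> b" using nc NP by auto
  let ?w0 = "a # b # p"
  have "flank (coef f) [a, b] [] ?w0 = coef f p" by (rule flank_eq) (use p0 in auto)
  moreover have "flank (coef f) [b, a] [] ?w0 = 0" "flank (coef f) [b] [a] ?w0 = 0"
    using ab by (auto intro: flank_hd)
  moreover have "flank (coef f) [a] [b] ?w0 = 0" "flank (coef f) [] [a, b] ?w0 = 0"
    using last p0 by (auto intro: flank_last)
  ultimately have "flank (coef f) [] [b, a] ?w0 = coef f p"
    using center3_flank[OF f NP(1,2), of ?w0] w by simp
  then obtain s where s: "a # b # p = s @ [b, a]" "s \<noteq> []" "coef f s = coef f p"
    using p by (cases rule: flank_cases[where w = ?w0 and u = "[]" and v = "[b, a]" and f = "coef f"]) auto
  have "s @ [b, a] \<in> NP" using w s by simp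
  then have ba: "head Q b = tail Q a" "[b, a] \<in> NP"
    using NP_append3[of s "[b]" "[a]"] NP_append[of s "[b, a]"] s(2) by auto
  have last_a: "last p = a" using arg_cong[OF s(1), of last] p0 by simp
  let ?w = "[b] @ [a, b] @ p"
  have w': "?w \<in> NP" using w ba(1) NP NP_append[of "[b]" "[a, b] @ p"] by simp
  have "flank (coef f) ([b, a] @ [b]) [] ?w = coef f p" by (rule flank_eq) (use p0 in auto)
  moreover have "flank (coef f) [b] [b, a] ?w = coef f s" by (rule flank_eq) (use s in auto)
  moreover have "flank (coef f) [b, a] [b] ?w = 0" "flank (coef f) [] ([b, a] @ [b]) ?w = 0"
    using ab p0 last by (auto intro: flank_last)
  moreover have "flank (coef f) ([b] @ [b, a]) [] ?w = 0"
    by (rule flank_prefix[of _ "[b, a, b]" p]) (use ab in auto)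
  moreover have "flank (coef f) [] ([b] @ [b, a]) ?w = 0"
  proof (rule flank_zero)
    fix t :: "'a list" assume "t \<noteq> []"
    have "head Q b \<noteq> tail Q b" using nc NP last_a by auto
    then have "t @ [b] @ [b, a] \<notin> NP"
      using NP_append3[of t "[b]" "[b, a]"] \<open>t \<noteq> []\<close> by auto
    then show "?w \<noteq> [] @ t @ [b] @ [b, a]" using w' by (metis append_Nil)
  qed
  ultimately have "coef f p + coef f p = 0"
    using center3_flank[OF f NP(2) ba(2) w'] s(3) by (simp add: algebra_simps)
  then show False using p char_0_double by blast
qed

text \<open>At the word \<open>a p b\<close> the monomial \<open>a f b\<close> contributes the
  coefficient of \<open>p\<close>. The conditions on the ends of \<open>p\<close> exclude
  \<open>f a b\<close> and \<open>a b f\<close>; the remaining three begin with \<open>b\<close> or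
  end with \<open>a\<close>.\<close>

lemma center3_middle:
  assumes f: "f \<in> center3 A" and p: "coef f p \<noteq> 0" and w: "[a] @ p @ [b] \<in> NP"
    and ab: "a \<noteq> b" and last: "last p \<noteq> a" and hd: "hd p \<noteq> b"
  shows False
proof -
  have p0: "p \<noteq> []" using center3_NP[OF f p] NP_not_Nil by simp
  have NP: "[a] \<in> NP" "[b] \<in> NP" using w NP_append3[of "[a]" p "[b]"] p0 by auto
  let ?w = "[a] @ p @ [b]"
  have "flank (coef f) [a] [b] ?w = coef f p" by (rule flank_eq) (use p0 in auto)
  moreover have "flank (coef f) ([b] @ [a]) [] ?w = 0" "flank (coef f) [b] [a] ?w = 0"
    using ab by (auto intro: flank_hd)
  moreover have "flank (coef f) [] ([b] @ [a]) ?w = 0" using ab by (auto intro: flank_last)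
  moreover have "flank (coef f) ([a] @ [b]) [] ?w = 0"
    by (rule flank_prefix[of _ "[a, hd p]" "tl p @ [b]"]) (use hd p0 in auto)
  moreover have "flank (coef f) [] ([a] @ [b]) ?w = 0"
    by (rule flank_suffix[of _ "a # butlast p" "[last p, b]"]) (use last p0 in auto)
  ultimately show False using center3_flank[OF f NP w] p by simp
qed

text \<open>Cutting a closed path \<open>p = q r\<close> behind its maximal initial power of one arrow, the words
  \<open>p p\<close> and \<open>r q r q\<close> show that the coefficients of \<open>p\<close> and \<open>r q\<close> are twice each other.\<close>

lemma center3_closed:
  assumes f: "f \<in> center3 A" and p: "coef f p \<noteq> 0" and closed: "head Q (last p) = tail Q (hd p)"
  shows "p = replicate (length p) (hd p)"
proof -
  have pNP: "p \<in> NP" using center3_NP[OF f p] .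
  then have p0: "p \<noteq> []" by (rule NP_not_Nil)
  define q where "q = takeWhile (\<lambda>x. x = hd p) p"
  define r where "r = dropWhile (\<lambda>x. x = hd p) p"
  have p_eq: "p = q @ r" by (simp add: q_def r_def)
  have q0: "q \<noteq> []" and hd_q: "hd q = hd p" using p0 by (cases p; simp add: q_def)+
  have "r = []"
  proof (rule ccontr)
    assume r0: "r \<noteq> []"
    \<comment> \<open>By the choice of the cut, \<open>q\<close> and \<open>r\<close> begin with
      different arrows. This excludes the monomials beginning with \<open>r\<close> at the first
      word and those beginning with \<open>q\<close> at the second.\<close>
    have hd_r: "hd r \<noteq> hd p" using hd_dropWhile[of "\<lambda>x. x = hd p" p] r0 by (simp add: r_def)
    have NP: "q \<in> NP" "r \<in> NP" "head Q (last q) = tail Q (hd r)"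
      using pNP p_eq NP_append[OF q0 r0] by auto
    have rq: "head Q (last r) = tail Q (hd q)" using closed p_eq hd_q r0 by simp
    have neq: "q @ r \<noteq> r @ q" using hd_r hd_q q0 r0 by (metis hd_append2)
    let ?w = "(q @ r) @ q @ r" and ?w' = "(r @ q) @ r @ q"
    have w: "?w \<in> NP" "?w' \<in> NP" using NP rq q0 r0 by (auto simp: NP_append)
    have "flank (coef f) [] (q @ r) ?w = coef f p" by (rule flank_eq) (use p_eq p0 in auto)
    moreover have "flank (coef f) (q @ r) [] ?w = coef f p" by (rule flank_eq) (use p_eq p0 in auto)
    moreover have "flank (coef f) q r ?w = coef f (r @ q)" by (rule flank_eq) (use r0 in auto)
    moreover have "flank (coef f) (r @ q) [] ?w = 0" "flank (coef f) r q ?w = 0"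
      using hd_r hd_q q0 r0 by (auto intro!: flank_hd)
    moreover have "flank (coef f) [] (r @ q) ?w = 0"
      by (rule flank_suffix[of _ "q @ r" "q @ r"]) (use neq in auto)
    ultimately have 1: "2 * coef f p = coef f (r @ q)"
      using center3_flank[OF f NP(1,2) w(1)] by simp
    have "flank (coef f) [] (r @ q) ?w' = coef f (r @ q)" by (rule flank_eq) (use q0 in auto)
    moreover have "flank (coef f) (r @ q) [] ?w' = coef f (r @ q)" by (rule flank_eq) (use q0 in auto)
    moreover have "flank (coef f) r q ?w' = coef f p" by (rule flank_eq) (use p_eq p0 in auto)
    moreover have "flank (coef f) (q @ r) [] ?w' = 0" "flank (coef f) q r ?w' = 0"
      using hd_r hd_q q0 r0 by (auto intro!: flank_hd)
    moreover have "flank (coef f) [] (q @ r) ?w' = 0"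
      by (rule flank_suffix[of _ "r @ q" "r @ q"]) (use neq in auto)
    ultimately have 2: "2 * coef f (r @ q) = coef f p"
      using center3_flank[OF f NP(1,2) w(2)] by simp
    show False using char_0_triple[OF 1 2] p by simp
  qed
  then have "\<forall>x\<in>set p. x = hd p" by (simp add: r_def)
  then show ?thesis by (metis replicate_length_same)
qed

text \<open>Test words give four exclusions: no second loop at the vertex, no incoming together with
  outgoing arrows, nothing after an outgoing arrow, nothing before an incoming one. So the loop with
  its outgoing arrows, or with its incoming ones, is closed under composability and is
  everything.\<close>

lemma center3_loop:
  assumes conn: "arc_connected Q" and f: "f \<in> center3 A"
    and p: "coef f p \<noteq> 0" and p_eq: "p = replicate k a" and loop: "head Q a = tail Q a"
  shows "(\<forall>b\<in>arcs Q - {a}. head Q b = head Q a \<and> tail Q b \<noteq> head Q b) \<or>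
    (\<forall>b\<in>arcs Q - {a}. tail Q b = tail Q a \<and> tail Q b \<noteq> head Q b)"
proof -
  have pNP: "p \<in> NP" using center3_NP[OF f p] .
  then have p0: "p \<noteq> []" by (rule NP_not_Nil)
  then have k: "k > 0" and hd: "hd p = a" and last: "last p = a" using p_eq by auto
  have a: "a \<in> arcs Q" using NP_arcs[OF pNP] p_eq k by auto
  have no_loop: "b = a" if b: "b \<in> arcs Q" "tail Q b = tail Q a" "head Q b = tail Q a" for b
  proof (rule ccontr)
    assume "b \<noteq> a"
    \<comment> \<open>The test paths must not begin with \<open>a\<close> and must not commute;
      \<open>[b]\<close> and \<open>[b, a]\<close> satisfy both.\<close>
    have "p @ [b] @ [b, a] \<in> NP"
      using b a pNP p0 last loop by (simp add: NP_append NP_Cons NP_singleton)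
    from center3_commute_right[OF f p this] hd \<open>b \<noteq> a\<close> show False by simp
  qed
  have in_out: False if b: "b \<in> arcs Q" "tail Q b = tail Q a" "head Q b \<noteq> tail Q a"
    and c: "c \<in> arcs Q" "head Q c = tail Q a" "tail Q c \<noteq> tail Q a" for b c
  proof (rule center3_middle[OF f p])
    show "[c] @ p @ [b] \<in> NP"
      using b c pNP p0 hd last loop by (simp add: NP_append NP_Cons NP_singleton)
  qed (use b c hd last loop in auto)
  have out_sink: False if b: "b \<in> arcs Q" "tail Q b = tail Q a" "head Q b \<noteq> tail Q a"
    and d: "d \<in> arcs Q" "head Q b = tail Q d" for b d
  proof -
    have "p @ [b] @ [d] \<in> NP"
      using b d pNP p0 last loop by (simp add: NP_append NP_Cons NP_singleton)
    moreover have "a \<noteq> b" "a \<noteq> d" "b \<noteq> d" using b d loop by auto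
    ultimately show False using center3_commute_right[OF f p, of "[b]" "[d]"] hd by simp
  qed
  have in_source: False if c: "c \<in> arcs Q" "head Q c = tail Q a" "tail Q c \<noteq> tail Q a"
    and d: "d \<in> arcs Q" "head Q d = tail Q c" for c d
  proof -
    have "[d] @ [c] @ p \<in> NP"
      using c d pNP p0 hd loop by (simp add: NP_append NP_Cons NP_singleton)
    moreover have "a \<noteq> c" "a \<noteq> d" "c \<noteq> d" using c d loop by auto
    ultimately show False using center3_commute_left[OF f p, of "[d]" "[c]"] last by simp
  qed
  show ?thesis
  proof (cases "\<exists>b\<in>arcs Q. tail Q b = tail Q a \<and> head Q b \<noteq> tail Q a")
    case True
    then obtain b0 where b0: "b0 \<in> arcs Q" "tail Q b0 = tail Q a" "head Q b0 \<noteq> tail Q a" by blast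
    let ?S = "insert a {b\<in>arcs Q. tail Q b = tail Q a \<and> head Q b \<noteq> tail Q a}"
    have "?S = arcs Q"
    proof (rule arc_connectedD[OF conn])
      show "y \<in> ?S" if "x \<in> ?S" "y \<in> arcs Q" "head Q x = tail Q y" for x y
        using that no_loop out_sink loop by (cases "x = a") auto
      show "y \<in> ?S" if "x \<in> ?S" "y \<in> arcs Q" "head Q y = tail Q x" for x y
        using that no_loop in_out[OF b0] loop by (cases "x = a") auto
    qed (use a in auto)
    then have "b \<in> ?S" if "b \<in> arcs Q" for b using that by simp
    then have "tail Q b = tail Q a \<and> tail Q b \<noteq> head Q b" if "b \<in> arcs Q - {a}" for b
      using that by fastforce
    then show ?thesis by (intro disjI2 ballI)
  next
    case False
    let ?S = "insert a {b\<in>arcs Q. head Q b = tail Q a \<and> tail Q b \<noteq> tail Q a}"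
    have "?S = arcs Q"
    proof (rule arc_connectedD[OF conn])
      show "y \<in> ?S" if "x \<in> ?S" "y \<in> arcs Q" "head Q x = tail Q y" for x y
        using that no_loop False loop by (cases "x = a") auto
      show "y \<in> ?S" if "x \<in> ?S" "y \<in> arcs Q" "head Q y = tail Q x" for x y
        using that no_loop in_source loop by (cases "x = a") auto
    qed (use a in auto)
    then have "b \<in> ?S" if "b \<in> arcs Q" for b using that by simp
    then have "head Q b = head Q a \<and> tail Q b \<noteq> head Q b" if "b \<in> arcs Q - {a}" for b
      using that loop by fastforce
    then show ?thesis by (intro disjI1 ballI)
  qed
qed

lemma triple_path_prod:
  assumes "p \<in> NP" "q \<in> NP" "r \<in> NP"
  shows "path_prod Q (path_prod Q (Poly_Mapping.single p x) (Poly_Mapping.single q y)) (Poly_Mapping.single r z)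
    = (if p @ q @ r \<in> NP then Poly_Mapping.single (p @ q @ r) (x * y * z) else 0)"
  using assms NP_not_Nil by (auto simp: path_prod_single NP_append3)

lemma nontrivial_path_triple_iff:
  assumes "p \<in> NP" "q \<in> NP" "r \<in> NP"
  shows "nontrivial_triple A (pe p) (pe q) (pe r) \<longleftrightarrow>
    p @ q @ r \<in> NP \<or> q @ p @ r \<in> NP \<or> r @ q @ p \<in> NP \<or> p @ r @ q \<in> NP \<or> q @ r @ p \<in> NP \<or> r @ p @ q \<in> NP"
  by (simp add: nontrivial_triple_iff mult_A triple_path_prod assms)

text \<open>The two alternatives of the property correspond to closed and non-closed paths. A closed
  path is a power of a loop; for a non-closed one every order of a triple with distinct arrows is
  refuted, where non-closedness supplies the side conditions of
  \<open>center3_middle\<close>.\<close>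

lemma center3_property_star:
  assumes conn: "arc_connected Q" and f: "f \<in> center3 A" and p: "coef f p \<noteq> 0"
  shows "property_star K Q p"
proof (cases "head Q (last p) = tail Q (hd p)")
  case True
  have pNP: "p \<in> NP" using center3_NP[OF f p] .
  then have p0: "p \<noteq> []" by (rule NP_not_Nil)
  have p_eq: "p = replicate (length p) (hd p)" by (rule center3_closed[OF f p True])
  have "last p = hd p" using p0 by (subst p_eq) simp
  then have loop: "head Q (hd p) = tail Q (hd p)" using True by simp
  have "hd p \<in> arcs Q" using NP_arcs[OF pNP] hd_in_set[OF p0] by blast
  moreover have "length p \<ge> 1" using p0 by (cases p) auto
  ultimately show ?thesis
    unfolding property_star_def using center3_loop[OF conn f p p_eq loop] p_eq loop by metis
next
  case False
  have pNP: "p \<in> NP" using center3_NP[OF f p] .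
  have right: "p @ [a, b] \<notin> NP" and left: "[a, b] @ p \<notin> NP" if "a \<noteq> b" for a b
    using center3_nonclosed_right[OF f p False] center3_nonclosed_left[OF f p False] that by blast+
  have middle: "[a] @ p @ [b] \<notin> NP" if "a \<noteq> b" for a b
  proof
    assume w: "[a] @ p @ [b] \<in> NP"
    then have "head Q a = tail Q (hd p)" "head Q (last p) = tail Q b"
      using NP_append3[of "[a]" p "[b]"] NP_not_Nil[OF pNP] by auto
    moreover from this have "last p \<noteq> a" "hd p \<noteq> b" using False by auto
    ultimately show False using center3_middle[OF f p w that] by blast
  qed
  have "\<not> nontrivial_triple A (pe p) (pe [a]) (pe [b])"
    if "a \<in> arcs Q" "b \<in> arcs Q" "a \<noteq> b" for a b
    using that right left middle by (simp add: nontrivial_path_triple_iff pNP NP_singleton)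
  then show ?thesis unfolding property_star_def by blast
qed

end

section \<open>Paths with \<open>property_star\<close> lie in the 3-center\<close>

lemma replicate_append_commute: "replicate i c @ replicate j c = replicate j c @ replicate i c"
  by (simp add: replicate_add[symmetric] add.commute)

context path_algebra
begin

lemma St3_single:
  fixes x y z :: 'k
  assumes "p \<in> NP" "q \<in> NP" "r \<in> NP"
  defines "W \<equiv> \<lambda>w. if w \<in> NP then Poly_Mapping.single w (x * y * z) else 0"
  shows "St3 A (Poly_Mapping.single p x) (Poly_Mapping.single q y) (Poly_Mapping.single r z) =
    W (p @ q @ r) - W (q @ p @ r) - W (r @ q @ p) - W (p @ r @ q) + W (q @ r @ p) + W (r @ p @ q)"
  by (simp add: St3_A triple_path_prod assms mult_ac)

text \<open>All six words coincide, and three signs are plus and three are minus.\<close>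

lemma St3_powers:
  "q = replicate i c \<Longrightarrow> r = replicate j c \<Longrightarrow> p = replicate k c \<Longrightarrow>
    p \<in> NP \<Longrightarrow> q \<in> NP \<Longrightarrow> r \<in> NP \<Longrightarrow>
    St3 A (Poly_Mapping.single p x) (Poly_Mapping.single q y) (Poly_Mapping.single r z) = 0"
  by (simp add: St3_single replicate_add[symmetric] add_ac)

context
  fixes p
  assumes p: "p \<in> NP"
    and no_triple: "\<And>a b. a \<noteq> b \<Longrightarrow> p @ [a, b] \<notin> NP \<and> [a] @ p @ [b] \<notin> NP \<and> [a, b] @ p \<notin> NP"
begin

lemma p_nonempty: "p \<noteq> []" using p by (rule NP_not_Nil)

lemma power_right: "p @ w \<in> NP \<Longrightarrow> w \<noteq> [] \<Longrightarrow> w = replicate (length w) (hd w)"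
proof (induction w rule: induct_list012)
  case (3 c d w)
  then have NP: "head Q (last p) = tail Q c" "c \<in> arcs Q" "head Q c = tail Q d" "d # w \<in> NP"
    using p_nonempty by (auto simp: NP_append NP_Cons)
  then have "d \<in> arcs Q" using NP_arcs[OF NP(4)] by simp
  then have "p @ [c, d] \<in> NP" using NP p p_nonempty by (simp add: NP_append NP_Cons NP_singleton)
  then have cd: "c = d" using no_triple[of c d] by metis
  then have "p @ d # w \<in> NP" using NP p p_nonempty by (simp add: NP_append)
  then show ?case using 3(2) cd by simp
qed auto

lemma power_left: "w @ p \<in> NP \<Longrightarrow> w \<noteq> [] \<Longrightarrow> w = replicate (length w) (last w)"
proof (induction w rule: rev_induct)
  case (snoc c w)
  show ?case
  proof (cases "w = []")
    case False
    let ?d = "last w"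
    have NP: "head Q c = tail Q (hd p)" "c \<in> arcs Q" "head Q ?d = tail Q c" "w \<in> NP"
      using snoc.prems False p_nonempty NP_append3[of w "[c]" p] by (auto simp: NP_singleton)
    then have "?d \<in> arcs Q" using NP_arcs[OF NP(4)] last_in_set[OF False] by blast
    then have "[?d, c] @ p \<in> NP" using NP p p_nonempty by (simp add: NP_append NP_Cons NP_singleton)
    then have cd: "?d = c" using no_triple[of ?d c] by metis
    then have "w @ p \<in> NP" using NP p p_nonempty False by (simp add: NP_append)
    then have "w = replicate (length w) c" using snoc.IH cd False by simp
    then show ?thesis by (metis append_Cons append_Nil last_snoc length_append_singleton
        replicate_append_same replicate_Suc)
  qed simp
qed simp

text \<open>The path \<open>p c (hd p)\<close> forces \<open>hd p = c\<close>. Moreover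
  \<open>p\<close> composes with itself, so \<open>power_right\<close> applies to \<open>p\<close>
  as its own continuation.\<close>

lemma power_closed:
  assumes c: "c \<in> arcs Q" "head Q c = tail Q c" "head Q (last p) = tail Q c" "head Q c = tail Q (hd p)"
  shows "p = replicate (length p) c"
proof -
  have "hd p \<in> arcs Q" using NP_arcs[OF p] hd_in_set[OF p_nonempty] by blast
  then have "p @ [c, hd p] \<in> NP" using c p p_nonempty by (simp add: NP_append NP_Cons NP_singleton)
  then have "hd p = c" using no_triple[of c "hd p"] by metis
  moreover have "p @ p \<in> NP" using c p p_nonempty by (simp add: NP_append)
  ultimately show ?thesis using power_right[OF _ p_nonempty] by simp
qed

text \<open>If the loop attaches to both ends of \<open>p\<close>, all three paths are powers of it.
  Otherwise \<open>q p r\<close> and \<open>r p q\<close> are no paths, and the other four terms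
  cancel in pairs because \<open>q\<close> and \<open>r\<close> commute.\<close>

lemma St3_loop_powers:
  assumes q: "q = replicate i c" "q \<in> NP" and r: "r = replicate j c" "r \<in> NP"
    and c: "c \<in> arcs Q" "head Q c = tail Q c"
  shows "St3 A (Poly_Mapping.single p x) (Poly_Mapping.single q y) (Poly_Mapping.single r z) = 0"
proof (cases "head Q (last p) = tail Q c \<and> head Q c = tail Q (hd p)")
  case True
  then show ?thesis using St3_powers[OF q(1) r(1) power_closed[OF c] p q(2) r(2)] by simp
next
  case False
  have ne: "p \<noteq> []" "q \<noteq> []" "r \<noteq> []" 
    using p_nonempty NP_not_Nil[OF q(2)] NP_not_Nil[OF r(2)] by simp_all
  have ends: "hd q = c" "last q = c" "hd r = c" "last r = c" using q(1) r(1) ne by auto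
  have comm: "q @ r = r @ q" unfolding q(1) r(1) by (rule replicate_append_commute)
  then have comm': "q @ r @ p = r @ q @ p" by (metis append_assoc)
  have "q @ p @ r \<notin> NP" "r @ p @ q \<notin> NP"
    using False ends ne by (auto simp: NP_append3)
  then show ?thesis unfolding St3_single[OF p q(2) r(2)] comm comm' by simp
qed

text \<open>If \<open>q\<close> and \<open>r\<close> stand together on one side of \<open>p\<close>,
  they are powers of a common loop. Otherwise \<open>q p r\<close> and \<open>r p q\<close> are the
  only possible terms, with opposite signs.\<close>

lemma St3_no_triple:
  assumes q: "q \<in> NP" and r: "r \<in> NP"
  shows "St3 A (Poly_Mapping.single p x) (Poly_Mapping.single q y) (Poly_Mapping.single r z) = 0"
proof -
  have ne: "q \<noteq> []" "r \<noteq> []" using q r NP_not_Nil by auto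
  have powers: ?thesis
    if "q = replicate (length q) c" "r = replicate (length r) c" "c \<in> arcs Q" "head Q c = tail Q c" for c
    using St3_loop_powers[OF that(1) q that(2) r that(3,4)] .
  have all_eq: "q' = replicate (length q') c \<and> r' = replicate (length r') c"
    if "q' @ r' = replicate n c" for q' r' :: "'a list" and n c
  proof -
    have "set (q' @ r') \<subseteq> {c}" unfolding that by auto
    then have "\<forall>x\<in>set q'. x = c" "\<forall>x\<in>set r'. x = c" by auto
    then show ?thesis by (metis replicate_length_same)
  qed
  consider (right) "p @ q @ r \<in> NP \<or> p @ r @ q \<in> NP" | (left) "q @ r @ p \<in> NP \<or> r @ q @ p \<in> NP"
    | (none) "p @ q @ r \<notin> NP" "p @ r @ q \<notin> NP" "q @ r @ p \<notin> NP" "r @ q @ p \<notin> NP" by blast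
  then show ?thesis
  proof cases
    case right
    then obtain q' r' where qr: "(q', r') = (q, r) \<or> (q', r') = (r, q)" and w: "p @ q' @ r' \<in> NP" by auto
    then have ne': "q' \<noteq> []" "r' \<noteq> []" using ne by auto
    from power_right[OF w] ne' all_eq obtain c
      where c: "q' = replicate (length q') c" "r' = replicate (length r') c" by blast
    then have "last q' = c" "hd r' = c" using ne' by (metis last_replicate hd_replicate length_0_conv)+
    moreover have "head Q (last q') = tail Q (hd r')" "q' \<in> NP"
      using w NP_append3[OF p_nonempty ne'] by auto
    ultimately have "head Q c = tail Q c" "c \<in> arcs Q"
      using NP_arcs[of q'] last_in_set[OF ne'(1)] by auto
    then show ?thesis using powers c qr by auto
  next
    case left
    then obtain q' r' where qr: "(q', r') = (q, r) \<or> (q', r') = (r, q)" and w: "q' @ r' @ p \<in> NP" by auto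
    then have ne': "q' \<noteq> []" "r' \<noteq> []" using ne by auto
    have "(q' @ r') @ p \<in> NP" using w by simp
    from power_left[OF this] ne' all_eq obtain c
      where c: "q' = replicate (length q') c" "r' = replicate (length r') c" by blast
    then have "last q' = c" "hd r' = c" using ne' by (metis last_replicate hd_replicate length_0_conv)+
    moreover have "head Q (last q') = tail Q (hd r')" "q' \<in> NP"
      using w NP_append3[OF ne' p_nonempty] by auto
    ultimately have "head Q c = tail Q c" "c \<in> arcs Q"
      using NP_arcs[of q'] last_in_set[OF ne'(1)] by auto
    then show ?thesis using powers c qr by auto
  next
    case none
    \<comment> \<open>The two remaining terms cancel because a path of this form forces its outer
      factors to be equal.\<close>
    have eq: "q' = r'" if qr: "(q', r') = (q, r) \<or> (q', r') = (r, q)" and w: "q' @ p @ r' \<in> NP" for q' r'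
    proof -
      have ne': "q' \<noteq> []" "r' \<noteq> []" using qr ne by auto
      have NP: "q' \<in> NP" "r' \<in> NP" "head Q (last q') = tail Q (hd p)" "head Q (last p) = tail Q (hd r')"
        using w NP_append3[OF ne'(1) p_nonempty ne'(2)] by auto
      have q': "q' = replicate (length q') (last q')"
        using power_left[of q'] NP ne' p p_nonempty by (simp add: NP_append)
      have r': "r' = replicate (length r') (hd r')"
        using power_right[of r'] NP ne' p p_nonempty by (simp add: NP_append)
      have arcs: "last q' \<in> arcs Q" "hd r' \<in> arcs Q"
        using NP_arcs NP(1,2) last_in_set[OF ne'(1)] hd_in_set[OF ne'(2)] by blast+
      have "[last q'] @ p @ [hd r'] \<in> NP"
        using NP arcs p p_nonempty by (simp add: NP_append NP_Cons NP_singleton)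
      then have c: "last q' = hd r'" using no_triple[of "last q'" "hd r'"] by metis
      \<comment> \<open>With a loop, \<open>r'\<close> could be moved in front of \<open>p\<close>,
        against the assumption of this case.\<close>
      have not_loop: "head Q (last q') \<noteq> tail Q (last q')"
      proof
        assume loop: "head Q (last q') = tail Q (last q')"
        have "q' @ r' @ p \<in> NP"
          using NP loop c r' ne' p p_nonempty
          by (simp add: NP_append3) (metis last_replicate length_0_conv)
        then show False using none qr by auto
      qed
      \<comment> \<open>A power of an arrow that is not a loop is a path only if its exponent is
        1.\<close>
      have short: "length u = 1" if "u = replicate (length u) (last q')" "u \<in> NP" for u
      proof (rule ccontr)
        assume "length u \<noteq> 1"
        moreover have "length u \<noteq> 0" using that(2) NP_not_Nil by auto
        ultimately obtain n where "length u = Suc (Suc n)" by (metis One_nat_def not0_implies_Suc)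
        then have "u = last q' # last q' # replicate n (last q')" using that(1) by simp
        then show False using that(2) not_loop by (metis NP_Cons list.sel(1) list.distinct(1))
      qed
      have "length q' = 1" using short[OF q' NP(1)] .
      moreover have "length r' = 1" using short[of r'] r' c NP(2) by simp
      ultimately show "q' = r'" using q' r' c by metis
    qed
    have "q = r" if "q @ p @ r \<in> NP \<or> r @ p @ q \<in> NP"
      using that eq[of q r] eq[of r q] by auto
    then show ?thesis using none by (auto simp: St3_single p q r)
  qed
qed

end

text \<open>Every path ends at the vertex of \<open>c\<close>, and those that also start there are
  powers of \<open>c\<close>. Any other path can only be the first factor: with two such paths no
  word survives, and with one the two surviving words cancel because the two powers commute.\<close>

lemma St3_loop_sink:
  assumes c: "c \<in> arcs Q" "tail Q c = head Q c"
    and arcs: "\<forall>b\<in>arcs Q - {c}. head Q b = head Q c \<and> tail Q b \<noteq> head Q b"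
    and p: "p = replicate k c" "p \<in> NP" and q: "q \<in> NP" and r: "r \<in> NP"
  shows "St3 A (Poly_Mapping.single p x) (Poly_Mapping.single q y) (Poly_Mapping.single r z) = 0"
proof -
  have heads: "head Q b = head Q c" if "b \<in> arcs Q" for b using arcs that by auto
  have last_head: "head Q (last t) = head Q c" if "t \<in> NP" for t
    using heads NP_arcs[OF that] last_in_set[OF NP_not_Nil[OF that]] by blast
  have power: "t = replicate (length t) c" if "t \<in> NP" "tail Q (hd t) = head Q c" for t
    using that
  proof (induction t)
    case (Cons a t)
    have "a \<in> arcs Q" using NP_arcs[OF Cons.prems(1)] by simp
    then have "a = c" using arcs Cons.prems(2) by (metis Diff_iff list.sel(1) singletonD)
    moreover have "t = replicate (length t) c"
    proof (cases "t = []")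
      case False
      then show ?thesis using Cons.IH Cons.prems(1) heads \<open>a \<in> arcs Q\<close> by (simp add: NP_Cons)
    qed simp
    ultimately show ?case by simp
  qed simp
  have ne: "p \<noteq> []" "q \<noteq> []" "r \<noteq> []"
    using NP_not_Nil[OF p(2)] NP_not_Nil[OF q] NP_not_Nil[OF r] by simp_all
  consider "tail Q (hd q) = head Q c" "tail Q (hd r) = head Q c"
    | "tail Q (hd q) \<noteq> head Q c" "tail Q (hd r) \<noteq> head Q c"
    | "tail Q (hd q) = head Q c" "tail Q (hd r) \<noteq> head Q c"
    | "tail Q (hd q) \<noteq> head Q c" "tail Q (hd r) = head Q c" by blast
  then show ?thesis
  proof cases
    case 1
    then show ?thesis using St3_powers[OF power[OF q] power[OF r] p(1) p(2) q r] by simp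
  next
    case 2
    then show ?thesis by (simp add: St3_single p(2) q r NP_append3 ne last_head)
  next
    case 3
    have comm: "q @ p = p @ q" using power[OF q 3(1)] p(1) replicate_append_commute by metis
    have "p @ q @ r \<notin> NP" "q @ p @ r \<notin> NP" "p @ r @ q \<notin> NP" "q @ r @ p \<notin> NP"
      using 3 by (auto simp: NP_append3 ne last_head q p(2))
    then show ?thesis unfolding St3_single[OF p(2) q r] comm by simp
  next
    case 4
    have comm: "r @ p = p @ r" using power[OF r 4(2)] p(1) replicate_append_commute by metis
    have "p @ q @ r \<notin> NP" "r @ q @ p \<notin> NP" "p @ r @ q \<notin> NP" "r @ p @ q \<notin> NP"
      using 4 by (auto simp: NP_append3 ne last_head r p(2))
    then show ?thesis unfolding St3_single[OF p(2) q r] comm by simp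
  qed
qed

text \<open>Mirror image of \<open>St3_loop_sink\<close>: a path that does not end at the vertex of
  \<open>c\<close> can only be the last factor.\<close>

lemma St3_loop_source:
  assumes c: "c \<in> arcs Q" "tail Q c = head Q c"
    and arcs: "\<forall>b\<in>arcs Q - {c}. tail Q b = tail Q c \<and> tail Q b \<noteq> head Q b"
    and p: "p = replicate k c" "p \<in> NP" and q: "q \<in> NP" and r: "r \<in> NP"
  shows "St3 A (Poly_Mapping.single p x) (Poly_Mapping.single q y) (Poly_Mapping.single r z) = 0"
proof -
  have tails: "tail Q b = tail Q c" if "b \<in> arcs Q" for b using arcs that by auto
  have hd_tail: "tail Q (hd t) = tail Q c" if "t \<in> NP" for t
    using tails NP_arcs[OF that] hd_in_set[OF NP_not_Nil[OF that]] by blast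
  have power: "t = replicate (length t) c" if "t \<in> NP" "head Q (last t) = tail Q c" for t
    using that
  proof (induction t rule: rev_induct)
    case (snoc a t)
    have "a \<in> arcs Q" using NP_arcs[OF snoc.prems(1)] by simp
    then have "a = c" using arcs snoc.prems(2) by (metis Diff_iff last_snoc singletonD)
    moreover have "t = replicate (length t) c"
    proof (cases "t = []")
      case False
      then show ?thesis using snoc.IH snoc.prems(1) tails \<open>a \<in> arcs Q\<close> by (simp add: NP_append)
    qed simp
    ultimately show ?case by (metis length_append_singleton replicate_Suc replicate_append_same)
  qed simp
  have ne: "p \<noteq> []" "q \<noteq> []" "r \<noteq> []"
    using NP_not_Nil[OF p(2)] NP_not_Nil[OF q] NP_not_Nil[OF r] by simp_all
  consider "head Q (last q) = tail Q c" "head Q (last r) = tail Q c"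
    | "head Q (last q) \<noteq> tail Q c" "head Q (last r) \<noteq> tail Q c"
    | "head Q (last q) = tail Q c" "head Q (last r) \<noteq> tail Q c"
    | "head Q (last q) \<noteq> tail Q c" "head Q (last r) = tail Q c" by blast
  then show ?thesis
  proof cases
    case 1
    then show ?thesis using St3_powers[OF power[OF q] power[OF r] p(1) p(2) q r] by simp
  next
    case 2
    then show ?thesis by (simp add: St3_single p(2) q r NP_append3 ne hd_tail)
  next
    case 3
    have comm: "p @ q @ r = q @ p @ r" using power[OF q 3(1)] p(1) replicate_append_commute by (metis append_assoc)
    have "r @ q @ p \<notin> NP" "r @ p @ q \<notin> NP" "p @ r @ q \<notin> NP" "q @ r @ p \<notin> NP"
      using 3 by (auto simp: NP_append3 ne hd_tail q p(2))
    then show ?thesis unfolding St3_single[OF p(2) q r] comm by simp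
  next
    case 4
    have comm: "p @ r @ q = r @ p @ q" using power[OF r 4(2)] p(1) replicate_append_commute by (metis append_assoc)
    have "p @ q @ r \<notin> NP" "r @ q @ p \<notin> NP" "q @ p @ r \<notin> NP" "q @ r @ p \<notin> NP"
      using 4 by (auto simp: NP_append3 ne hd_tail r p(2))
    then show ?thesis unfolding St3_single[OF p(2) q r] comm by simp
  qed
qed

lemma St3_property_star:
  assumes p: "p \<in> NP" "property_star K Q p" and q: "q \<in> NP" and r: "r \<in> NP"
  shows "St3 A (Poly_Mapping.single p x) (Poly_Mapping.single q y) (Poly_Mapping.single r z) = 0"
  using p(2) unfolding property_star_def
proof (elim disjE bexE exE conjE)
  assume no_triple: "\<not> (\<exists>a\<in>arcs Q. \<exists>b\<in>arcs Q. a \<noteq> b \<and> nontrivial_triple A (pe p) (pe [a]) (pe [b]))"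
  show ?thesis
  proof (rule St3_no_triple[OF p(1) _ q r])
    fix a b :: 'a assume "a \<noteq> b"
    show "p @ [a, b] \<notin> NP \<and> [a] @ p @ [b] \<notin> NP \<and> [a, b] @ p \<notin> NP"
    proof (cases "a \<in> arcs Q \<and> b \<in> arcs Q")
      case True
      then have "\<not> nontrivial_triple A (pe p) (pe [a]) (pe [b])" using no_triple \<open>a \<noteq> b\<close> by blast
      then show ?thesis using True by (simp add: nontrivial_path_triple_iff p NP_singleton)
    next
      case False
      have "\<not> set t \<subseteq> arcs Q \<Longrightarrow> t \<notin> NP" for t using NP_arcs by blast
      with False show ?thesis by auto
    qed
  qed
next
  \<comment> \<open>A lone loop is the sink shape with no further arrows.\<close>
  fix c k assume c: "c \<in> arcs Q" "tail Q c = head Q c" "p = replicate k c" "arcs Q = {c}"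
  then show ?thesis using St3_loop_sink[OF c(1,2) _ c(3) p(1) q r] by simp
next
  fix c k assume c: "c \<in> arcs Q" "tail Q c = head Q c" "p = replicate k c"
    and "\<forall>b\<in>arcs Q - {c}. head Q b = head Q c \<and> tail Q b \<noteq> head Q b"
  then show ?thesis using St3_loop_sink[OF c(1,2) _ c(3) p(1) q r] by blast
next
  fix c k assume c: "c \<in> arcs Q" "tail Q c = head Q c" "p = replicate k c"
    and "\<forall>b\<in>arcs Q - {c}. tail Q b = tail Q c \<and> tail Q b \<noteq> head Q b"
  then show ?thesis using St3_loop_source[OF c(1,2) _ c(3) p(1) q r] by blast
qed

lemma center3_eq_span:
  assumes conn: "arc_connected Q"
  shows "center3 A = alg_span A {pe p | p. p \<in> NP \<and> property_star K Q p}"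
  unfolding span_paths
proof (intro subset_antisym subsetI CollectI ballI)
  fix f p assume f: "f \<in> center3 A" and "p \<in> Poly_Mapping.keys f"
  then have "coef f p \<noteq> 0" by (simp add: in_keys_iff)
  then show "p \<in> NP \<and> property_star K Q p"
    using center3_NP[OF f] center3_property_star[OF conn f] by blast
next
  fix f :: "'a list \<Rightarrow>\<^sub>0 'k" assume "f \<in> {f. \<forall>p\<in>Poly_Mapping.keys f. p \<in> NP \<and> property_star K Q p}"
  then have f: "p \<in> NP \<and> property_star K Q p" if "p \<in> Poly_Mapping.keys f" for p using that by blast
  have "St3 A f g h = 0" if "g \<in> car A" "h \<in> car A" for g h
  proof (rule St3_eq_0I)
    fix p q r :: "'a list" and x y z :: 'k
    assume "p \<in> Poly_Mapping.keys f" "q \<in> Poly_Mapping.keys g" "r \<in> Poly_Mapping.keys h"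
    then have "p \<in> NP" "property_star K Q p" "q \<in> NP" "r \<in> NP" using f that by (auto simp: car_A)
    then show "St3 A (Poly_Mapping.single p x) (Poly_Mapping.single q y) (Poly_Mapping.single r z) = 0"
      by (rule St3_property_star)
  qed
  then show "f \<in> center3 A" using f by (auto simp: center3_def car_A)
qed

end

section \<open>Circles\<close>

text \<open>Arrows are indexed by all natural numbers modulo \<open>n\<close>. A path is then given
  by a starting index and a length, and going round the circle needs no case distinction.\<close>

locale circle_algebra = path_algebra Q K
  for Q :: "('v, 'a) pre_digraph" and K :: "'k::field_char_0 itself" +
  fixes n :: nat and b :: "nat \<Rightarrow> 'a"
  assumes n_pos: "n > 0" and arcs_b: "arcs Q = range b"
    and b_eq_iff: "b i = b j \<longleftrightarrow> i mod n = j mod n"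
    and composable_iff: "head Q (b i) = tail Q (b j) \<longleftrightarrow> Suc i mod n = j mod n"
begin

definition P :: "nat \<Rightarrow> nat \<Rightarrow> 'a list" where
  "P j l = map b [j..<j + l]"

lemma length_P [simp]: "length (P j l) = l" by (simp add: P_def)

lemma nth_P [simp]: "i < l \<Longrightarrow> P j l ! i = b (j + i)" by (simp add: P_def)

lemma P_eq_Nil [simp]: "P j l = [] \<longleftrightarrow> l = 0" by (auto simp: P_def)

lemma P_in_NP: "l > 0 \<Longrightarrow> P j l \<in> NP"
  by (auto simp: NP_iff successively_conv_nth composable_iff arcs_b) (auto simp: P_def)

lemma NP_is_P:
  assumes "p \<in> NP"
  obtains j where "p = P j (length p)"
proof -
  have p0: "p \<noteq> []" and arcs: "set p \<subseteq> range b"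
    and path: "\<And>i. Suc i < length p \<Longrightarrow> head Q (p ! i) = tail Q (p ! Suc i)"
    using assms arcs_b by (auto simp: NP_iff successively_conv_nth)
  have in_range: "p ! i \<in> range b" if "i < length p" for i using subsetD[OF arcs nth_mem[OF that]] .
  obtain j where j: "p ! 0 = b j" using in_range[of 0] p0 by blast
  have "p ! i = b (j + i)" if "i < length p" for i
    using that
  proof (induction i)
    case (Suc i)
    obtain k where k: "p ! Suc i = b k" using in_range[OF Suc.prems] by blast
    have "Suc (j + i) mod n = k mod n" using path[of i] Suc k composable_iff by simp
    then show ?case using k b_eq_iff by simp
  qed (use j in simp)
  then have "p = P j (length p)" by (intro nth_equalityI) auto
  then show ?thesis by (rule that)
qed

lemma P_cong: "i mod n = j mod n \<Longrightarrow> P i l = P j l"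
  by (intro nth_equalityI) (auto simp: b_eq_iff intro: mod_add_cong)

lemma P_eq_iff:
  assumes "l > 0"
  shows "P i l = P j m \<longleftrightarrow> l = m \<and> i mod n = j mod n"
proof
  assume eq: "P i l = P j m"
  then have "l = m" by (metis length_P)
  moreover have "b i = b j" using arg_cong[OF eq, of "\<lambda>p. p ! 0"] assms \<open>l = m\<close> by simp
  ultimately show "l = m \<and> i mod n = j mod n" by (simp add: b_eq_iff)
qed (auto intro: P_cong)

lemma P_append: "P j l @ P (j + l) m = P j (l + m)"
  using upt_add_eq_append[of j "j + l" m] by (simp add: P_def add.assoc)

lemma take_P: "i \<le> l \<Longrightarrow> take i (P j l) = P j i"
  by (intro nth_equalityI) auto

lemma drop_P: "i \<le> l \<Longrightarrow> drop i (P j l) = P (j + i) (l - i)"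
  by (intro nth_equalityI) (auto simp: add.assoc)

lemma poly_mapping_eq_on_P:
  assumes "f \<in> car A" "g \<in> car A" "\<And>j l. l > 0 \<Longrightarrow> coef f (P j l) = coef g (P j l)"
  shows "f = g"
proof (rule poly_mapping_eqI)
  fix p show "coef f p = coef g p"
  proof (cases "p \<in> NP")
    case True
    then obtain j where "p = P j (length p)" by (rule NP_is_P)
    then show ?thesis using assms(3)[of "length p" j] NP_not_Nil[OF True] by simp
  qed (simp add: coef_notin assms)
qed

lemma coef_mult_P:
  assumes "f \<in> car A" "g \<in> car A" "l > 0"
  shows "coef (path_prod Q f g) (P j l) =
    (\<Sum>i\<in>{0<..<l}. coef f (P j i) * coef g (P (j + i) (l - i)))"
  unfolding coef_mult[OF assms(1,2)]
  using P_in_NP[OF assms(3)] by (auto simp: take_P drop_P intro!: sum.cong)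

text \<open>Compare \<open>f v\<close> and \<open>v f\<close> at a path of length
  \<open>l + 1\<close> with last arrow \<open>v\<close>. If \<open>n\<close> divides
  \<open>l\<close>, the path also begins with \<open>v\<close> and the next rotation appears;
  otherwise it does not, and the coefficient is zero.\<close>

lemma center_imp_rotation_invariant:
  assumes f: "f \<in> center A" and l: "l > 0"
  shows "coef f (P j l) = (if n dvd l then coef f (P 0 l) else 0)"
proof -
  have step: "coef f (P j l) = (if n dvd l then coef f (P (Suc j) l) else 0)" for j
  proof -
    let ?w = "P j (Suc l)" and ?v = "[b (j + l)]"
    have w1: "?w = [] @ P j l @ ?v"
      using P_append[of j l 1] by (simp add: P_def)
    have w2: "?w = [b j] @ P (Suc j) l @ []"
      using P_append[of j 1 l] by (simp add: P_def)
    have "?v \<in> NP" using arcs_b by (simp add: NP_singleton)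
    then have "coef f (P j l) = flank (coef f) ?v [] ?w"
      using center_flank[OF f _ P_in_NP, of ?v "Suc l" j] flank_eq[OF w1, of "coef f"] l by simp
    also have "\<dots> = (if n dvd l then coef f (P (Suc j) l) else 0)"
    proof (cases "n dvd l")
      case True
      then have "b (j + l) = b j" by (auto simp: b_eq_iff)
      then show ?thesis using flank_eq[OF w2, of "coef f"] l True by simp
    next
      case False
      then have "b (j + l) \<noteq> b j"
        by (metis b_eq_iff add.commute add_0_right mod_eq_dvd_iff_nat diff_add_inverse le_add1)
      then have "flank (coef f) ?v [] ?w = 0" by (intro flank_hd) (auto simp: w2)
      then show ?thesis using False by simp
    qed
    finally show ?thesis .
  qed
  show ?thesis
  proof (induction j)
    case 0
    show ?case using step[of 0] by auto
  next
    case (Suc j)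
    then show ?case using step[of j] step[of "Suc j"] by (auto split: if_splits)
  qed
qed

text \<open>Only cuts at multiples of \<open>n\<close> contribute, and there the shift of the
  starting point of \<open>g\<close> is invisible. Reflecting the cut position \<open>i\<close> to
  \<open>l - i\<close> then produces the opposite product.\<close>

lemma rotation_invariant_imp_center:
  assumes f: "f \<in> car A"
    and inv: "\<And>j l. l > 0 \<Longrightarrow> coef f (P j l) = (if n dvd l then coef f (P 0 l) else 0)"
  shows "f \<in> center A"
proof -
  have "path_prod Q f g = path_prod Q g f" if g: "g \<in> car A" for g
  proof (rule poly_mapping_eq_on_P)
    show "path_prod Q f g \<in> car A" "path_prod Q g f \<in> car A"
      using closed_algD(3)[OF closed_A] f g by (auto simp: mult_A)
    fix j l :: nat assume l: "l > 0"
    have "coef (path_prod Q f g) (P j l) = (\<Sum>i\<in>{0<..<l}. coef f (P j i) * coef g (P j (l - i)))"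
      unfolding coef_mult_P[OF f g l]
    proof (rule sum.cong)
      fix i assume i: "i \<in> {0<..<l}"
      show "coef f (P j i) * coef g (P (j + i) (l - i)) = coef f (P j i) * coef g (P j (l - i))"
      proof (cases "n dvd i")
        case True
        then have "P (j + i) (l - i) = P j (l - i)" by (intro P_cong) auto
        then show ?thesis by simp
      qed (use inv[of i j] i in simp)
    qed simp
    also have "\<dots> = (\<Sum>i\<in>{0<..<l}. coef f (P j (l - i)) * coef g (P j i))"
      by (rule sum.reindex_bij_witness[of _ "\<lambda>i. l - i" "\<lambda>i. l - i"]) auto
    also have "\<dots> = coef (path_prod Q g f) (P j l)"
      unfolding coef_mult_P[OF g f l]
    proof (rule sum.cong)
      fix i assume i: "i \<in> {0<..<l}"
      then have "coef f (P j (l - i)) = coef f (P (j + i) (l - i))" using inv[of "l - i"] by simp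
      then show "coef f (P j (l - i)) * coef g (P j i) = coef g (P j i) * coef f (P (j + i) (l - i))"
        by simp
    qed simp
    finally show "coef (path_prod Q f g) (P j l) = coef (path_prod Q g f) (P j l)" .
  qed
  then show ?thesis using f by (auto simp: center_def mult_A)
qed

text \<open>The element \<open>f(c_1) + ... + f(c_n)\<close> written on basis paths:
  \<open>P i (k * n)\<close> is the \<open>k\<close>-th power of a full turn. The inner sum starts
  at \<open>k = 1\<close>, so a constant term is ignored.\<close>

definition poly_elem :: "'k poly \<Rightarrow> ('a list \<Rightarrow>\<^sub>0 'k)" where
  "poly_elem F = (\<Sum>i<n. \<Sum>k = 1..degree F. Poly_Mapping.single (P i (k * n)) (coeff F k))"

lemma poly_elem_in_car: "poly_elem F \<in> car A"
  unfolding poly_elem_def using n_pos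
  by (intro closed_alg_sum[OF closed_A] single_in_car P_in_NP) auto

lemma coef_poly_elem:
  assumes "l > 0"
  shows "coef (poly_elem F) (P j l) = (if n dvd l then coeff F (l div n) else 0)"
proof -
  have eq: "coef (Poly_Mapping.single (P i (k * n)) (coeff F k)) (P j l) =
      (if i = j mod n then if k * n = l then coeff F k else 0 else 0)" if "i < n" for i k
    using that P_eq_iff[OF assms, of j i "k * n"] by (auto simp: lookup_single when_def)
  have "coef (poly_elem F) (P j l) =
      (\<Sum>i<n. \<Sum>k = 1..degree F. if i = j mod n then if k * n = l then coeff F k else 0 else 0)"
    unfolding poly_elem_def lookup_sum by (intro sum.cong refl eq) simp
  also have "\<dots> = (\<Sum>i<n. if i = j mod n then \<Sum>k = 1..degree F. if k * n = l then coeff F k else 0 else 0)"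
    by (intro sum.cong refl) auto
  also have "\<dots> = (\<Sum>k = 1..degree F. if k * n = l then coeff F k else 0)"
    using n_pos by simp
  also have "\<dots> = (if n dvd l then coeff F (l div n) else 0)"
  proof (cases "n dvd l")
    case True
    then obtain m where m: "l = m * n" by (metis dvd_div_mult_self)
    then have "m > 0" using assms by simp
    have "(\<Sum>k = 1..degree F. if k * n = l then coeff F k else 0) =
        (\<Sum>k = 1..degree F. if k = m then coeff F k else 0)"
      using n_pos m by (intro sum.cong) auto
    also have "\<dots> = coeff F m" using \<open>m > 0\<close> by (auto simp: not_le coeff_eq_0)
    finally show ?thesis using m n_pos by simp
  qed (auto intro!: sum.neutral)
  finally show ?thesis .
qed

text \<open>A central element is determined by its coefficients at the full windings
  \<open>P 0 (k * n)\<close>; these become the coefficients of the polynomial, and cuts at multiples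
  of \<open>n\<close> become the terms of the Cauchy product.\<close>

lemma poly_elem_iso: "alg_iso poly_elem (polys_no_const K) (center_alg A)"
proof -
  have car: "car (polys_no_const K) = {F. coeff F 0 = 0}"
    by (simp add: polys_no_const_def poly_0_coeff_0)
  have in_center: "poly_elem F \<in> center A" for F
    by (rule rotation_invariant_imp_center[OF poly_elem_in_car]) (simp add: coef_poly_elem)
  have inj: "F = G" if "poly_elem F = poly_elem G" "coeff F 0 = 0" "coeff G 0 = 0" for F G
  proof (rule poly_eqI)
    fix k show "coeff F k = coeff G k"
    proof (cases "k = 0")
      case False
      then show ?thesis
        using arg_cong[OF that(1), of "\<lambda>f. coef f (P 0 (k * n))"] n_pos by (simp add: coef_poly_elem)
    qed (use that in simp)
  qed
  have surj: "\<exists>F. coeff F 0 = 0 \<and> f = poly_elem F" if f: "f \<in> center A" for f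
  proof -
    define c where "c k = (if k = 0 then 0 else coef f (P 0 (k * n)))" for k
    \<comment> \<open>A degree bound: a key \<open>P 0 (k * n)\<close> has length at least
      \<open>k\<close>. Inserting 0 covers the zero element, which has no keys.\<close>
    define N where "N = Max (insert 0 (length ` Poly_Mapping.keys f))"
    have "c k = 0" if "k > N" for k
    proof (rule ccontr)
      assume "c k \<noteq> 0"
      then have "P 0 (k * n) \<in> Poly_Mapping.keys f" by (auto simp: c_def in_keys_iff split: if_splits)
      then have "k * n \<in> length ` Poly_Mapping.keys f" by (metis image_eqI length_P)
      then have "k * n \<le> N" unfolding N_def by (intro Max_ge) auto
      moreover have "k \<le> k * n" using n_pos by simp
      ultimately show False using that by simp
    qed
    then have coeff: "coeff (Abs_poly c) = c" by (intro coeff_Abs_poly) auto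
    have "f = poly_elem (Abs_poly c)"
    proof (rule poly_mapping_eq_on_P)
      show "f \<in> car A" using f by (simp add: center_def)
      fix j l :: nat assume "l > 0"
      then show "coef f (P j l) = coef (poly_elem (Abs_poly c)) (P j l)"
        unfolding coef_poly_elem[OF \<open>l > 0\<close>] coeff center_imp_rotation_invariant[OF f \<open>l > 0\<close>, of j]
        using n_pos by (auto simp: c_def dvd_imp_le)
    qed (rule poly_elem_in_car)
    moreover have "coeff (Abs_poly c) 0 = 0" unfolding coeff by (simp add: c_def)
    ultimately show ?thesis by blast
  qed
  have mult: "poly_elem (F * G) = path_prod Q (poly_elem F) (poly_elem G)"
    if F: "coeff F 0 = 0" and G: "coeff G 0 = 0" for F G
  proof (rule poly_mapping_eq_on_P)
    show "path_prod Q (poly_elem F) (poly_elem G) \<in> car A"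
      using closed_algD(3)[OF closed_A poly_elem_in_car poly_elem_in_car] by (simp add: mult_A)
    fix j l :: nat assume l: "l > 0"
    define h where "h i = (if n dvd i then coeff F (i div n) else 0) *
      (if n dvd l - i then coeff G ((l - i) div n) else 0)" for i
    have lhs: "coef (path_prod Q (poly_elem F) (poly_elem G)) (P j l) = sum h {0<..<l}"
      unfolding coef_mult_P[OF poly_elem_in_car poly_elem_in_car l] h_def
      by (intro sum.cong) (auto simp: coef_poly_elem)
    have "sum h {0<..<l} = (if n dvd l then coeff (F * G) (l div n) else 0)"
    proof (cases "n dvd l")
      case False
      then have "h i = 0" if "i \<in> {0<..<l}" for i
        using that dvd_diffD[of n l i] by (auto simp: h_def)
      then show ?thesis using False by simp
    next
      case True
      then obtain m where m: "l = m * n" by (metis dvd_div_mult_self)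
      then have "m > 0" using l by simp
      have "sum h {0<..<l} = sum h ((\<lambda>k. k * n) ` {0<..<m})"
      proof (rule sum.mono_neutral_right)
        show "\<forall>i\<in>{0<..<l} - (\<lambda>k. k * n) ` {0<..<m}. h i = 0"
        proof
          fix i assume i: "i \<in> {0<..<l} - (\<lambda>k. k * n) ` {0<..<m}"
          have "\<not> n dvd i"
          proof
            assume "n dvd i"
            then obtain k where k: "i = k * n" by (metis dvd_div_mult_self)
            then have "k \<in> {0<..<m}" using i m by auto
            then show False using i k by auto
          qed
          then show "h i = 0" by (simp add: h_def)
        qed
      qed (use m n_pos in auto)
      also have "\<dots> = (\<Sum>k\<in>{0<..<m}. h (k * n))"
        using n_pos by (subst sum.reindex) (auto simp: inj_on_def)
      also have "\<dots> = (\<Sum>k\<in>{0<..<m}. coeff F k * coeff G (m - k))"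
      proof (rule sum.cong)
        fix k assume "k \<in> {0<..<m}"
        have "l - k * n = (m - k) * n" by (simp add: m diff_mult_distrib)
        then show "h (k * n) = coeff F k * coeff G (m - k)" using n_pos by (simp add: h_def)
      qed simp
      \<comment> \<open>Both end terms contain a constant coefficient, which is zero, so the sum
        extends to the full Cauchy product.\<close>
      also have "\<dots> = (\<Sum>k\<le>m. coeff F k * coeff G (m - k))"
      proof (rule sum.mono_neutral_left)
        show "\<forall>k\<in>{..m} - {0<..<m}. coeff F k * coeff G (m - k) = 0"
        proof
          fix k assume "k \<in> {..m} - {0<..<m}"
          then have "k = 0 \<or> k = m" by auto
          then show "coeff F k * coeff G (m - k) = 0" using F G by auto
        qed
      qed auto
      finally show ?thesis using True m n_pos by (simp add: coeff_mult)
    qed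
    then show "coef (poly_elem (F * G)) (P j l) = coef (path_prod Q (poly_elem F) (poly_elem G)) (P j l)"
      using lhs l by (simp add: coef_poly_elem)
  qed (rule poly_elem_in_car)
  have add: "poly_elem (F + G) = poly_elem F + poly_elem G" for F G
    by (rule poly_mapping_eq_on_P)
       (auto simp: poly_elem_in_car coef_poly_elem lookup_add intro!: closed_algD(2)[OF closed_A])
  have scale: "poly_elem (smult c F) = scale A c (poly_elem F)" for c F
    by (rule poly_mapping_eq_on_P)
       (auto simp: poly_elem_in_car coef_poly_elem scale_A coef_scale
         intro!: closed_algD(4)[OF closed_A, unfolded scale_A])
  have "bij_betw poly_elem (car (polys_no_const K)) (center A)"
    using in_center inj surj unfolding car bij_betw_def by (auto simp: inj_on_def image_iff)
  then show ?thesis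
    unfolding alg_iso_def using mult add scale by (auto simp: car) (auto simp: polys_no_const_def mult_A)
qed

lemma polys_closed: "closed_alg (polys_no_const K)"
  by (auto simp: closed_alg_def polys_no_const_def)

lemma center_isomorphic_polys: "alg_isomorphic (center_alg A) (polys_no_const K)"
  using alg_iso_inv[OF poly_elem_iso polys_closed] unfolding alg_isomorphic_def by blast

lemma center_eq_poly_elem: "center A = {poly_elem F | F. poly F 0 = 0}"
  using alg_isoD(1)[OF poly_elem_iso] by (auto simp: bij_betw_def polys_no_const_def)

lemma alg_power_P:
  assumes "k > 0"
  shows "alg_power A (pe (P j n)) k = pe (P j (k * n))"
proof -
  have step: "path_prod Q (pe (P j (k * n))) (pe (P j n)) = pe (P j (Suc k * n))" if "k > 0" for k
  proof -
    have "P j n = P (j + k * n) n" by (rule P_cong) simp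
    then have "P j (k * n) @ P j n = P j (Suc k * n)"
      using P_append[of j "k * n" n] by (simp add: add.commute)
    moreover have "Suc k * n > 0" "k * n > 0" using n_pos that by auto
    ultimately have "head Q (last (P j (k * n))) = tail Q (hd (P j n))"
      using P_in_NP[of "Suc k * n" j] n_pos NP_append[of "P j (k * n)" "P j n"] by simp
    then show ?thesis using \<open>P j (k * n) @ P j n = P j (Suc k * n)\<close> by (simp add: path_prod_single)
  qed
  have "((\<lambda>y. mult A y (pe (P j n))) ^^ m) (pe (P j n)) = pe (P j (Suc m * n))" for m
  proof (induction m)
    case (Suc m)
    then show ?case using step[of "Suc m"] by (simp add: mult_A)
  qed simp
  from this[of "k - 1"] show ?thesis using assms by (simp add: alg_power_def)
qed

lemma poly_elem_eq_poly_at: "poly_elem F = (\<Sum>i<n. poly_at A F (pe (P i n)))"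
proof -
  have scale: "scale A c (pe p) = Poly_Mapping.single p c" for c p
    by (rule poly_mapping_eqI) (simp add: scale_A coef_scale lookup_single when_def)
  show ?thesis
    unfolding poly_elem_def poly_at_def
    by (intro sum.cong refl) (simp add: alg_power_P scale)
qed

text \<open>A loop has one path of each length, so rotation invariance is automatic.\<close>

lemma loop_commutative:
  assumes "n = 1"
  shows "center A = car A"
proof -
  have "f \<in> center A" if f: "f \<in> car A" for f
  proof (rule rotation_invariant_imp_center[OF f])
    show "coef f (P j l) = (if n dvd l then coef f (P 0 l) else 0)" for j l
      using P_cong[of j 0 l] assms by simp
  qed
  then show ?thesis by (auto simp: center_def)
qed

lemma loop_center3:
  assumes "n = 1"
  shows "center3 A = car A"
proof -
  have comm: "path_prod Q x y = path_prod Q y x" if "x \<in> car A" "y \<in> car A" for x y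
    using that loop_commutative[OF assms] by (auto simp: center_def mult_A)
  have "St3 A x y z = 0" if "x \<in> car A" "y \<in> car A" "z \<in> car A" for x y z
    unfolding St3_A comm[OF that(2,1)] comm[OF that(3,2)] comm[OF that(3,1)] by simp
  then show ?thesis by (auto simp: center3_def)
qed

end

text \<open>Residues start at 0 and the arrows of \<open>circle\<close> at 1, hence the index
  \<open>k mod n + 1\<close>.\<close>

lemma circle_algebraI:
  fixes Q :: "('v, 'a) pre_digraph" and K :: "'k::field_char_0 itself"
  assumes Q: "quiver Q" and n: "n \<ge> 1"
    and iso: "pre_digraph.digraph_isomorphism (circle n) h" "Q = app_iso h (circle n)"
  shows "circle_algebra Q n (\<lambda>k. iso_arcs h (k mod n + 1))"
proof -
  let ?b = "\<lambda>k. iso_arcs h (k mod n + 1)"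
  have inj: "inj_on (iso_verts h) {1..n}" "inj_on (iso_arcs h) {1..n}"
    using iso(1) by (auto simp: pre_digraph.digraph_isomorphism_def circle_def)
  have ends: "tail Q (iso_arcs h a) = iso_verts h a"
    "head Q (iso_arcs h a) = iso_verts h (if a < n then a + 1 else 1)" if "a \<in> {1..n}" for a
  proof -
    have "tail Q = iso_tail h" "head Q = iso_head h" by (simp_all add: iso(2))
    moreover have "a \<in> arcs (circle n)" using that by (simp add: circle_def)
    then have "iso_verts h (tail (circle n) a) = iso_tail h (iso_arcs h a)"
      "iso_verts h (head (circle n) a) = iso_head h (iso_arcs h a)"
      using iso(1) unfolding pre_digraph.digraph_isomorphism_def by blast+
    ultimately show "tail Q (iso_arcs h a) = iso_verts h a"
      "head Q (iso_arcs h a) = iso_verts h (if a < n then a + 1 else 1)"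
      by (simp_all add: circle_def)
  qed
  have range: "k mod n + 1 \<in> {1..n}" for k using n by (simp add: Suc_leI)
  show ?thesis
  proof (intro circle_algebra.intro circle_algebra_axioms.intro path_algebra.intro)
    show "quiver Q" by (rule Q)
    show "n > 0" using n by simp
    have "arcs Q = iso_arcs h ` {1..n}" using iso(2) by (simp add: circle_def)
    also have "{1..n} = range (\<lambda>k. k mod n + 1)"
    proof (intro subset_antisym subsetI)
      fix x assume "x \<in> {1..n}"
      then show "x \<in> range (\<lambda>k. k mod n + 1)" by (intro image_eqI[of _ _ "x - 1"]) auto
    qed (use range in auto)
    finally show "arcs Q = range ?b" by (simp add: image_image)
    show "?b i = ?b j \<longleftrightarrow> i mod n = j mod n" for i j
      using inj_on_eq_iff[OF inj(2) range range] by simp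
    show "head Q (?b i) = tail Q (?b j) \<longleftrightarrow> Suc i mod n = j mod n" for i j
    proof -
      have "(if i mod n + 1 < n then i mod n + 1 + 1 else 1) = Suc i mod n + 1"
        using range[of i] by (auto simp: mod_Suc)
      then have "head Q (?b i) = iso_verts h (Suc i mod n + 1)" using ends(2)[OF range] by simp
      then show ?thesis
        using ends(1)[OF range, of j] inj_on_eq_iff[OF inj(1) range range] by simp
    qed
  qed
qed

text \<open>The pieces \<open>[i..<n + 1]\<close> and \<open>[1..<i]\<close> form one run of
  \<open>n\<close> consecutive residues that starts at \<open>i - 1\<close>.\<close>

lemma circle_path_eq:
  assumes "1 \<le> i" "i \<le> n"
  shows "circle_path n a i = map (\<lambda>k. a (k mod n + 1)) [i - 1..<i - 1 + n]"
proof -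
  have "map (\<lambda>k. k mod n + 1) [i - 1..<i - 1 + n] = [i..<n + 1] @ [1..<i]"
  proof (rule nth_equalityI)
    fix t assume "t < length (map (\<lambda>k. k mod n + 1) [i - 1..<i - 1 + n])"
    then have t: "t < n" by simp
    show "map (\<lambda>k. k mod n + 1) [i - 1..<i - 1 + n] ! t = ([i..<n + 1] @ [1..<i]) ! t"
    proof (cases "t < n + 1 - i")
      case True
      then show ?thesis using t assms by (simp add: nth_append del: upt_Suc)
    next
      case False
      then have "(i - 1 + t) mod n = i - 1 + t - n"
        using t assms by (simp add: le_mod_geq)
      then show ?thesis using t assms False by (simp add: nth_append del: upt_Suc)
    qed
  qed (use assms in simp)
  then show ?thesis
    unfolding circle_path_def using map_map[of a "\<lambda>k. k mod n + 1" "[i - 1..<i - 1 + n]"]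
    by (simp add: o_def)
qed

section \<open>Decompositions and connectivity\<close>

text \<open>The linear map that \<open>k\<close> induces on basis elements.\<close>

definition push :: "('b \<Rightarrow> 'c) \<Rightarrow> ('b \<Rightarrow>\<^sub>0 'k) \<Rightarrow> ('c \<Rightarrow>\<^sub>0 'k::comm_monoid_add)" where
  "push k f = (\<Sum>p\<in>Poly_Mapping.keys f. Poly_Mapping.single (k p) (coef f p))"

lemma push_id: "push id f = f"
  by (simp add: push_def flip: poly_mapping_sum_singles)

lemma coef_push:
  assumes "inj_on k X" "Poly_Mapping.keys f \<subseteq> X" "p \<in> X"
  shows "coef (push k f) (k p) = coef f p"
proof -
  have "coef (push k f) (k p) = (\<Sum>q\<in>Poly_Mapping.keys f. if q = p then coef f q else 0)"
    unfolding push_def lookup_sum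
    by (intro sum.cong) (use assms in \<open>auto simp: lookup_single when_def dest: inj_onD\<close>)
  then show ?thesis by (auto simp: in_keys_iff)
qed

lemma coef_push_zero: "q \<notin> k ` Poly_Mapping.keys f \<Longrightarrow> coef (push k f) q = 0"
  by (auto simp: push_def lookup_sum lookup_single when_def intro!: sum.neutral)

text \<open>The principal subalgebra sees only which arrows compose, so the axioms constrain arrows
  and not vertices; blocks may share vertices of \<open>Q\<close>. The renaming \<open>g\<close> is
  the identity for components and leads back from natural numbers for
  \<open>alg_connected\<close>.\<close>

locale decomposition = path_algebra Q K
  for Q :: "('v, 'a) pre_digraph" and K :: "'k::field_char_0 itself" +
  fixes n :: nat and F :: "nat \<Rightarrow> ('w, 'b) pre_digraph" and g :: "'b \<Rightarrow> 'a"
  assumes quiver_F: "i < n \<Longrightarrow> quiver (F i)"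
    and inj_g: "i < n \<Longrightarrow> inj_on g (arcs (F i))"
    and arcs_F: "arcs Q = (\<Union>i<n. g ` arcs (F i))"
    and disjoint_F: "i < n \<Longrightarrow> j < n \<Longrightarrow> a \<in> arcs (F i) \<Longrightarrow> b \<in> arcs (F j) \<Longrightarrow> g a = g b \<Longrightarrow> i = j"
    and composable_F: "i < n \<Longrightarrow> j < n \<Longrightarrow> a \<in> arcs (F i) \<Longrightarrow> b \<in> arcs (F j) \<Longrightarrow>
      head Q (g a) = tail Q (g b) \<longleftrightarrow> i = j \<and> head (F i) a = tail (F i) b"
begin

lemma path_algebra_F: "i < n \<Longrightarrow> path_algebra (F i)"
  by (intro path_algebra.intro quiver_F)

lemmas NP_F_iff = path_algebra.NP_iff[OF path_algebra_F]

lemma map_g_in_NP: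
  assumes "i < n" "p \<in> nontrivial_paths (F i)"
  shows "map g p \<in> NP"
proof -
  have p: "p \<noteq> []" "set p \<subseteq> arcs (F i)" "\<And>j. Suc j < length p \<Longrightarrow> head (F i) (p ! j) = tail (F i) (p ! Suc j)"
    using assms by (auto simp: NP_F_iff successively_conv_nth)
  have "p ! j \<in> arcs (F i)" if "j < length p" for j
    using subsetD[OF p(2) nth_mem[OF that]] .
  then have "successively (\<lambda>a b. head Q a = tail Q b) (map g p)"
    using p(3) assms(1) by (auto simp: successively_conv_nth composable_F)
  then show ?thesis using p assms(1) arcs_F by (auto simp: NP_iff)
qed

text \<open>Composable arrows lie in one block, so a path stays in the block of its first
  arrow.\<close>

lemma NP_is_map_g:
  assumes "w \<in> NP"
  obtains i p where "i < n" "p \<in> nontrivial_paths (F i)" "w = map g p"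
proof -
  have w: "w \<noteq> []" "set w \<subseteq> arcs Q" and path: "\<And>j. Suc j < length w \<Longrightarrow> head Q (w ! j) = tail Q (w ! Suc j)"
    using assms by (auto simp: NP_iff successively_conv_nth)
  have in_F: "\<exists>i<n. w ! j \<in> g ` arcs (F i)" if "j < length w" for j
    using subsetD[OF w(2) nth_mem[OF that]] arcs_F by auto
  obtain i where i: "i < n" "w ! 0 \<in> g ` arcs (F i)" using in_F[of 0] w by auto
  have wj: "w ! j \<in> g ` arcs (F i)" if "j < length w" for j
    using that
  proof (induction j)
    case (Suc j)
    then obtain a where a: "a \<in> arcs (F i)" "w ! j = g a" by auto
    obtain i' b where b: "i' < n" "b \<in> arcs (F i')" "w ! Suc j = g b" using in_F[OF Suc.prems] by auto
    then show ?case using composable_F[OF i(1) b(1) a(1) b(2)] path[OF Suc.prems] a by auto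
  qed (use i in simp)
  define p where "p = map (inv_into (arcs (F i)) g) w"
  have p_nth: "p ! j \<in> arcs (F i)" "g (p ! j) = w ! j" if "j < length w" for j
    using wj[OF that] that by (auto simp: p_def inv_into_into f_inv_into_f)
  have len: "length p = length w" by (simp add: p_def)
  have w_eq: "w = map g p" by (rule nth_equalityI) (use p_nth len in auto)
  have "head (F i) (p ! j) = tail (F i) (p ! Suc j)" if "Suc j < length p" for j
    using path[of j] that p_nth[of j] p_nth[of "Suc j"] len composable_F[OF i(1) i(1), of "p ! j" "p ! Suc j"]
    by simp
  moreover have "set p \<subseteq> arcs (F i)" using p_nth len by (metis in_set_conv_nth subsetI)
  moreover have "p \<noteq> []" using w len by auto
  ultimately have "p \<in> nontrivial_paths (F i)" by (simp add: NP_F_iff[OF i(1)] successively_conv_nth)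
  from that[OF i(1) this w_eq] show ?thesis .
qed

lemma map_g_eq:
  assumes "i < n" "j < n" "p \<in> nontrivial_paths (F i)" "q \<in> nontrivial_paths (F j)" "map g p = map g q"
  shows "i = j \<and> p = q"
proof -
  have p: "p \<noteq> []" "set p \<subseteq> arcs (F i)" and q: "q \<noteq> []" "set q \<subseteq> arcs (F j)"
    using assms by (auto simp: NP_F_iff)
  have "g (hd p) = g (hd q)" using arg_cong[OF assms(5), of hd] p(1) q(1) by (simp add: hd_map)
  moreover have "hd p \<in> arcs (F i)" "hd q \<in> arcs (F j)" using p q hd_in_set by blast+
  ultimately have ij: "i = j" using disjoint_F assms by blast
  then have "inj_on g (set p \<union> set q)" using inj_g[OF assms(1)] p q by (auto intro: inj_on_subset)
  then show ?thesis using ij assms(5) map_inj_on by blast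
qed

abbreviation DS :: "('k, nat \<Rightarrow> 'b list \<Rightarrow>\<^sub>0 'k) nu_alg" where
  "DS \<equiv> direct_sum n (\<lambda>i. principal_subalg K (F i))"

definition glue :: "(nat \<Rightarrow> 'b list \<Rightarrow>\<^sub>0 'k) \<Rightarrow> ('a list \<Rightarrow>\<^sub>0 'k)" where
  "glue x = (\<Sum>i<n. push (map g) (x i))"

lemma DS_keys: "x \<in> car DS \<Longrightarrow> i < n \<Longrightarrow> Poly_Mapping.keys (x i) \<subseteq> nontrivial_paths (F i)"
  using path_algebra.car_A[OF path_algebra_F] by (auto simp: car_direct_sum)

lemma closed_DS: "closed_alg DS"
  by (intro direct_sum_closed path_algebra.closed_A path_algebra_F)

lemma coef_glue:
  assumes x: "x \<in> car DS" and i: "i < n" and p: "p \<in> nontrivial_paths (F i)"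
  shows "coef (glue x) (map g p) = coef (x i) p"
proof -
  have "coef (push (map g) (x j)) (map g p) = (if j = i then coef (x i) p else 0)" if j: "j < n" for j
  proof (cases "j = i")
    case True
    have "inj_on (map g) (nontrivial_paths (F i))"
      using map_g_eq[OF i i] by (auto intro: inj_onI)
    then show ?thesis using coef_push[OF _ DS_keys[OF x i] p] True by simp
  next
    case False
    have "map g p \<notin> map g ` Poly_Mapping.keys (x j)"
    proof
      assume "map g p \<in> map g ` Poly_Mapping.keys (x j)"
      then obtain q where "q \<in> nontrivial_paths (F j)" "map g p = map g q"
        using DS_keys[OF x j] by blast
      then show False using map_g_eq[OF i j p] False by blast
    qed
    then show ?thesis using False by (simp add: coef_push_zero)
  qed
  then show ?thesis using i by (simp add: glue_def lookup_sum)
qed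

lemma glue_in_car:
  assumes x: "x \<in> car DS"
  shows "glue x \<in> car A"
proof (rule in_carI)
  fix w assume w: "w \<notin> NP"
  have "w \<notin> map g ` Poly_Mapping.keys (x i)" if "i < n" for i
    using map_g_in_NP[OF that] DS_keys[OF x that] w by blast
  then show "coef (glue x) w = 0" by (simp add: glue_def lookup_sum coef_push_zero)
qed

lemma poly_mapping_eq_on_map_g:
  assumes "f \<in> car A" "f' \<in> car A"
    "\<And>i p. i < n \<Longrightarrow> p \<in> nontrivial_paths (F i) \<Longrightarrow> coef f (map g p) = coef f' (map g p)"
  shows "f = f'"
proof (rule poly_mapping_eqI)
  fix w show "coef f w = coef f' w"
  proof (cases "w \<in> NP")
    case True
    then obtain i p where "i < n" "p \<in> nontrivial_paths (F i)" "w = map g p" by (rule NP_is_map_g)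
    then show ?thesis using assms(3) by simp
  qed (simp add: coef_notin assms)
qed

lemma glue_inj: "inj_on glue (car DS)"
proof (rule inj_onI, rule ext)
  fix x y i assume x: "x \<in> car DS" and y: "y \<in> car DS" and eq: "glue x = glue y"
  show "x i = y i"
  proof (cases "i < n")
    case True
    show ?thesis
    proof (rule poly_mapping_eqI)
      fix p show "coef (x i) p = coef (y i) p"
      proof (cases "p \<in> nontrivial_paths (F i)")
        case True
        then show ?thesis using coef_glue[OF x \<open>i < n\<close>] coef_glue[OF y \<open>i < n\<close>] eq by metis
      next
        case False
        then show ?thesis using DS_keys[OF x \<open>i < n\<close>] DS_keys[OF y \<open>i < n\<close>]
          by (metis in_keys_iff subsetD)
      qed
    qed
  qed (use x y in \<open>simp add: car_direct_sum\<close>)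
qed

lemma glue_surj:
  assumes f: "f \<in> car A"
  shows "f \<in> glue ` car DS"
proof -
  define c where "c i p = (if p \<in> nontrivial_paths (F i) then coef f (map g p) else 0)" for i p
  define x where "x i = (if i < n then Abs_poly_mapping (c i) else 0)" for i
  have coef_x: "coef (x i) p = c i p" if i: "i < n" for i p
  proof -
    have "inj_on (map g) {p. c i p \<noteq> 0}"
      using map_g_eq[OF i i] by (auto intro!: inj_onI simp: c_def split: if_splits)
    moreover have "finite (map g ` {p. c i p \<noteq> 0})"
      by (rule finite_subset[of _ "Poly_Mapping.keys f"]) (auto simp: c_def in_keys_iff split: if_splits)
    ultimately have "finite {p. c i p \<noteq> 0}" by (metis finite_imageD)
    then show ?thesis using i by (simp add: x_def)
  qed
  have x: "x \<in> car DS"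
    using path_algebra.in_carI[OF path_algebra_F, of _ "x _" K] coef_x
    by (auto simp: car_direct_sum c_def) (simp add: x_def)
  have "f = glue x"
    by (rule poly_mapping_eq_on_map_g[OF f glue_in_car[OF x]])
       (simp add: coef_glue[OF x] coef_x c_def)
  then show ?thesis using x by blast
qed

text \<open>Cuts of \<open>map g p\<close> are images of cuts of \<open>p\<close>, so
  \<open>coef_mult\<close> gives the same sum on both sides.\<close>

lemma glue_mult:
  assumes x: "x \<in> car DS" and y: "y \<in> car DS"
  shows "glue (mult DS x y) = path_prod Q (glue x) (glue y)"
proof (rule poly_mapping_eq_on_map_g)
  note xy = closed_algD(3)[OF closed_DS x y]
  show "glue (mult DS x y) \<in> car A" by (rule glue_in_car[OF xy])
  show "path_prod Q (glue x) (glue y) \<in> car A"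
    using closed_algD(3)[OF closed_A glue_in_car[OF x] glue_in_car[OF y]] by (simp add: mult_A)
  fix i p assume i: "i < n" and p: "p \<in> nontrivial_paths (F i)"
  interpret Fi: path_algebra "F i" K by (rule path_algebra_F[OF i])
  have car: "x i \<in> car Fi.A" "y i \<in> car Fi.A" using x y i by (auto simp: car_direct_sum)
  have "coef (glue (mult DS x y)) (map g p) = coef (path_prod (F i) (x i) (y i)) p"
    using coef_glue[OF xy i p] i by (simp add: Fi.mult_A)
  also have "\<dots> = (\<Sum>j\<in>{0<..<length p}. coef (x i) (take j p) * coef (y i) (drop j p))"
    using Fi.coef_mult[OF car, of p] p by simp
  also have "\<dots> = (\<Sum>j\<in>{0<..<length p}. coef (glue x) (map g (take j p)) * coef (glue y) (map g (drop j p)))"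
  proof (rule sum.cong)
    fix j assume j: "j \<in> {0<..<length p}"
    then have "take j p \<noteq> []" "drop j p \<noteq> []" by auto
    from Fi.NP_append[OF this] p have "take j p \<in> nontrivial_paths (F i)" "drop j p \<in> nontrivial_paths (F i)"
      by auto
    then show "coef (x i) (take j p) * coef (y i) (drop j p) =
      coef (glue x) (map g (take j p)) * coef (glue y) (map g (drop j p))"
      by (simp add: coef_glue[OF x i] coef_glue[OF y i])
  qed simp
  also have "\<dots> = coef (path_prod Q (glue x) (glue y)) (map g p)"
    unfolding coef_mult[OF glue_in_car[OF x] glue_in_car[OF y]]
    using map_g_in_NP[OF i p] by (simp add: take_map drop_map)
  finally show "coef (glue (mult DS x y)) (map g p) = coef (path_prod Q (glue x) (glue y)) (map g p)" .
qed

lemma glue_add: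
  assumes x: "x \<in> car DS" and y: "y \<in> car DS"
  shows "glue (x + y) = glue x + glue y"
  using closed_algD(2)[OF closed_DS x y] closed_algD(2)[OF closed_A glue_in_car[OF x] glue_in_car[OF y]]
  by (intro poly_mapping_eq_on_map_g) (auto simp: glue_in_car coef_glue x y lookup_add)

lemma glue_scale:
  assumes x: "x \<in> car DS"
  shows "glue (scale DS c x) = scale A c (glue x)"
proof -
  have "coef (scale DS c x i) p = c * coef (x i) p" if "i < n" for i p
    using that path_algebra.scale_A[OF path_algebra_F, of i K] by (simp add: coef_scale)
  then show ?thesis
    using closed_algD(4)[OF closed_DS x] closed_algD(4)[OF closed_A glue_in_car[OF x]]
    by (intro poly_mapping_eq_on_map_g) (auto simp: glue_in_car coef_glue x scale_A coef_scale simp del: scale_direct_sum)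
qed

lemma glue_iso: "alg_iso glue DS A"
  unfolding alg_iso_def bij_betw_def
  using glue_inj glue_surj glue_in_car glue_mult glue_add glue_scale by (auto simp: mult_A)

lemma isomorphic_direct_sum: "alg_isomorphic A DS"
  using alg_iso_inv[OF glue_iso closed_DS] unfolding alg_isomorphic_def by blast

end

text \<open>The subquiver with arrows \<open>S\<close> and their endpoints, renamed along \<open>va\<close> and \<open>ar\<close>; \<open>g\<close> undoes \<open>ar\<close>.\<close>

definition relabel :: "('v \<Rightarrow> 'w) \<Rightarrow> ('a \<Rightarrow> 'b) \<Rightarrow> ('b \<Rightarrow> 'a) \<Rightarrow> ('v, 'a) pre_digraph \<Rightarrow> 'a set \<Rightarrow>
    ('w, 'b) pre_digraph" where
  "relabel va ar g Q S = \<lparr>verts = va ` (tail Q ` S \<union> head Q ` S), arcs = ar ` S,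
     tail = (\<lambda>a. va (tail Q (g a))), head = (\<lambda>a. va (head Q (g a)))\<rparr>"

section \<open>Splitting a quiver along classes of arrows\<close>

context path_algebra
begin

lemma quiver_relabel:
  assumes "S \<subseteq> arcs Q" "S \<noteq> {}" "\<And>a. a \<in> arcs Q \<Longrightarrow> g (ar a) = a"
  shows "quiver (relabel va ar g Q S)"
proof -
  have "finite S" using assms(1) finite_arcs by (rule finite_subset)
  then show ?thesis
    using assms by unfold_locales (auto simp: relabel_def subset_iff)
qed

lemma decomposition_relabel:
  assumes S: "\<And>i. i < n \<Longrightarrow> S i \<subseteq> arcs Q \<and> S i \<noteq> {}" "arcs Q = (\<Union>i<n. S i)"
    and sep: "\<And>i j a b. i < n \<Longrightarrow> j < n \<Longrightarrow> a \<in> S i \<Longrightarrow> b \<in> S j \<Longrightarrow> a = b \<or> head Q a = tail Q b \<Longrightarrow> i = j"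
    and va: "inj_on va (verts Q)" and ar: "\<And>a. a \<in> arcs Q \<Longrightarrow> g (ar a) = a"
  shows "decomposition Q n (\<lambda>i. relabel va ar g Q (S i)) g"
proof (intro decomposition.intro decomposition_axioms.intro path_algebra_axioms, goal_cases)
  case (1 i)
  then show ?case by (intro quiver_relabel) (use S(1) ar in auto)
next
  case (2 i)
  then have "g (ar a) = a" if "a \<in> S i" for a using S(1) ar that by blast
  then show ?case by (auto simp: relabel_def inj_on_def)
next
  case 3
  have "g ` ar ` S i = S i" if "i < n" for i
  proof -
    have "g (ar a) = a" if "a \<in> S i" for a using S(1)[OF \<open>i < n\<close>] ar that by blast
    then show ?thesis by (simp add: image_image)
  qed
  then show ?case unfolding S(2) by (simp add: relabel_def)
next
  case (4 i j a b)
  then obtain a' b' where *: "a' \<in> S i" "b' \<in> S j" "a = ar a'" "b = ar b'" by (auto simp: relabel_def)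
  then have "a' \<in> arcs Q" "b' \<in> arcs Q" using S(1) 4 by blast+
  then show ?case using sep[OF 4(1,2) *(1,2)] 4(5) * ar by simp
next
  case (5 i j a b)
  then obtain a' b' where *: "a' \<in> S i" "b' \<in> S j" "a = ar a'" "b = ar b'" by (auto simp: relabel_def)
  then have arc: "a' \<in> arcs Q" "b' \<in> arcs Q" using S(1) 5 by blast+
  then have "va (head Q a') = va (tail Q b') \<longleftrightarrow> head Q a' = tail Q b'"
    using inj_on_eq_iff[OF va] by simp
  then show ?case using sep[OF 5(1,2) *(1,2)] * ar arc by (auto simp: relabel_def)
qed

text \<open>A proper closed set and its complement never compose with each other and form two
  blocks. Arrows and vertices are renamed to natural numbers because \<open>alg_connected\<close>
  quantifies over such quivers.\<close>

lemma not_arc_connected_decomposes: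
  assumes "\<not> arc_connected Q"
  shows "\<not> alg_connected K Q"
proof -
  obtain S where S: "S \<subseteq> arcs Q" "S \<noteq> {}" "S \<noteq> arcs Q"
    and closed: "\<And>a b. a \<in> S \<Longrightarrow> b \<in> arcs Q \<Longrightarrow> head Q a = tail Q b \<or> head Q b = tail Q a \<Longrightarrow> b \<in> S"
    using assms unfolding arc_connected_def by blast
  define T :: "nat \<Rightarrow> 'a set" where "T i = (if i = 0 then S else arcs Q - S)" for i
  obtain va :: "'v \<Rightarrow> nat" where va: "inj_on va (verts Q)"
    using finite_imp_inj_to_nat_seg[OF finite_verts] by blast
  obtain ar :: "'a \<Rightarrow> nat" where ar: "inj_on ar (arcs Q)"
    using finite_imp_inj_to_nat_seg[OF finite_arcs] by blast
  let ?g = "inv_into (arcs Q) ar"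
  have two: "i = 0 \<or> i = 1" if "i < 2" for i :: nat using that by auto
  have "decomposition Q 2 (\<lambda>i. relabel va ar ?g Q (T i)) ?g"
  proof (rule decomposition_relabel[OF _ _ _ va])
    show "T i \<subseteq> arcs Q \<and> T i \<noteq> {}" for i using S by (auto simp: T_def)
    have "{..<2::nat} = {0, 1}" by auto
    then show "arcs Q = (\<Union>i<2. T i)" using S by (auto simp: T_def)
    show "i = j" if "i < 2" "j < 2" "a \<in> T i" "b \<in> T j" "a = b \<or> head Q a = tail Q b" for i j a b
      using two[OF that(1)] two[OF that(2)] that(3-5) closed[of a b] closed[of b a] S(1)
      by (auto simp: T_def)
    show "?g (ar a) = a" if "a \<in> arcs Q" for a using ar that by simp
  qed
  then interpret D: decomposition Q K 2 "\<lambda>i. relabel va ar ?g Q (T i)" ?g .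
  show ?thesis
    unfolding alg_connected_def using D.isomorphic_direct_sum D.quiver_F by fastforce
qed

end

section \<open>Connected arrows make the algebra indecomposable\<close>

lemma map_scale_zero: "Poly_Mapping.map ((*) (c :: 'k::semiring_0)) 0 = 0"
  by (rule poly_mapping_eqI) (simp add: coef_scale)

context path_algebra
begin

lemma coef_mult_singleton:
  assumes "f \<in> car A" "g \<in> car A"
  shows "coef (path_prod Q f g) [e] = 0"
  by (simp add: coef_mult[OF assms])

lemma coef_mult_pair:
  assumes "f \<in> car A" "g \<in> car A" "[a, b] \<in> NP"
  shows "coef (path_prod Q f g) [a, b] = coef f [a] * coef g [b]"
proof -
  have "{0<..<2} = {1::nat}" by auto
  then show ?thesis using assms(3) by (simp add: coef_mult[OF assms(1,2)] numeral_2_eq_2)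
qed

text \<open>An element without linear part is a sum of products.\<close>

lemma no_linear_part_image:
  assumes \<phi>: "alg_iso \<phi> A (direct_sum n (\<lambda>i. principal_subalg K (F i)))"
    and F: "\<And>i. i < n \<Longrightarrow> quiver (F i)"
    and y: "y \<in> car A" "\<And>a. a \<in> arcs Q \<Longrightarrow> coef y [a] = 0" and i: "i < n"
  shows "coef (\<phi> y i) [e] = 0"
proof -
  let ?DS = "direct_sum n (\<lambda>i. principal_subalg K (F i))"
  interpret Fi: path_algebra "F i" K by (intro path_algebra.intro F i)
  \<comment> \<open>Each path in the support is its first arrow times the rest, which is non-empty
    by hypothesis; the second factor carries the coefficient. The images of these products have no
    term of length one.\<close>
  define u where "u p = pe [hd p]" for p :: "'a list"
  define v where "v p = Poly_Mapping.single (tl p) (coef y p)" for p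
  have uv: "u p \<in> car A" "v p \<in> car A" "mult A (u p) (v p) = Poly_Mapping.single p (coef y p)"
    if "p \<in> Poly_Mapping.keys y" for p
  proof -
    have p: "p \<in> NP" using that y(1) by (auto simp: car_A)
    obtain a t where at: "p = a # t" using NP_not_Nil[OF p] by (cases p) auto
    have "t \<noteq> []"
    proof
      assume "t = []"
      then have "coef y p = 0" using y(2)[of a] p at by (simp add: NP_singleton)
      then show False using that by (simp add: in_keys_iff)
    qed
    then have "a \<in> arcs Q" "t \<in> NP" "head Q a = tail Q (hd t)" using p at by (auto simp: NP_Cons)
    then show "u p \<in> car A" "v p \<in> car A" "mult A (u p) (v p) = Poly_Mapping.single p (coef y p)"
      using at by (auto simp: u_def v_def mult_A path_prod_single NP_singleton intro!: single_in_car)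
  qed
  have "\<phi> (\<Sum>p\<in>Poly_Mapping.keys y. mult A (u p) (v p)) =
      (\<Sum>p\<in>Poly_Mapping.keys y. \<phi> (mult A (u p) (v p)))"
    by (rule alg_iso_sum[OF \<phi> closed_A]) (intro closed_algD(3)[OF closed_A] uv)
  also have "\<dots> = (\<Sum>p\<in>Poly_Mapping.keys y. mult ?DS (\<phi> (u p)) (\<phi> (v p)))"
    by (intro sum.cong refl alg_isoD(3)[OF \<phi>] uv)
  also have "(\<Sum>p\<in>Poly_Mapping.keys y. mult A (u p) (v p)) = y"
    using uv(3) by (simp flip: poly_mapping_sum_singles)
  finally have "\<phi> y i = (\<Sum>p\<in>Poly_Mapping.keys y. path_prod (F i) (\<phi> (u p) i) (\<phi> (v p) i))"
    using i by (simp add: sum_fun_apply Fi.mult_A)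
  moreover have "coef (path_prod (F i) (\<phi> (u p) i) (\<phi> (v p) i)) [e] = 0" if "p \<in> Poly_Mapping.keys y" for p
    using alg_isoD(5)[OF \<phi> uv(1)[OF that]] alg_isoD(5)[OF \<phi> uv(2)[OF that]] i
    by (intro Fi.coef_mult_singleton) (auto simp: car_direct_sum)
  ultimately show ?thesis by (simp add: lookup_sum)
qed

text \<open>A splitting into ideals \<open>I\<close> and \<open>J\<close> with \<open>I J = J I = 0\<close> labels each arrow by the ideal that
  contributes to its coefficient; composable arrows carry the same single label.\<close>

lemma arc_connected_imp_alg_connected:
  assumes conn: "arc_connected Q"
  shows "alg_connected K Q"
  unfolding alg_connected_def
proof clarify
  fix n :: nat and F :: "nat \<Rightarrow> (nat, nat) pre_digraph"
  assume n: "2 \<le> n" and F: "\<forall>i<n. quiver (F i)"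
    and "alg_isomorphic A (direct_sum n (\<lambda>i. principal_subalg K (F i)))"
  then obtain \<phi> where \<phi>: "alg_iso \<phi> A (direct_sum n (\<lambda>i. principal_subalg K (F i)))"
    by (auto simp: alg_isomorphic_def)
  let ?DS = "direct_sum n (\<lambda>i. principal_subalg K (F i))"
  have PF: "path_algebra (F i)" if "i < n" for i using F that by (intro path_algebra.intro) auto
  have closed_F: "closed_alg (principal_subalg K (F i))" if "i < n" for i
    using path_algebra.closed_A[OF PF[OF that]] .
  have pre: "\<exists>x\<in>car A. \<phi> x = z" if "z \<in> car ?DS" for z
    using bij_betw_imp_surj_on[OF alg_isoD(1)[OF \<phi>]] that by (metis imageE)
  have inj: "x = y" if "x \<in> car A" "y \<in> car A" "\<phi> x = \<phi> y" for x y
    using bij_betw_imp_inj_on[OF alg_isoD(1)[OF \<phi>]] that by (metis inj_onD)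
  have \<phi>0: "\<phi> 0 = 0" by (rule alg_iso_zero[OF \<phi> closed_A])
  \<comment> \<open>Pulled back to \<open>A\<close>, the ideal \<open>J\<close> is the summand 0 and
    \<open>I\<close> is the sum of all others.\<close>
  define I where "I = {x\<in>car A. \<phi> x 0 = 0}"
  define J where "J = {x\<in>car A. \<forall>i. i \<noteq> 0 \<longrightarrow> \<phi> x i = 0}"
  have IJ: "path_prod Q x y = 0" "path_prod Q y x = 0" if x: "x \<in> I" and y: "y \<in> J" for x y
  proof -
    have car: "x \<in> car A" "y \<in> car A" using x y by (auto simp: I_def J_def)
    have zero: "\<phi> x i = 0 \<or> \<phi> y i = 0" for i using x y by (cases "i = 0") (auto simp: I_def J_def)
    have "mult ?DS (\<phi> x) (\<phi> y) i = 0" "mult ?DS (\<phi> y) (\<phi> x) i = 0" for i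
      using zero[of i] path_algebra.mult_A[OF PF, of i K] by auto
    then have "mult ?DS (\<phi> x) (\<phi> y) = 0" "mult ?DS (\<phi> y) (\<phi> x) = 0" by (simp_all add: fun_eq_iff)
    then have "\<phi> (path_prod Q x y) = \<phi> 0" "\<phi> (path_prod Q y x) = \<phi> 0"
      using alg_isoD(3)[OF \<phi> car] alg_isoD(3)[OF \<phi> car(2,1)] \<phi>0 by (simp_all add: mult_A)
    moreover have "path_prod Q x y \<in> car A" "path_prod Q y x \<in> car A" "0 \<in> car A"
      using closed_algD[OF closed_A] car by (auto simp: mult_A)
    ultimately show "path_prod Q x y = 0" "path_prod Q y x = 0" using inj by blast+
  qed
  define SI where "SI = {a\<in>arcs Q. \<exists>x\<in>I. coef x [a] \<noteq> 0}"
  define SJ where "SJ = {a\<in>arcs Q. \<exists>x\<in>J. coef x [a] \<noteq> 0}"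
  \<comment> \<open>Splitting the arrow into its parts in \<open>I\<close> and \<open>J\<close>
    splits its coefficient 1 into a sum, so one part has a non-zero coefficient there.\<close>
  have cover: "a \<in> SI \<or> a \<in> SJ" if a: "a \<in> arcs Q" for a
  proof -
    have pa: "pe [a] \<in> car A" using a by (intro single_in_car) (simp add: NP_singleton)
    let ?z = "\<phi> (pe [a])"
    have z: "?z \<in> car ?DS" by (rule alg_isoD(5)[OF \<phi> pa])
    have "(\<lambda>i. if i = 0 then 0 else ?z i) \<in> car ?DS" "(\<lambda>i. if i = 0 then ?z i else 0) \<in> car ?DS"
      using z n closed_algD(1)[OF closed_F] by (auto simp: car_direct_sum)
    from pre[OF this(1)] pre[OF this(2)] obtain x y
      where x: "x \<in> car A" "\<phi> x = (\<lambda>i. if i = 0 then 0 else ?z i)"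
        and y: "y \<in> car A" "\<phi> y = (\<lambda>i. if i = 0 then ?z i else 0)" by blast
    have "\<phi> (x + y) = ?z"
      unfolding alg_isoD(2)[OF \<phi> x(1) y(1)] x(2) y(2) by (auto simp: fun_eq_iff)
    then have "x + y = pe [a]" using inj closed_algD(2)[OF closed_A x(1) y(1)] pa by blast
    then have "coef x [a] + coef y [a] = 1" by (metis lookup_add lookup_single_eq)
    then have "coef x [a] \<noteq> 0 \<or> coef y [a] \<noteq> 0" by auto
    moreover have "x \<in> I" "y \<in> J" using x y by (auto simp: I_def J_def)
    ultimately show ?thesis using a by (auto simp: SI_def SJ_def)
  qed
  have sep: "\<not> (a \<in> SI \<and> b \<in> SJ)" "\<not> (a \<in> SJ \<and> b \<in> SI)"
    if ab: "a \<in> arcs Q" "b \<in> arcs Q" "head Q a = tail Q b" for a b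
  proof -
    have NP: "[a, b] \<in> NP" using ab by (simp add: NP_Cons NP_singleton)
    have "coef x [a] * coef y [b] = 0" "coef y [a] * coef x [b] = 0" if x: "x \<in> I" and y: "y \<in> J" for x y
    proof -
      have car: "x \<in> car A" "y \<in> car A" using x y by (auto simp: I_def J_def)
      show "coef x [a] * coef y [b] = 0" "coef y [a] * coef x [b] = 0"
        using coef_mult_pair[OF car NP] coef_mult_pair[OF car(2,1) NP] IJ[OF x y] by simp_all
    qed
    then show "\<not> (a \<in> SI \<and> b \<in> SJ)" "\<not> (a \<in> SJ \<and> b \<in> SI)"
      unfolding SI_def SJ_def by fastforce+
  qed
  \<comment> \<open>A neighbour of an arrow in one label set has some label by \<open>cover\<close>,
    and not the other one by \<open>sep\<close>; so each label set is closed.\<close>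
  have all_or_none: "S = {} \<or> S = arcs Q" if "S = SI \<or> S = SJ" for S
  proof (cases "S = {}")
    case False
    have "S = arcs Q"
    proof (rule arc_connectedD[OF conn _ False])
      show "S \<subseteq> arcs Q" using that by (auto simp: SI_def SJ_def)
      then show "b \<in> S" if "a \<in> S" "b \<in> arcs Q" "head Q a = tail Q b" for a b
        using \<open>S = SI \<or> S = SJ\<close> that sep[of a b] cover[of b] by blast
      show "b \<in> S" if "a \<in> S" "b \<in> arcs Q" "head Q b = tail Q a" for a b
        using \<open>S = SI \<or> S = SJ\<close> \<open>S \<subseteq> arcs Q\<close> that sep[of b a] cover[of b] by blast
    qed
    then show ?thesis by simp
  qed simp
  \<comment> \<open>Each summand contains an arrow of its own quiver; the preimage of that arrow has
    a linear part, since otherwise its image would have no term of length one.\<close>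
  have nonempty: "\<exists>y\<in>car A. (\<forall>j. j \<noteq> i \<longrightarrow> \<phi> y j = 0) \<and> (\<exists>a\<in>arcs Q. coef y [a] \<noteq> 0)" if i: "i < n" for i
  proof -
    interpret Fi: path_algebra "F i" K by (rule PF[OF i])
    obtain e where e: "e \<in> arcs (F i)" using Fi.arcs_nonempty by auto
    have "(\<lambda>j. if j = i then Fi.pe [e] else 0) \<in> car ?DS"
      using closed_F i e by (intro single_component_in_direct_sum Fi.single_in_car) (auto simp: Fi.NP_singleton)
    from pre[OF this] obtain y where y: "y \<in> car A" "\<phi> y = (\<lambda>j. if j = i then Fi.pe [e] else 0)" by blast
    then have "coef (\<phi> y i) [e] \<noteq> 0" by simp
    then show ?thesis using no_linear_part_image[OF \<phi> _ y(1) _ i] F y by (metis (no_types, lifting))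
  qed
  obtain y a where "y \<in> car A" "\<forall>j. j \<noteq> 0 \<longrightarrow> \<phi> y j = 0" "a \<in> arcs Q" "coef y [a] \<noteq> 0"
    using nonempty[of 0] n by auto
  then have "a \<in> SJ" unfolding SJ_def J_def by blast
  moreover obtain x b where "x \<in> car A" "\<forall>j. j \<noteq> 1 \<longrightarrow> \<phi> x j = 0" "b \<in> arcs Q" "coef x [b] \<noteq> 0"
    using nonempty[of 1] n by auto
  then have "b \<in> SI" unfolding SI_def I_def by auto
  ultimately have S: "SI = arcs Q" "SJ = arcs Q" using all_or_none by blast+
  \<comment> \<open>Every arrow carries both labels, which composable arrows cannot. What remains is
    a single arrow with zero square.\<close>
  have not_comp: "head Q a \<noteq> tail Q b" if "a \<in> arcs Q" "b \<in> arcs Q" for a b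
    using sep[OF that] S that by auto
  obtain a where a: "a \<in> arcs Q" using arcs_nonempty by blast
  have "{a} = arcs Q" by (rule arc_connectedD[OF conn]) (use a not_comp in auto)
  have NP: "NP = {[a]}"
  proof (intro subset_antisym subsetI)
    fix p assume p: "p \<in> NP"
    then obtain c t where ct: "p = c # t" using NP_not_Nil by (cases p) auto
    have "t = []"
    proof (rule ccontr)
      assume t: "t \<noteq> []"
      then have "c \<in> arcs Q" "head Q c = tail Q (hd t)" "hd t \<in> arcs Q"
        using p ct NP_arcs[OF p] by (auto simp: NP_Cons)
      then show False using not_comp by blast
    qed
    then show "p \<in> {[a]}" using NP_arcs[OF p] ct \<open>{a} = arcs Q\<close> by auto
  qed (use a in \<open>simp add: NP_singleton\<close>)
  obtain x y where x: "x \<in> I" "coef x [a] \<noteq> 0" and y: "y \<in> J" "coef y [a] \<noteq> 0"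
  proof -
    have "a \<in> SI" "a \<in> SJ" using a S by simp_all
    then show ?thesis using that unfolding SI_def SJ_def by blast
  qed
  have car: "x \<in> car A" "y \<in> car A" using x y by (auto simp: I_def J_def)
  \<comment> \<open>In a one-dimensional algebra \<open>y\<close> is a multiple of \<open>x\<close>,
    so it lies in both ideals and is zero.\<close>
  let ?c = "coef y [a] / coef x [a]"
  have coef_y: "coef y p = ?c * coef x p" for p
    using x(2) coef_notin[OF car(1), of p] coef_notin[OF car(2), of p] NP by (cases "p = [a]") auto
  have yx: "y = scale A ?c x"
    by (rule poly_mapping_eqI) (simp only: scale_A coef_scale coef_y[symmetric])
  have "\<phi> y i = 0" for i
  proof (cases "i = 0")
    case True
    have "\<phi> y 0 = scale ?DS ?c (\<phi> x) 0" by (subst yx) (simp only: alg_isoD(4)[OF \<phi> car(1)])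
    also have "\<dots> = 0"
      using x(1) n path_algebra.scale_A[OF PF, of 0 K] by (simp add: I_def map_scale_zero)
    finally show ?thesis using True by simp
  qed (use y in \<open>simp add: J_def\<close>)
  then have "\<phi> y = \<phi> 0" using \<phi>0 by (simp add: fun_eq_iff)
  then have "y = 0" using inj[OF car(2)] closed_algD(1)[OF closed_A] by blast
  then show False using y(2) by simp
qed

lemma alg_connected_iff: "alg_connected K Q \<longleftrightarrow> arc_connected Q"
  using not_arc_connected_decomposes arc_connected_imp_alg_connected by blast

text \<open>The components are the classes of arrows under chains of composable neighbours, each
  taken with its endpoints.\<close>

lemma components_exist:
  "\<exists>n E. alg_components K Q n E \<and>
     alg_iso (\<lambda>x. \<Sum>i<n. x i) (direct_sum n (\<lambda>i. principal_subalg K (E i))) A"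
proof -
  define R where "R = {(a, b). a \<in> arcs Q \<and> b \<in> arcs Q \<and> (head Q a = tail Q b \<or> head Q b = tail Q a)}"
  define cls where "cls a = {b. (a, b) \<in> R\<^sup>*}" for a
  have "sym (R\<^sup>*)" by (intro sym_rtrancl symI) (auto simp: R_def)
  then have sym: "(b, a) \<in> R\<^sup>*" if "(a, b) \<in> R\<^sup>*" for a b using that by (rule symD)
  have cls_eq: "cls a = cls b" if "(a, b) \<in> R\<^sup>*" for a b
    using that sym[OF that] unfolding cls_def by (auto intro: rtrancl_trans)
  have cls_sub: "cls a \<subseteq> arcs Q" if "a \<in> arcs Q" for a
  proof
    fix b assume "b \<in> cls a"
    then have "(a, b) \<in> R\<^sup>*" by (simp add: cls_def)
    then show "b \<in> arcs Q" by (induction rule: rtrancl_induct) (auto simp: R_def that)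
  qed
  have "finite (cls ` arcs Q)" by simp
  from ex_bij_betw_nat_finite[OF this] obtain S
    where S: "bij_betw S {0..<card (cls ` arcs Q)} (cls ` arcs Q)" by blast
  define n where "n = card (cls ` arcs Q)"
  have S_im: "S ` {..<n} = cls ` arcs Q" and S_inj: "inj_on S {..<n}"
    using S by (auto simp: n_def bij_betw_def atLeast0LessThan)
  have S_cls: "\<exists>a\<in>arcs Q. S i = cls a" if "i < n" for i using S_im that by blast
  have S_prop: "S i \<subseteq> arcs Q \<and> S i \<noteq> {}" if "i < n" for i
    using S_cls[OF that] cls_sub by (auto simp: cls_def)
  have S_mem: "S i = cls a" if i: "i < n" and a: "a \<in> S i" for i a
  proof -
    obtain c where c: "S i = cls c" using S_cls[OF i] by blast
    then show ?thesis using a cls_eq[of c a] by (simp add: cls_def)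
  qed
  have cover: "arcs Q = (\<Union>i<n. S i)"
  proof (intro subset_antisym subsetI)
    fix a assume a: "a \<in> arcs Q"
    then obtain i where "i < n" "S i = cls a" using S_im by (metis imageE imageI lessThan_iff)
    moreover have "a \<in> cls a" by (simp add: cls_def)
    ultimately show "a \<in> (\<Union>i<n. S i)" by auto
  qed (use S_prop in auto)
  have nb: "b \<in> S i" if i: "i < n" and a: "a \<in> S i" and b: "b \<in> arcs Q"
    and ab: "head Q a = tail Q b \<or> head Q b = tail Q a" for i a b
  proof -
    have "(a, b) \<in> R" using a b ab S_prop[OF i] by (auto simp: R_def)
    then show ?thesis using S_mem[OF i a] by (simp add: cls_def)
  qed
  have sep: "i = j" if i: "i < n" and j: "j < n" and a: "a \<in> S i" and b: "b \<in> S j"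
    and ab: "a = b \<or> head Q a = tail Q b" for i j a b
  proof -
    have "b \<in> S i" using ab a nb[OF i a, of b] S_prop[OF j] b by blast
    then have "S i = S j" using S_mem[OF i] S_mem[OF j b] by simp
    then show ?thesis using inj_onD[OF S_inj] i j by simp
  qed
  define E where "E i = relabel id id id Q (S i)" for i
  have E_simps: "verts (E i) = tail Q ` S i \<union> head Q ` S i" "arcs (E i) = S i"
    "tail (E i) = tail Q" "head (E i) = head Q" for i
    by (auto simp: E_def relabel_def)
  have "decomposition Q n E id"
    unfolding E_def by (rule decomposition_relabel) (use S_prop cover sep in auto)
  then interpret D: decomposition Q K n E id .
  \<comment> \<open>With \<open>g = id\<close> the isomorphism is the plain sum, so the
    decomposition is internal.\<close>
  have glue: "D.glue = (\<lambda>x. \<Sum>i<n. x i)"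
    by (rule ext) (simp add: D.glue_def push_id)
  have "alg_connected K (E i)" if i: "i < n" for i
  proof -
    interpret Ei: path_algebra "E i" K by (rule D.path_algebra_F[OF i])
    \<comment> \<open>A closed set that contains \<open>t\<close> contains every arrow of
      \<open>S i\<close> reached from \<open>t\<close>, and the class \<open>S i\<close> is reached
      from any of its members.\<close>
    have "T = S i" if T: "T \<subseteq> S i" "T \<noteq> {}"
      and closed: "\<forall>a\<in>T. \<forall>b\<in>S i. head Q a = tail Q b \<or> head Q b = tail Q a \<longrightarrow> b \<in> T" for T
    proof -
      obtain t where t: "t \<in> T" using T by blast
      have "b \<in> T" if "(t, b) \<in> R\<^sup>*" for b
        using that
      proof (induction rule: rtrancl_induct)
        case (step b c)
        then have "c \<in> S i" using nb[OF i, of b c] T by (auto simp: R_def)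
        moreover have "head Q b = tail Q c \<or> head Q c = tail Q b" using step(2) by (auto simp: R_def)
        ultimately show ?case using closed step(3) by blast
      qed (rule t)
      moreover have "S i = cls t" using S_mem[OF i] t T by blast
      ultimately show ?thesis using T by (auto simp: cls_def)
    qed
    then have "arc_connected (E i)" unfolding arc_connected_def E_simps by blast
    then show ?thesis by (rule Ei.arc_connected_imp_alg_connected)
  qed
  moreover have "subgraph (E i) Q" if i: "i < n" for i
  proof -
    interpret Ei: path_algebra "E i" K by (rule D.path_algebra_F[OF i])
    show ?thesis
      unfolding subgraph_def using S_prop[OF i] Ei.wf_digraph wf_digraph
      by (auto simp: E_simps compatible_def)
  qed
  moreover have "no_isolated_points (E i)" for i
    by (auto simp: no_isolated_points_def isolated_point_def E_simps)
  ultimately have "alg_components K Q n E"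
    unfolding alg_components_def using D.quiver_F D.isomorphic_direct_sum by blast
  then show ?thesis using D.glue_iso glue by auto
qed

end

lemma (in path_algebra) circle_center:
  assumes n: "n \<ge> 1" and h: "pre_digraph.digraph_isomorphism (circle n) h" "Q = app_iso h (circle n)"
  shows "center A =
      {\<Sum>i = 1..n. poly_at A f (path_elem K (circle_path n (iso_arcs h) i)) | f. poly f 0 = 0}"
    and "alg_isomorphic (center_alg A) (polys_no_const K)"
    and "n = 1 \<Longrightarrow> center A = car A" and "n = 1 \<Longrightarrow> center3 A = car A"
proof -
  interpret C: circle_algebra Q K n "\<lambda>k. iso_arcs h (k mod n + 1)"
    by (rule circle_algebraI[OF _ n h]) unfold_locales
  have "(\<Sum>i = 1..n. poly_at A f (path_elem K (circle_path n (iso_arcs h) i))) = C.poly_elem f" for f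
  proof -
    have "circle_path n (iso_arcs h) (Suc k) = C.P k n" if "k < n" for k
      unfolding C.P_def using circle_path_eq[of "Suc k" n "iso_arcs h"] that by simp
    then show ?thesis
      unfolding C.poly_elem_eq_poly_at by (simp add: sum.atLeast1_atMost_eq)
  qed
  then show "center A =
      {\<Sum>i = 1..n. poly_at A f (path_elem K (circle_path n (iso_arcs h) i)) | f. poly f 0 = 0}"
    using C.center_eq_poly_elem by simp
  show "alg_isomorphic (center_alg A) (polys_no_const K)" by (rule C.center_isomorphic_polys)
  show "n = 1 \<Longrightarrow> center A = car A" by (rule C.loop_commutative)
  show "n = 1 \<Longrightarrow> center3 A = car A" by (rule C.loop_center3)
qed

theorem theorem1p4:
  fixes Q :: "('v, 'a) pre_digraph"
    and K :: "'k::field_char_0 itself"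
  assumes "quiver Q" and "no_isolated_points Q"
  shows
    "(\<comment> \<open>the algebraically connected components exist, as an internal direct decomposition\<close>
      \<exists>n E. alg_components K Q n E \<and>
        alg_iso (\<lambda>x. \<Sum>i<n. x i) (direct_sum n (\<lambda>i. principal_subalg K (E i))) (principal_subalg K Q)) \<and>
     (\<comment> \<open>(i)\<close>
      (\<forall>n E \<phi>. alg_components K Q n E \<and>
         alg_iso \<phi> (direct_sum n (\<lambda>i. principal_subalg K (E i))) (principal_subalg K Q) \<longrightarrow>
         alg_iso \<phi> (direct_sum n (\<lambda>i. center_alg (principal_subalg K (E i))))
           (center_alg (principal_subalg K Q))) \<and>
      (alg_connected K Q \<and> \<not> (\<exists>n\<ge>1. digraph_iso (circle n) Q) \<longrightarrow>
         center (principal_subalg K Q) =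
           alg_span (principal_subalg K Q)
             {path_elem K p | p. p \<in> nontrivial_paths Q \<and> two_sided_unextendable K Q p}) \<and>
      (\<forall>n\<ge>1. \<forall>h. pre_digraph.digraph_isomorphism (circle n) h \<and> Q = app_iso h (circle n) \<longrightarrow>
         center (principal_subalg K Q) =
           {\<Sum>i = 1..n. poly_at (principal_subalg K Q) f (path_elem K (circle_path n (iso_arcs h) i)) | f.
              poly f 0 = 0} \<and>
         alg_isomorphic (center_alg (principal_subalg K Q)) (polys_no_const K))) \<and>
     (\<comment> \<open>(ii)\<close>
      (\<forall>n E \<phi>. alg_components K Q n E \<and>
         alg_iso \<phi> (direct_sum n (\<lambda>i. principal_subalg K (E i))) (principal_subalg K Q) \<longrightarrow>
         alg_iso \<phi> (direct_sum n (\<lambda>i. center3_alg (principal_subalg K (E i))))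
           (center3_alg (principal_subalg K Q))) \<and>
      (alg_connected K Q \<and> \<not> digraph_iso (circle 1) Q \<longrightarrow>
         center3 (principal_subalg K Q) =
           alg_span (principal_subalg K Q)
             {path_elem K p | p. p \<in> nontrivial_paths Q \<and> property_star K Q p}) \<and>
      (digraph_iso (circle 1) Q \<longrightarrow>
         center3 (principal_subalg K Q) = car (principal_subalg K Q) \<and>
         alg_isomorphic (principal_subalg K Q) (polys_no_const K)))"
proof -
  interpret path_algebra Q K by (intro path_algebra.intro assms)
  have closed_DS: "closed_alg (direct_sum n (\<lambda>i. principal_subalg K (E i)))"
    if "alg_components K Q n E" for n and E :: "nat \<Rightarrow> ('v, 'a) pre_digraph"
    using that
    by (intro direct_sum_closed path_algebra.closed_A path_algebra.intro) (auto simp: alg_components_def)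
  have closed_E: "closed_alg (principal_subalg K (E i))"
    if "alg_components K Q n E" "i < n" for n i and E :: "nat \<Rightarrow> ('v, 'a) pre_digraph"
    using that by (intro path_algebra.closed_A path_algebra.intro) (auto simp: alg_components_def)
  show ?thesis
  proof (intro conjI allI impI)
    show "\<exists>n E. alg_components K Q n E \<and>
        alg_iso (\<lambda>x. \<Sum>i<n. x i) (direct_sum n (\<lambda>i. principal_subalg K (E i))) A"
      by (rule components_exist)
  next
    fix n \<phi> and E :: "nat \<Rightarrow> ('v, 'a) pre_digraph"
    assume "alg_components K Q n E \<and> alg_iso \<phi> (direct_sum n (\<lambda>i. principal_subalg K (E i))) A"
    then have E: "alg_components K Q n E"
      and iso: "alg_iso \<phi> (direct_sum n (\<lambda>i. principal_subalg K (E i))) A" by simp_all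
    \<comment> \<open>With centers moved outside the direct sum, the claims are restrictions of the
      given isomorphism.\<close>
    have eq: "direct_sum n (\<lambda>i. center_alg (principal_subalg K (E i))) =
        center_alg (direct_sum n (\<lambda>i. principal_subalg K (E i)))"
      "direct_sum n (\<lambda>i. center3_alg (principal_subalg K (E i))) =
        center3_alg (direct_sum n (\<lambda>i. principal_subalg K (E i)))"
      by (rule center_direct_sum[symmetric] center3_direct_sum[symmetric], rule closed_E[OF E], assumption)+
    show "alg_iso \<phi> (direct_sum n (\<lambda>i. center_alg (principal_subalg K (E i)))) (center_alg A)"
      unfolding eq by (rule alg_iso_center[OF iso closed_DS[OF E]])
    show "alg_iso \<phi> (direct_sum n (\<lambda>i. center3_alg (principal_subalg K (E i)))) (center3_alg A)"
      unfolding eq by (rule alg_iso_center3[OF iso closed_DS[OF E]])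
  next
    assume "alg_connected K Q \<and> \<not> (\<exists>n\<ge>1. digraph_iso (circle n) Q)"
    then show "center A = alg_span A {path_elem K p | p. p \<in> NP \<and> two_sided_unextendable K Q p}"
      using center_noncircle assms(2) alg_connected_iff by blast
  next
    assume "alg_connected K Q \<and> \<not> digraph_iso (circle 1) Q"
    then show "center3 A = alg_span A {path_elem K p | p. p \<in> NP \<and> property_star K Q p}"
      using center3_eq_span alg_connected_iff by blast
  next
    fix n h
    assume "1 \<le> n" and "pre_digraph.digraph_isomorphism (circle n) h \<and> Q = app_iso h (circle n)"
    then show "center A =
        {\<Sum>i = 1..n. poly_at A f (path_elem K (circle_path n (iso_arcs h) i)) | f. poly f 0 = 0}"
      and "alg_isomorphic (center_alg A) (polys_no_const K)"
      using circle_center by blast+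
  next
    assume "digraph_iso (circle 1) Q"
    then obtain h where "pre_digraph.digraph_isomorphism (circle 1) h" "Q = app_iso h (circle 1)"
      by (auto simp: digraph_iso_def)
    note C = circle_center(2-4)[OF order_refl this]
    show "center3 A = car A" using C(3) by simp
    \<comment> \<open>The center is the whole algebra here, so the isomorphism of the center with
      the polynomials is already the claim.\<close>
    show "alg_isomorphic A (polys_no_const K)" using C(1) C(2) by simp
  qed
qed

end
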